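(* Let $N\ge1$, $s\in(0,1)$, let $\Omega\subset\mathbb{R}^N$ be a $C^{1,1}$ bounded domain that is star-shaped with respect to the origin, and let $B_\delta(0)$ be a ball centered at the origin with radius $\delta>0$ such that $B_\delta(0)\subset\Omega$. Let $\mathcal{A}$ be the set of all $u_0\in C_0^\infty(\Omega)$ with $\operatorname{supp}u_0\subset B_\delta(0)$ and $u_0(x)=-u_0(-x)$ for $x\in B_\delta(0)$. For $u_0\in\mathcal{A}$ let $u$ be the solution of $$\partial_t u+(-\Delta)^su=0\ \text{ in }\Omega\times(0,\infty),\quad u(x,0)=u_0(x)\ \text{ for }x\in\Omega,\quad u(x,t)=0\ \text{ for }x\in\mathbb{R}^N\setminus\Omega,\ t>0.$$ Then the following conditions are equivalent: (1) $u(0,t)=0$ for any $t>0$ and any $u_0\in\mathcal{A}$; (2) $\Omega$ is centrosymmetric with respect to the origin, i.e. $x\in\Omega\implies-x\in\Omega$.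
   Context: A domain is a connected open set; $B_r(0)$ is the open ball of radius $r$ centered at the origin; star-shaped with respect to the origin means that the segment from $0$ to $x$ lies in $\Omega$ for every $x\in\Omega$. The fractional Laplacian is $(-\Delta)^s u(x)=c_{N,s}\lim_{\varepsilon\to0^+}\int_{|y-x|>\varepsilon}\frac{u(x)-u(y)}{|x-y|^{N+2s}}\,dy$ with $c_{N,s}=\frac{2^{2s}s\,\Gamma((N+2s)/2)}{\pi^{N/2}\Gamma(1-s)}$. Put $\mathcal{E}_s[u,v]=\iint_{\mathbb{R}^{2N}}\frac{(u(x)-u(y))(v(x)-v(y))}{|x-y|^{N+2s}}dx\,dy$ and $\widetilde{H}^s(\Omega)=\{u\in L^2(\mathbb{R}^N):\mathcal{E}_s[u,u]<\infty,\ u\equiv0\text{ on }\mathbb{R}^N\setminus\Omega\}$. The solution of the initial-boundary value problem is the one given by separation of variables: $u(x,t)=\sum_k e^{-\lambda_kt}\langle u_0,\phi_k\rangle_{L^2(\Omega)}\phi_k(x)$, where $\{\phi_k\}\subset\widetilde{H}^s(\Omega)$ is an $L^2(\Omega)$-orthonormal basis of eigenfunctions of $(-\Delta)^s$ with zero exterior condition, i.e. $\frac{c_{N,s}}{2}\mathcal{E}_s[\phi_k,v]=\lambda_k\langle\phi_k,v\rangle_{L^2}$ for all $v\in\widetilde{H}^s(\Omega)$; $u(\cdot,t)$ is smooth in $\Omega$ for $t>0$. *)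

theory Defs
  imports "HOL-Analysis.Analysis"
begin

section \<open>Smooth functions on open sets\<close>

text \<open>For open \<open>S\<close>: \<open>f\<close> is \<open>k\<close> times continuously differentiable on \<open>S\<close>. The vectors
  \<open>axis i 1\<close> are the standard basis, so the recursion runs through the partial derivatives.\<close>

primrec Ck_on :: "nat \<Rightarrow> (real ^ 'n) set \<Rightarrow> (real ^ 'n \<Rightarrow> real) \<Rightarrow> bool" where
  "Ck_on 0 S f \<longleftrightarrow> continuous_on S f"
| "Ck_on (Suc k) S f \<longleftrightarrow>
     (\<forall>x\<in>S. f differentiable (at x)) \<and>
     (\<forall>i. Ck_on k S (\<lambda>x. frechet_derivative f (at x) (axis i 1)))"

definition smooth_on :: "(real ^ 'n) set \<Rightarrow> (real ^ 'n \<Rightarrow> real) \<Rightarrow> bool" where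
  "smooth_on S f \<longleftrightarrow> (\<forall>k. Ck_on k S f)"

definition supp :: "(real ^ 'n \<Rightarrow> real) \<Rightarrow> (real ^ 'n) set" where
  "supp f = closure {x. f x \<noteq> 0}"

text \<open>Elements of \<open>C\<^sub>0\<^sup>\<infinity>(\<Omega>)\<close> are taken to be extended by zero to the whole space.\<close>

definition test_functions :: "(real ^ 'n) set \<Rightarrow> (real ^ 'n \<Rightarrow> real) set" where
  "test_functions \<Omega> = {f. smooth_on UNIV f \<and> compact (supp f) \<and> supp f \<subseteq> \<Omega>}"


section \<open>Domains\<close>

definition is_domain :: "(real ^ 'n) set \<Rightarrow> bool" where
  "is_domain \<Omega> \<longleftrightarrow> open \<Omega> \<and> connected \<Omega>"

definition C11_function :: "(real ^ 'n \<Rightarrow> real) \<Rightarrow> bool" where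
  "C11_function g \<longleftrightarrow>
     (\<exists>G L. (\<forall>x. (g has_derivative (\<lambda>h. G x \<bullet> h)) (at x)) \<and> L-lipschitz_on UNIV G)"

text \<open>Near each boundary point \<open>\<Omega>\<close> is, in a suitable orthogonal coordinate system, the region
  strictly above the graph of a \<open>C\<^sup>1\<^sup>,\<^sup>1\<close> function of the other \<open>N - 1\<close> coordinates. The unit
  vector \<open>e\<close> is the vertical direction. The graph function is a function on the hyperplane
  orthogonal to \<open>e\<close>; since such a function is \<open>C\<^sup>1\<^sup>,\<^sup>1\<close> iff its extension constant
  along \<open>e\<close> is, it is represented by a function \<open>g\<close> on the whole space that is only evaluated
  at projections onto that hyperplane.\<close>

definition C11_boundary :: "(real ^ 'n) set \<Rightarrow> bool" where
  "C11_boundary \<Omega> \<longleftrightarrow>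
     (\<forall>p\<in>frontier \<Omega>. \<exists>r>0. \<exists>e g. norm e = 1 \<and> C11_function g \<and>
        \<Omega> \<inter> ball p r = {x \<in> ball p r. x \<bullet> e > g (x - (x \<bullet> e) *\<^sub>R e)})"

definition star_shaped_origin :: "(real ^ 'n) set \<Rightarrow> bool" where
  "star_shaped_origin \<Omega> \<longleftrightarrow> (\<forall>x\<in>\<Omega>. closed_segment 0 x \<subseteq> \<Omega>)"

definition centrosymmetric :: "(real ^ 'n) set \<Rightarrow> bool" where
  "centrosymmetric \<Omega> \<longleftrightarrow> (\<forall>x. x \<in> \<Omega> \<longrightarrow> - x \<in> \<Omega>)"


section \<open>The space \<open>L\<^sup>2(\<Omega>)\<close>\<close>

definition L2_on :: "(real ^ 'n) set \<Rightarrow> (real ^ 'n \<Rightarrow> real) set" where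
  "L2_on \<Omega> = {f. set_borel_measurable lebesgue \<Omega> f \<and> set_integrable lebesgue \<Omega> (\<lambda>x. (f x)\<^sup>2)}"

definition L2_inner :: "(real ^ 'n) set \<Rightarrow> (real ^ 'n \<Rightarrow> real) \<Rightarrow> (real ^ 'n \<Rightarrow> real) \<Rightarrow> real" where
  "L2_inner \<Omega> f g = (LINT x:\<Omega>|lebesgue. f x * g x)"

text \<open>Convergence of the series \<open>\<Sum>k. f k\<close> to \<open>g\<close> in \<open>L\<^sup>2(\<Omega>)\<close>. The membership conditions are
  needed because the integral of a non-integrable function is \<open>0\<close> by convention.\<close>

definition L2_sums ::
    "(real ^ 'n) set \<Rightarrow> (nat \<Rightarrow> real ^ 'n \<Rightarrow> real) \<Rightarrow> (real ^ 'n \<Rightarrow> real) \<Rightarrow> bool" where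
  "L2_sums \<Omega> f g \<longleftrightarrow> (\<forall>k. f k \<in> L2_on \<Omega>) \<and> g \<in> L2_on \<Omega> \<and>
     (\<lambda>n. LINT x:\<Omega>|lebesgue. (g x - (\<Sum>k<n. f k x))\<^sup>2) \<longlonglongrightarrow> 0"

definition L2_orthonormal_basis :: "(real ^ 'n) set \<Rightarrow> (nat \<Rightarrow> real ^ 'n \<Rightarrow> real) \<Rightarrow> bool" where
  "L2_orthonormal_basis \<Omega> \<phi> \<longleftrightarrow>
     (\<forall>k. \<phi> k \<in> L2_on \<Omega>) \<and>
     (\<forall>j k. L2_inner \<Omega> (\<phi> j) (\<phi> k) = (if j = k then 1 else 0)) \<and>
     (\<forall>f\<in>L2_on \<Omega>. L2_sums \<Omega> (\<lambda>k x. L2_inner \<Omega> f (\<phi> k) * \<phi> k x) f)"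


section \<open>The fractional Laplacian and its eigenfunctions\<close>

definition frac_const :: "'n itself \<Rightarrow> real \<Rightarrow> real" where
  "frac_const _ s =
     2 powr (2 * s) * s * Gamma ((real CARD('n) + 2 * s) / 2) /
     (pi powr (real CARD('n) / 2) * Gamma (1 - s))"

text \<open>\<open>L\<close> is the (principal) value of the fractional Laplacian of order \<open>s\<close> of \<open>u\<close> at \<open>x\<close>.\<close>

definition has_frac_laplacian :: "real \<Rightarrow> (real ^ 'n \<Rightarrow> real) \<Rightarrow> real ^ 'n \<Rightarrow> real \<Rightarrow> bool" where
  "has_frac_laplacian s u x L \<longleftrightarrow>
     (\<forall>\<epsilon>>0. set_integrable lebesgue {y. norm (y - x) > \<epsilon>}
        (\<lambda>y. (u x - u y) / norm (x - y) powr (real CARD('n) + 2 * s))) \<and>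
     ((\<lambda>\<epsilon>. frac_const TYPE('n) s *
        (LINT y:{y. norm (y - x) > \<epsilon>}|lebesgue.
           (u x - u y) / norm (x - y) powr (real CARD('n) + 2 * s))) \<longlongrightarrow> L) (at_right 0)"

text \<open>The integrand of \<open>\<E>\<^sub>s[u,v]\<close>; it vanishes on the diagonal since division by zero gives zero.\<close>

definition energy_integrand ::
    "real \<Rightarrow> (real ^ 'n \<Rightarrow> real) \<Rightarrow> (real ^ 'n \<Rightarrow> real) \<Rightarrow> (real ^ 'n) \<times> (real ^ 'n) \<Rightarrow> real" where
  "energy_integrand s u v =
     (\<lambda>(x, y). (u x - u y) * (v x - v y) / norm (x - y) powr (real CARD('n) + 2 * s))"

definition energy :: "real \<Rightarrow> (real ^ 'n \<Rightarrow> real) \<Rightarrow> (real ^ 'n \<Rightarrow> real) \<Rightarrow> real" where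
  "energy s u v = (LINT z|lebesgue. energy_integrand s u v z)"

text \<open>The integrand of \<open>\<E>\<^sub>s[u,u]\<close> is nonnegative and measurable, so its integrability says
  exactly that \<open>\<E>\<^sub>s[u,u] < \<infinity>\<close>.\<close>

definition Htilde :: "real \<Rightarrow> (real ^ 'n) set \<Rightarrow> (real ^ 'n \<Rightarrow> real) set" where
  "Htilde s \<Omega> = {u \<in> L2_on UNIV.
     integrable lebesgue (energy_integrand s u u) \<and> (\<forall>x. x \<notin> \<Omega> \<longrightarrow> u x = 0)}"

definition frac_eigenbasis ::
    "real \<Rightarrow> (real ^ 'n) set \<Rightarrow> (nat \<Rightarrow> real ^ 'n \<Rightarrow> real) \<Rightarrow> (nat \<Rightarrow> real) \<Rightarrow> bool" where
  "frac_eigenbasis s \<Omega> \<phi> ev \<longleftrightarrow>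
     L2_orthonormal_basis \<Omega> \<phi> \<and>
     (\<forall>k. \<phi> k \<in> Htilde s \<Omega> \<and>
        (\<forall>v\<in>Htilde s \<Omega>. frac_const TYPE('n) s / 2 * energy s (\<phi> k) v = ev k * L2_inner \<Omega> (\<phi> k) v))"


section \<open>The fractional heat equation\<close>

text \<open>\<open>u\<close> is the solution, given by separation of variables, of the initial-boundary value problem
  for the fractional heat equation. The eigenfunction series converges in \<open>L\<^sup>2(\<Omega>)\<close> and so
  determines \<open>u(\<cdot>,t)\<close> only almost everywhere; its values at individual points of \<open>\<Omega>\<close> are
  those of its smooth representative. Values at negative times are irrelevant.\<close>

definition frac_heat_solution ::
    "real \<Rightarrow> (real ^ 'n) set \<Rightarrow> (real ^ 'n \<Rightarrow> real) \<Rightarrow> (real ^ 'n \<Rightarrow> real \<Rightarrow> real) \<Rightarrow> bool" where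
  "frac_heat_solution s \<Omega> u0 u \<longleftrightarrow>
     (\<forall>x\<in>\<Omega>. \<forall>t>0. \<exists>D L. ((\<lambda>\<tau>. u x \<tau>) has_real_derivative D) (at t) \<and>
        has_frac_laplacian s (\<lambda>y. u y t) x L \<and> D + L = 0) \<and>
     (\<forall>x\<in>\<Omega>. u x 0 = u0 x) \<and>
     (\<forall>x t. x \<notin> \<Omega> \<longrightarrow> t > 0 \<longrightarrow> u x t = 0) \<and>
     (\<forall>t>0. smooth_on \<Omega> (\<lambda>x. u x t)) \<and>
     (\<exists>\<phi> ev. frac_eigenbasis s \<Omega> \<phi> ev \<and>
        (\<forall>t>0. L2_sums \<Omega> (\<lambda>k x. exp (- ev k * t) * L2_inner \<Omega> u0 (\<phi> k) * \<phi> k x) (\<lambda>x. u x t)))"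

definition odd_data :: "(real ^ 'n) set \<Rightarrow> real \<Rightarrow> (real ^ 'n \<Rightarrow> real) set" where
  "odd_data \<Omega> \<delta> = {u0 \<in> test_functions \<Omega>.
     supp u0 \<subseteq> ball 0 \<delta> \<and> (\<forall>x\<in>ball 0 \<delta>. u0 x = - u0 (- x))}"

end

theory Submission
  imports Defs
begin

text \<open>Finite partial sums of the eigenfunction series lie in the form domain, so testing their
  differences to barriers with the positive part gives a weak maximum principle in \<open>L\<^sup>2\<close>, which
  passes to the limit.

  If \<open>\<Omega>\<close> is symmetric, the maximum principle applied to \<open>\<plusminus>(u(x,t) + u(-x,t))\<close> shows that \<open>u(\<cdot>,t)\<close> is
  odd.

  Conversely, let \<open>f = (-\<Delta>)\<^sup>s u\<^sub>0\<close>. Formally \<open>u = u\<^sub>0 - t f + O(t\<^sup>2)\<close> in \<open>\<Omega>\<close>, and the second order term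
  at the origin is \<open>t\<^sup>2/2\<close> times \<open>(-\<Delta>)\<^sup>s\<close> of the function \<open>f\<close> cut off to \<open>\<Omega>\<close>. This is made rigorous
  by barriers \<open>u\<^sub>0 - t g + t\<^sup>2 k\<close> with \<open>C\<^sup>1\<^sup>,\<^sup>1\<close> minorants \<open>g\<close> of the truncated \<open>f\<close>. Hence \<open>u(0,t) = 0\<close>
  forces the integral of \<open>f(y) |y|\<^sup>-\<^sup>N\<^sup>-\<^sup>2\<^sup>s\<close> over \<open>\<Omega>\<close> minus a small ball to vanish. As \<open>u\<^sub>0\<close> is an arbitrary
  odd function, the potential with kernel \<open>|z - y|\<^sup>-\<^sup>N\<^sup>-\<^sup>2\<^sup>s\<close> of the odd density
  \<open>w(y) = (1\<^sub>\<Omega>(y) - 1\<^sub>\<Omega>(-y)) |y|\<^sup>-\<^sup>N\<^sup>-\<^sup>2\<^sup>s\<close>, which vanishes near the origin, is zero in a ball. Applying the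
  Laplacian in \<open>z\<close> repeatedly gives all kernels \<open>|z - y|\<^sup>-\<^sup>N\<^sup>-\<^sup>2\<^sup>s\<^sup>-\<^sup>2\<^sup>m\<close>, hence by the Weierstrass
  theorem all Gaussians centred in the ball; these generate an algebra, so \<open>w\<close> is orthogonal to all
  continuous functions. But \<open>w\<close> is positive on a nonempty open set if \<open>\<Omega>\<close> is not symmetric.\<close>

section \<open>Preliminaries on Lebesgue integrals\<close>

text \<open>The solution is accessible only through an L^2 convergent series, with no expansion in
  t, so the formal expansion at the origin is replaced by one-sided barriers. The first order term
  is silent: f is odd, hence f(0) = 0, and the asymmetry of \<Omega> can show up at order t^2 at the
  earliest. The cut-off of f to \<Omega> may jump across the boundary, so it cannot itself be the
  first order coefficient of a barrier; C11 minorants can, and they converge to it off the frontier.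
  A barrier bounds u from above only and yields an inequality; using it for u0 and for -u0 yields
  the equality. The boundary regularity enters twice. It makes the frontier a null set, so that the
  minorants converge almost everywhere, and it enlarges one point x of \<Omega> with -x outside
  \<Omega> to an open set of such points, which integrals can detect. The Laplacian of |v|^(-b) is b
  (b + 2 - N) |v|^(-b-2). Starting from b = N + 2s and raising b by 2 each time, the factor never
  vanishes, so no power is lost.\<close>

abbreviation kern :: "real \<Rightarrow> real ^ 'n \<Rightarrow> real" where
  "kern s h \<equiv> norm h powr (real CARD('n) + 2 * s)"

lemma distr_lborel_affine_isometry:
  fixes t :: "'a::euclidean_space"
  assumes "\<bar>c\<bar> = 1"
  shows "distr lborel borel (\<lambda>x. t + c *\<^sub>R x) = lborel"
  using lborel_affine[of c t] assms by (auto simp: density_1)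

lemma nn_integral_lborel_affine_isometry:
  fixes f :: "'a::euclidean_space \<Rightarrow> ennreal"
  assumes "\<bar>c\<bar> = 1" and [measurable]: "f \<in> borel_measurable borel"
  shows "(\<integral>\<^sup>+x. f (t + c *\<^sub>R x) \<partial>lborel) = (\<integral>\<^sup>+x. f x \<partial>lborel)"
  by (subst (2) distr_lborel_affine_isometry[OF assms(1), of t, symmetric])
     (simp add: nn_integral_distr)

lemma integrable_lborel_affine_isometry:
  fixes f :: "'a::euclidean_space \<Rightarrow> real"
  assumes "\<bar>c\<bar> = 1" and "integrable lborel f"
  shows "integrable lborel (\<lambda>x. f (t + c *\<^sub>R x))"
proof -
  have "integrable (distr lborel borel (\<lambda>x. t + c *\<^sub>R x)) f"
    using assms by (simp add: distr_lborel_affine_isometry)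
  then show ?thesis
    using assms by (subst (asm) integrable_distr_eq) auto
qed

text \<open>No integrability is assumed: the inverse map has the same form, so a non-integrable
  \<open>f\<close> has a non-integrable composition and both integrals are 0 by convention.\<close>

lemma integral_lborel_affine_isometry:
  fixes f :: "'a::euclidean_space \<Rightarrow> real"
  assumes c: "\<bar>c\<bar> = 1"
  shows "(\<integral>x. f (t + c *\<^sub>R x) \<partial>lborel) = (\<integral>x. f x \<partial>lborel)"
proof (cases "integrable lborel f")
  case True
  then have [measurable]: "f \<in> borel_measurable borel" by auto
  show ?thesis
    by (subst (2) distr_lborel_affine_isometry[OF c, of t, symmetric]) (simp add: integral_distr)
next
  case False
  have "\<not> integrable lborel (\<lambda>x. f (t + c *\<^sub>R x))"
  proof
    assume "integrable lborel (\<lambda>x. f (t + c *\<^sub>R x))"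
    then have "integrable lborel (\<lambda>x. f (t + c *\<^sub>R ((- c *\<^sub>R t) + c *\<^sub>R x)))"
      by (rule integrable_lborel_affine_isometry[OF c, of _ "- c *\<^sub>R t"])
    moreover have "t + c *\<^sub>R ((- c *\<^sub>R t) + c *\<^sub>R x) = x" for x
    proof -
      have "c * c = 1" using c by (metis abs_mult_self_eq mult.right_neutral)
      then show ?thesis by (simp add: algebra_simps)
    qed
    ultimately show False using False by simp
  qed
  then show ?thesis using False by (simp add: not_integrable_integral_eq)
qed

lemmas nn_integral_lborel_shift = nn_integral_lborel_affine_isometry[where c = 1, simplified]
lemmas integrable_lborel_shift = integrable_lborel_affine_isometry[where c = 1, simplified]
lemmas integrable_lborel_uminus = integrable_lborel_affine_isometry[where c = "-1" and t = 0, simplified]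
lemmas integral_lborel_shift = integral_lborel_affine_isometry[where c = 1, simplified]
lemmas integral_lborel_uminus = integral_lborel_affine_isometry[where c = "-1" and t = 0, simplified]

lemma integrable_bounded_support:
  fixes f :: "'a::euclidean_space \<Rightarrow> real"
  assumes f: "f \<in> borel_measurable borel" "\<And>x. \<bar>f x\<bar> \<le> C"
    and S: "bounded S" "\<And>x. x \<notin> S \<Longrightarrow> f x = 0"
  shows "integrable lborel f"
proof -
  obtain R where R: "\<And>x. x \<in> S \<Longrightarrow> norm x \<le> R" using S(1) by (auto simp: bounded_iff)
  show ?thesis
  proof (rule Bochner_Integration.integrable_bound[where f = "\<lambda>x. C * indicator (cball 0 R) x"])
    show "integrable lborel (\<lambda>x::'a. C * indicator (cball 0 R) x :: real)"
      using emeasure_bounded_finite[OF bounded_cball, of "0::'a" R]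
      by (intro integrable_mult_right) (simp add: integrable_indicator_iff)
    show "AE x in lborel. norm (f x) \<le> norm (C * indicator (cball 0 R) x :: real)"
    proof (rule AE_I2)
      fix x
      show "norm (f x) \<le> norm (C * indicator (cball 0 R) x :: real)"
        using f(2)[of x] S(2)[of x] R[of x] by (cases "x \<in> S") auto
    qed
  qed (use f in simp)
qed

text \<open>Dominated convergence along sequences: the mean value inequality turns the bound
  \<open>B\<close> on the derivatives into a bound on the difference quotients.\<close>

lemma has_real_derivative_lebesgue_integral:
  fixes F :: "real \<Rightarrow> 'a \<Rightarrow> real"
  assumes "0 < e"
    and int: "\<And>r. \<bar>r - t\<bar> < e \<Longrightarrow> integrable M (F r)"
    and deriv: "\<And>r x. x \<in> space M \<Longrightarrow> \<bar>r - t\<bar> < e \<Longrightarrow>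
      ((\<lambda>r. F r x) has_real_derivative F' r x) (at r)"
    and bound: "\<And>r x. x \<in> space M \<Longrightarrow> \<bar>r - t\<bar> < e \<Longrightarrow> \<bar>F' r x\<bar> \<le> B x"
    and B: "integrable M B"
  shows "((\<lambda>r. \<integral>x. F r x \<partial>M) has_real_derivative (\<integral>x. F' t x \<partial>M)) (at t)"
  unfolding has_field_derivative_iff tendsto_at_iff_sequentially comp_def
proof (intro allI impI)
  fix X :: "nat \<Rightarrow> real"
  assume X: "\<forall>i. X i \<in> UNIV - {t}" "X \<longlonglongrightarrow> t"
  then have "eventually (\<lambda>i. \<bar>X i - t\<bar> < e) sequentially"
    using tendstoD[OF X(2) \<open>0 < e\<close>] by (simp add: dist_real_def)
  then obtain n where n: "\<And>i. i \<ge> n \<Longrightarrow> \<bar>X i - t\<bar> < e"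
    by (auto simp: eventually_sequentially)
  \<comment> \<open>Dropping an initial segment puts every term inside the interval where the
    hypotheses hold.\<close>
  define Y where "Y i = X (i + n)" for i
  have Y: "\<bar>Y i - t\<bar> < e" "Y i \<noteq> t" for i
    using n X unfolding Y_def by auto
  have Yt: "Y \<longlonglongrightarrow> t" unfolding Y_def using X(2) by (rule LIMSEQ_ignore_initial_segment)
  have t0: "\<bar>t - t\<bar> < e" using \<open>0 < e\<close> by simp
  have "(\<lambda>i. \<integral>x. (F (Y i) x - F t x) / (Y i - t) \<partial>M) \<longlonglongrightarrow> (\<integral>x. F' t x \<partial>M)"
  proof (rule integral_dominated_convergence[OF _ _ B])
    show meas: "(\<lambda>x. (F (Y i) x - F t x) / (Y i - t)) \<in> borel_measurable M" for i
      using int[OF Y(1)[of i]] int[OF t0] by auto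
    have lim: "(\<lambda>i. (F (Y i) x - F t x) / (Y i - t)) \<longlonglongrightarrow> F' t x" if "x \<in> space M" for x
      using deriv[OF that t0] Y Yt
      unfolding has_field_derivative_iff tendsto_at_iff_sequentially comp_def by auto
    then show "AE x in M. (\<lambda>i. (F (Y i) x - F t x) / (Y i - t)) \<longlonglongrightarrow> F' t x" by simp
    show "F' t \<in> borel_measurable M"
      by (rule borel_measurable_LIMSEQ_real[OF lim meas])
    show "AE x in M. norm ((F (Y i) x - F t x) / (Y i - t)) \<le> B x" for i
    proof (rule AE_I2)
      fix x assume x: "x \<in> space M"
      have "\<bar>F (Y i) x - F t x\<bar> \<le> B x * \<bar>Y i - t\<bar>"
      proof -
        have cv: "convex {r. \<bar>r - t\<bar> < e}"
        proof -
          have "{r. \<bar>r - t\<bar> < e} = ball t e" by (auto simp: dist_real_def)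
          then show ?thesis by simp
        qed
        have "norm (F (Y i) x - F t x) \<le> B x * norm (Y i - t)"
          by (rule field_differentiable_bound[OF cv, of "\<lambda>r. F r x" "\<lambda>r. F' r x"])
             (use deriv bound x Y t0 in \<open>auto intro: DERIV_subset\<close>)
        then show ?thesis by simp
      qed
      then show "norm ((F (Y i) x - F t x) / (Y i - t)) \<le> B x"
        using Y[of i] by (simp add: divide_le_eq)
    qed
  qed
  moreover have "(\<integral>x. (F (Y i) x - F t x) / (Y i - t) \<partial>M) =
      ((\<integral>x. F (Y i) x \<partial>M) - (\<integral>x. F t x \<partial>M)) / (Y i - t)" for i
    using int[OF Y(1)[of i]] int[OF t0] by (simp only: integral_divide_zero Bochner_Integration.integral_diff)
  ultimately have "(\<lambda>i. ((\<integral>x. F (X (i + n)) x \<partial>M) - (\<integral>x. F t x \<partial>M)) / (X (i + n) - t))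
      \<longlonglongrightarrow> (\<integral>x. F' t x \<partial>M)"
    by (simp only: Y_def)
  then show "(\<lambda>i. ((\<integral>x. F (X i) x \<partial>M) - (\<integral>x. F t x \<partial>M)) / (X i - t)) \<longlonglongrightarrow> (\<integral>x. F' t x \<partial>M)"
    by (rule LIMSEQ_offset)
qed

text \<open>Dyadic scales: scale 2^n contributes O(2^(-2sn)) and scale 2^(-n) contributes
  O(2^(-(2-2s)n)), so 0 < s controls infinity and s < 1 the origin. At h = 0 the quotient is 0,
  since \<open>0 powr a = 0\<close> and division by zero gives zero.\<close>

lemma integrable_min_kernel:
  fixes s :: real
  assumes s: "0 < s" "s < 1"
  shows "integrable lborel (\<lambda>h::real^'n. min 1 ((norm h)\<^sup>2) / kern s h)"
    (is "integrable _ ?f")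
proof (rule integrableI_bounded)
  show "?f \<in> borel_measurable lborel" by measurable
  define N where "N = CARD('n)"
  define a where "a = real N + 2 * s"
  define V where "V = unit_ball_vol (real N)"
  have V: "V \<ge> 0" unfolding V_def by simp
  define p where "p = (\<lambda>n::nat. (2 powr real n) powr (- a))"
  define q where "q = (\<lambda>n::nat. (2 powr (- real n))\<^sup>2 * (2 powr (- real n - 1)) powr (- a))"
  \<comment> \<open>Whole balls stand in for dyadic shells: the overcount costs a constant factor,
    and at each point a single term of the series already dominates.\<close>
  define G where "G = (\<lambda>n (h::real^'n). ennreal (p n) * indicator (ball 0 (2 powr (real n + 1))) h
        + ennreal (q n) * indicator (ball 0 (2 powr (- real n + 1))) h)"
  have [measurable]: "ball (0::real^'n) r \<in> sets borel" for r by simp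
  have G[measurable]: "G n \<in> borel_measurable lborel" for n
    unfolding G_def by measurable
  have le: "ennreal (norm (?f h)) \<le> (\<Sum>n. G n h)" for h :: "real^'n"
  proof (cases "h = 0")
    case True then show ?thesis by simp
  next
    case False
    define r where "r = norm h"
    have r: "r > 0" using False unfolding r_def by simp
    have nf: "norm (?f h) = min 1 (r\<^sup>2) * r powr (- a)"
      unfolding r_def a_def N_def by (simp only: powr_minus) (simp add: divide_inverse)
    have apos: "a > 0" unfolding a_def using s by (simp add: add_nonneg_pos)
    have single: "G n h \<le> (\<Sum>n. G n h)" for n
      using sum_le_suminf[of "\<lambda>n. G n h" "{n}"] by simp
    show ?thesis
    proof (cases "r \<ge> 1")
      case True
      define n where "n = nat \<lfloor>log 2 r\<rfloor>"
      have l0: "log 2 r \<ge> 0" using True by simp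
      have n1: "real n \<le> log 2 r" "log 2 r < real n + 1"
        unfolding n_def using l0 by linarith+
      have r1: "2 powr real n \<le> r" using n1 r by (simp add: le_log_iff)
      have r2: "r < 2 powr (real n + 1)" using n1 r by (simp add: log_less_iff)
      have "r powr (- a) \<le> p n"
        unfolding p_def using r1 apos by (intro powr_mono2') auto
      moreover have "min 1 (r\<^sup>2) \<le> 1" by simp
      ultimately have fp: "norm (?f h) \<le> p n"
        unfolding nf using mult_mono[of "min 1 (r\<^sup>2)" 1 "r powr (- a)" "p n"] by simp
      have "ennreal (p n) \<le> G n h"
        unfolding G_def using r2 by (auto simp: r_def)
      then show ?thesis using single[of n] fp by (meson ennreal_leI order_trans)
    next
      case False
      define n where "n = nat \<lfloor>- log 2 r\<rfloor>"
      have l0: "- log 2 r \<ge> 0" using False r by (simp add: not_le less_imp_le)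
      have n1: "real n \<le> - log 2 r" "- log 2 r < real n + 1"
        unfolding n_def using l0 by linarith+
      have r1: "r \<le> 2 powr (- real n)" using n1 r by (simp add: log_le_iff[symmetric])
      have r2: "2 powr (- real n - 1) \<le> r" using n1 r by (simp add: le_log_iff[symmetric])
      have r3: "r < 2 powr (- real n + 1)"
      proof -
        have "2 powr (- real n) < (2::real) powr (- real n + 1)" by simp
        with r1 show ?thesis by linarith
      qed
      have "r powr (- a) \<le> (2 powr (- real n - 1)) powr (- a)"
        using r2 apos by (intro powr_mono2') auto
      moreover have "min 1 (r\<^sup>2) \<le> (2 powr (- real n))\<^sup>2"
        using r1 r by (intro min.coboundedI2 power_mono) auto
      ultimately have fq: "norm (?f h) \<le> q n"
        unfolding nf q_def by (intro mult_mono) auto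
      have "ennreal (q n) \<le> G n h"
        unfolding G_def using r3 by (auto simp: r_def)
      then show ?thesis using single[of n] fq by (meson ennreal_leI order_trans)
    qed
  qed
  have pq: "p n \<ge> 0" "q n \<ge> 0" for n unfolding p_def q_def by auto
  have N1: "DIM(real^'n) = N" unfolding N_def by simp
  have IG: "(\<integral>\<^sup>+h. G n h \<partial>lborel) =
      ennreal (p n * (V * (2 powr (real n + 1)) ^ N) + q n * (V * (2 powr (- real n + 1)) ^ N))" for n
  proof -
    have "(\<integral>\<^sup>+h. G n h \<partial>lborel) = ennreal (p n) * emeasure lborel (ball (0::real^'n) (2 powr (real n + 1)))
       + ennreal (q n) * emeasure lborel (ball (0::real^'n) (2 powr (- real n + 1)))"
      unfolding G_def by (subst nn_integral_add) (auto simp: nn_integral_cmult_indicator)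
    then show ?thesis
      using V pq by (simp add: emeasure_ball V_def N_def ennreal_mult'[symmetric] ennreal_plus[symmetric] del: ennreal_plus)
  qed
  have e1: "p n * (V * (2 powr (real n + 1)) ^ N) = V * 2 ^ N * (2 powr (- (2 * s))) ^ n" for n
  proof -
    have "p n * (2 powr (real n + 1)) ^ N = 2 powr (- a * real n) * 2 powr ((real n + 1) * real N)"
      unfolding p_def by (simp add: powr_powr powr_realpow[symmetric] mult.commute)
    also have "\<dots> = 2 powr (- a * real n + (real n + 1) * real N)" by (simp only: powr_add)
    also have "- a * real n + (real n + 1) * real N = real N + - (2 * s) * real n"
      unfolding a_def by (simp add: algebra_simps)
    also have "2 powr (real N + - (2 * s) * real n) = 2 ^ N * (2 powr (- (2 * s))) ^ n"
      by (simp only: powr_add powr_realpow[symmetric] powr_powr zero_less_numeral powr_gt_zero)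
    finally show ?thesis by simp
  qed
  have e2: "q n * (V * (2 powr (- real n + 1)) ^ N) = V * 2 ^ N * 2 powr a * (2 powr (- (2 - 2 * s))) ^ n" for n
  proof -
    have "q n * (2 powr (- real n + 1)) ^ N
        = 2 powr (- real n * 2) * 2 powr ((- real n - 1) * (- a)) * 2 powr ((- real n + 1) * real N)"
      unfolding q_def
      by (simp add: powr_powr powr_realpow[symmetric] mult.commute)
    also have "\<dots> = 2 powr (- real n * 2 + (- real n - 1) * (- a) + (- real n + 1) * real N)"
      by (simp only: powr_add)
    also have "- real n * 2 + (- real n - 1) * (- a) + (- real n + 1) * real N
        = real N + a + - (2 - 2 * s) * real n"
      unfolding a_def by (simp add: algebra_simps)
    also have "2 powr (real N + a + - (2 - 2 * s) * real n) = 2 ^ N * 2 powr a * (2 powr (- (2 - 2 * s))) ^ n"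
      by (simp only: powr_add powr_realpow[symmetric] powr_powr zero_less_numeral powr_gt_zero)
    finally show ?thesis by simp
  qed
  have sm: "summable (\<lambda>n. V * 2 ^ N * (2 powr (- (2 * s))) ^ n + V * 2 ^ N * 2 powr a * (2 powr (- (2 - 2 * s))) ^ n)"
  proof -
    have "norm ((2::real) powr (- (2 * s))) < 1" "norm ((2::real) powr (- (2 - 2 * s))) < 1"
      using s by (simp_all add: powr_less_one)
    then show ?thesis
      by (intro summable_add summable_mult summable_geometric)
  qed
  have "(\<integral>\<^sup>+h. ennreal (norm (?f h)) \<partial>lborel) \<le> (\<integral>\<^sup>+h. (\<Sum>n. G n h) \<partial>lborel)"
    by (intro nn_integral_mono le)
  also have "\<dots> = (\<Sum>n. (\<integral>\<^sup>+h. G n h \<partial>lborel))"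
    by (intro nn_integral_suminf) simp
  also have "\<dots> = (\<Sum>n. ennreal (V * 2 ^ N * (2 powr (- (2 * s))) ^ n + V * 2 ^ N * 2 powr a * (2 powr (- (2 - 2 * s))) ^ n))"
    by (simp only: IG e1 e2)
  also have "\<dots> < \<infinity>"
    using V sm by (subst suminf_ennreal2) (auto intro!: add_nonneg_nonneg mult_nonneg_nonneg)
  finally show "(\<integral>\<^sup>+h. ennreal (norm (?f h)) \<partial>lborel) < \<infinity>" .
qed

section \<open>The fractional Laplacian of bounded C11 functions\<close>

text \<open>Bounded C^{1,1} regularity expressed by differences instead of derivatives. The class is
  closed under sums and products, and the second difference bound is what makes the symmetrised
  singular integral converge absolutely.\<close>

definition bdd_C11 :: "(real ^ 'n \<Rightarrow> real) \<Rightarrow> bool" where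
  "bdd_C11 g \<longleftrightarrow> (\<exists>C. \<forall>x h. \<bar>g x\<bar> \<le> C \<and> \<bar>g (x + h) - g x\<bar> \<le> C * norm h \<and>
     \<bar>2 * g x - g (x + h) - g (x - h)\<bar> \<le> C * (norm h)\<^sup>2)"

lemma bdd_C11I:
  fixes g :: "real ^ 'n \<Rightarrow> real"
  assumes "\<And>x. \<bar>g x\<bar> \<le> A" "\<And>x h. \<bar>g (x + h) - g x\<bar> \<le> B * norm h"
    "\<And>x h. \<bar>2 * g x - g (x + h) - g (x - h)\<bar> \<le> C * (norm h)\<^sup>2"
  shows "bdd_C11 g"
  unfolding bdd_C11_def
proof (intro exI[of _ "max A (max B C)"] allI conjI)
  fix x h :: "real^'n"
  show "\<bar>g x\<bar> \<le> max A (max B C)" using assms(1)[of x] by linarith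
  have "B * norm h \<le> max A (max B C) * norm h" by (intro mult_right_mono) auto
  then show "\<bar>g (x + h) - g x\<bar> \<le> max A (max B C) * norm h" using assms(2)[of x h] by linarith
  have "C * (norm h)\<^sup>2 \<le> max A (max B C) * (norm h)\<^sup>2" by (intro mult_right_mono) auto
  then show "\<bar>2 * g x - g (x + h) - g (x - h)\<bar> \<le> max A (max B C) * (norm h)\<^sup>2"
    using assms(3)[of x h] by linarith
qed

lemma bdd_C11E:
  fixes g :: "real ^ 'n \<Rightarrow> real"
  assumes "bdd_C11 g"
  obtains C where "C \<ge> 0" "\<And>x. \<bar>g x\<bar> \<le> C" "\<And>x h. \<bar>g (x + h) - g x\<bar> \<le> C * norm h"
    "\<And>x h. \<bar>2 * g x - g (x + h) - g (x - h)\<bar> \<le> C * (norm h)\<^sup>2"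
proof -
  obtain C where C: "\<bar>g x\<bar> \<le> C" "\<bar>g (x + h) - g x\<bar> \<le> C * norm h"
     "\<bar>2 * g x - g (x + h) - g (x - h)\<bar> \<le> C * (norm h)\<^sup>2" for x h
    using assms unfolding bdd_C11_def by blast
  have "C \<ge> 0" using C(1)[of 0] by linarith
  with C that show thesis by blast
qed

lemma bdd_C11_const: "bdd_C11 (\<lambda>x. c)"
  by (rule bdd_C11I[of _ "\<bar>c\<bar>" 0 0]) auto

lemma bdd_C11_add:
  assumes "bdd_C11 f" "bdd_C11 g" shows "bdd_C11 (\<lambda>x. f x + g x)"
proof -
  obtain C where C: "\<And>x. \<bar>f x\<bar> \<le> C" "\<And>x h. \<bar>f (x + h) - f x\<bar> \<le> C * norm h"
    "\<And>x h. \<bar>2 * f x - f (x + h) - f (x - h)\<bar> \<le> C * (norm h)\<^sup>2"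
    using assms(1) by (rule bdd_C11E) blast
  obtain D where D: "\<And>x. \<bar>g x\<bar> \<le> D" "\<And>x h. \<bar>g (x + h) - g x\<bar> \<le> D * norm h"
    "\<And>x h. \<bar>2 * g x - g (x + h) - g (x - h)\<bar> \<le> D * (norm h)\<^sup>2"
    using assms(2) by (rule bdd_C11E) blast
  show ?thesis
  proof (rule bdd_C11I[of _ "C + D" "C + D" "C + D"])
    fix x h
    show "\<bar>f x + g x\<bar> \<le> C + D" using C(1)[of x] D(1)[of x] by linarith
    show "\<bar>f (x + h) + g (x + h) - (f x + g x)\<bar> \<le> (C + D) * norm h"
      using C(2)[of x h] D(2)[of x h] unfolding distrib_right by linarith
    show "\<bar>2 * (f x + g x) - (f (x + h) + g (x + h)) - (f (x - h) + g (x - h))\<bar> \<le> (C + D) * (norm h)\<^sup>2"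
      using C(3)[of x h] D(3)[of x h] unfolding distrib_right by (auto simp: abs_le_iff)
  qed
qed

lemma bdd_C11_mult:
  assumes "bdd_C11 f" "bdd_C11 g" shows "bdd_C11 (\<lambda>x. f x * g x)"
proof -
  obtain C where C0: "C \<ge> 0" and C: "\<And>x. \<bar>f x\<bar> \<le> C" "\<And>x h. \<bar>f (x + h) - f x\<bar> \<le> C * norm h"
    "\<And>x h. \<bar>2 * f x - f (x + h) - f (x - h)\<bar> \<le> C * (norm h)\<^sup>2"
    using assms(1) by (rule bdd_C11E) blast
  obtain D where D0: "D \<ge> 0" and D: "\<And>x. \<bar>g x\<bar> \<le> D" "\<And>x h. \<bar>g (x + h) - g x\<bar> \<le> D * norm h"
    "\<And>x h. \<bar>2 * g x - g (x + h) - g (x - h)\<bar> \<le> D * (norm h)\<^sup>2"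
    using assms(2) by (rule bdd_C11E) blast
  have m: "\<bar>a * b\<bar> \<le> A * B" if "\<bar>a\<bar> \<le> A" "\<bar>b\<bar> \<le> B" for a b A B :: real
    unfolding abs_mult using that by (intro mult_mono) auto
  show ?thesis
  proof (rule bdd_C11I[of _ "C * D" "2 * (C * D)" "4 * (C * D)"])
    fix x h
    show "\<bar>f x * g x\<bar> \<le> C * D" using C D by (intro m)
    have "f (x + h) * g (x + h) - f x * g x = (f (x + h) - f x) * g (x + h) + f x * (g (x + h) - g x)"
      by (simp add: algebra_simps)
    moreover have "\<bar>(f (x + h) - f x) * g (x + h)\<bar> \<le> (C * norm h) * D" using C D by (intro m)
    moreover have "\<bar>f x * (g (x + h) - g x)\<bar> \<le> C * (D * norm h)" using C D by (intro m)
    ultimately show "\<bar>f (x + h) * g (x + h) - f x * g x\<bar> \<le> 2 * (C * D) * norm h"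
      by (simp add: algebra_simps)
    \<comment> \<open>Discrete Leibniz rule; the cross terms are products of two first differences
      and hence already of size |h|^2.\<close>
    have "2 * (f x * g x) - f (x + h) * g (x + h) - f (x - h) * g (x - h)
       = (2 * f x - f (x + h) - f (x - h)) * g x + f x * (2 * g x - g (x + h) - g (x - h))
         - (f (x + h) - f x) * (g (x + h) - g x) - (f (x - h) - f x) * (g (x - h) - g x)"
      by (simp add: algebra_simps)
    moreover have "\<bar>(2 * f x - f (x + h) - f (x - h)) * g x\<bar> \<le> (C * (norm h)\<^sup>2) * D"
      using C D by (intro m)
    moreover have "\<bar>f x * (2 * g x - g (x + h) - g (x - h))\<bar> \<le> C * (D * (norm h)\<^sup>2)"
      using C D by (intro m)
    moreover have "\<bar>(f (x + h) - f x) * (g (x + h) - g x)\<bar> \<le> (C * norm h) * (D * norm h)"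
      using C D by (intro m)
    moreover have "\<bar>(f (x - h) - f x) * (g (x - h) - g x)\<bar> \<le> (C * norm h) * (D * norm h)"
      using C(2)[of x "- h"] D(2)[of x "- h"] by (intro m) auto
    ultimately show "\<bar>2 * (f x * g x) - f (x + h) * g (x + h) - f (x - h) * g (x - h)\<bar>
        \<le> 4 * (C * D) * (norm h)\<^sup>2"
      by (simp add: algebra_simps power2_eq_square abs_le_iff)
  qed
qed

lemma bdd_C11_cmult: "bdd_C11 f \<Longrightarrow> bdd_C11 (\<lambda>x. c * f x)"
  by (rule bdd_C11_mult[OF bdd_C11_const])

lemma bdd_C11_diff: "bdd_C11 f \<Longrightarrow> bdd_C11 g \<Longrightarrow> bdd_C11 (\<lambda>x. f x - g x)"
  using bdd_C11_add[of f "\<lambda>x. (-1) * g x"] bdd_C11_cmult[of g "-1"] by simp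

lemma bdd_C11_continuous:
  assumes "bdd_C11 g" shows "continuous_on UNIV g"
proof -
  obtain C where C0: "C \<ge> 0" and C: "\<And>x h. \<bar>g (x + h) - g x\<bar> \<le> C * norm h"
    using assms by (rule bdd_C11E) blast
  have "C-lipschitz_on UNIV g"
    using C0 C by (intro lipschitz_onI) (simp_all add: dist_norm, metis add_diff_cancel_left' diff_add_cancel add.commute)
  then show ?thesis by (rule lipschitz_on_continuous_on)
qed

lemma bdd_C11_borel: "bdd_C11 g \<Longrightarrow> g \<in> borel_measurable borel"
  using bdd_C11_continuous borel_measurable_continuous_onI by blast

text \<open>The symmetrised form of the singular integral, absolutely convergent for
  \<open>bdd_C11\<close> functions, with the constant left out. Symmetrising counts every increment
  twice, so \<open>frac_const / 2\<close> times this is the fractional Laplacian.\<close>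

definition frac_lap :: "real \<Rightarrow> (real ^ 'n \<Rightarrow> real) \<Rightarrow> real ^ 'n \<Rightarrow> real" where
  "frac_lap s g x =
     (LINT h|lborel. (2 * g x - g (x + h) - g (x - h)) / kern s h)"

lemma second_diff_le_min:
  assumes "C \<ge> 0" "\<And>x. \<bar>g x\<bar> \<le> C" "\<bar>2 * g x - g (x + h) - g (x - h)\<bar> \<le> C * (norm h)\<^sup>2"
  shows "\<bar>2 * g x - g (x + h) - g (x - h)\<bar> \<le> 4 * C * min 1 ((norm h)\<^sup>2)"
proof (cases "(norm h)\<^sup>2 \<le> 1")
  case True
  have "C * (norm h)\<^sup>2 \<le> 4 * C * (norm h)\<^sup>2" using assms(1) by (intro mult_right_mono) auto
  with True assms(3) show ?thesis by (simp add: min_def)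
next
  case False
  then show ?thesis
    using assms(2)[of x] assms(2)[of "x + h"] assms(2)[of "x - h"] by (simp add: min_def abs_le_iff)
qed

lemma bdd_C11_min:
  assumes "bdd_C11 g"
  obtains C where "C \<ge> 0" "\<And>x h. \<bar>(2 * g x - g (x + h) - g (x - h)) / norm h powr a\<bar>
     \<le> C * (min 1 ((norm h)\<^sup>2) / norm h powr a)"
proof -
  obtain C where C: "C \<ge> 0" "\<And>x. \<bar>g x\<bar> \<le> C"
    "\<And>x h. \<bar>2 * g x - g (x + h) - g (x - h)\<bar> \<le> C * (norm h)\<^sup>2"
    using assms by (rule bdd_C11E) blast
  have "\<bar>(2 * g x - g (x + h) - g (x - h)) / norm h powr a\<bar> \<le> (4 * C) * (min 1 ((norm h)\<^sup>2) / norm h powr a)" for x h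
    using divide_right_mono[OF second_diff_le_min[of C g, OF C(1,2,3)], of "norm h powr a" x h]
    by (simp add: abs_divide)
  then show thesis using C by (intro that[of "4 * C"]) auto
qed

context
  fixes s :: real
  assumes s: "0 < s" "s < 1"
begin

lemma frac_lap_integrable:
  fixes g :: "real ^ 'n \<Rightarrow> real"
  assumes "bdd_C11 g"
  shows "integrable lborel (\<lambda>h. (2 * g x - g (x + h) - g (x - h)) / kern s h)"
proof -
  obtain C where C: "C \<ge> 0" "\<And>x h. \<bar>(2 * g x - g (x + h) - g (x - h)) / kern s h\<bar>
     \<le> C * (min 1 ((norm h)\<^sup>2) / kern s h)"
    using assms by (rule bdd_C11_min) blast
  have [measurable]: "g \<in> borel_measurable borel" using assms by (rule bdd_C11_borel)
  show ?thesis
    by (rule Bochner_Integration.integrable_bound[OF integrable_mult_right[OF integrable_min_kernel[OF s], of C]])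
       (use C in \<open>auto intro!: order_trans[OF _ abs_ge_self]\<close>)
qed

lemma frac_lap_continuous:
  fixes g :: "real ^ 'n \<Rightarrow> real"
  assumes "bdd_C11 g"
  shows "continuous_on UNIV (frac_lap s g)"
proof -
  obtain C where C: "C \<ge> 0" "\<And>x h. \<bar>(2 * g x - g (x + h) - g (x - h)) / kern s h\<bar>
     \<le> C * (min 1 ((norm h)\<^sup>2) / kern s h)"
    using assms by (rule bdd_C11_min) blast
  have [measurable]: "g \<in> borel_measurable borel" using assms by (rule bdd_C11_borel)
  have cont: "isCont g x" for x
    using bdd_C11_continuous[OF assms] by (simp add: continuous_on_eq_continuous_at)
  have "isCont (frac_lap s g) x" for x
    unfolding continuous_at_sequentially comp_def
  proof (intro allI impI)
    fix X :: "nat \<Rightarrow> real^'n" assume X: "X \<longlonglongrightarrow> x"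
    show "(\<lambda>n. frac_lap s g (X n)) \<longlonglongrightarrow> frac_lap s g x"
      unfolding frac_lap_def
    proof (rule integral_dominated_convergence[OF _ _ integrable_mult_right[OF integrable_min_kernel[OF s], of C]])
      show "AE h in lborel. (\<lambda>i. (2 * g (X i) - g (X i + h) - g (X i - h)) / kern s h)
         \<longlonglongrightarrow> (2 * g x - g (x + h) - g (x - h)) / kern s h"
        unfolding divide_inverse
        by (intro AE_I2 tendsto_intros isCont_tendsto_compose[OF cont] X)
      show "AE h in lborel. norm ((2 * g (X i) - g (X i + h) - g (X i - h)) / kern s h)
         \<le> C * (min 1 ((norm h)\<^sup>2) / kern s h)" for i
        using C by simp
    qed measurable
  qed
  then show ?thesis by (simp add: continuous_on_eq_continuous_at)
qed

lemma frac_lap_bounded: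
  fixes g :: "real ^ 'n \<Rightarrow> real"
  assumes "bdd_C11 g"
  obtains K where "\<And>x. \<bar>frac_lap s g x\<bar> \<le> K"
proof -
  obtain C where C: "C \<ge> 0" "\<And>x h. \<bar>(2 * g x - g (x + h) - g (x - h)) / kern s h\<bar>
     \<le> C * (min 1 ((norm h)\<^sup>2) / kern s h)"
    using assms by (rule bdd_C11_min) blast
  have "\<bar>frac_lap s g x\<bar> \<le> (LINT h|lborel. C * (min 1 ((norm h)\<^sup>2) / kern s (h::real^'n)))" for x
    unfolding frac_lap_def
    by (rule order_trans[OF integral_abs_bound])
       (intro integral_mono integrable_abs frac_lap_integrable assms integrable_mult_right integrable_min_kernel s C)
  then show thesis by (rule that)
qed

lemma frac_lap_add:
  fixes f g :: "real ^ 'n \<Rightarrow> real"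
  assumes "bdd_C11 f" "bdd_C11 g"
  shows "frac_lap s (\<lambda>x. f x + g x) x = frac_lap s f x + frac_lap s g x"
proof -
  have "frac_lap s f x + frac_lap s g x =
     (LINT h|lborel. (2 * f x - f (x + h) - f (x - h)) / kern s h +
      (2 * g x - g (x + h) - g (x - h)) / kern s h)"
    unfolding frac_lap_def
    using frac_lap_integrable[OF assms(1), of x] frac_lap_integrable[OF assms(2), of x] by simp
  also have "\<dots> = frac_lap s (\<lambda>x. f x + g x) x"
    unfolding frac_lap_def
    by (intro Bochner_Integration.integral_cong refl) (simp add: add_divide_distrib[symmetric])
  finally show ?thesis by simp
qed

end

lemma frac_lap_cmult:
  fixes g :: "real ^ 'n \<Rightarrow> real"
  shows "frac_lap s (\<lambda>x. c * g x) x = c * frac_lap s g x"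
proof -
  have "(2 * (c * g x) - c * g (x + h) - c * g (x - h)) / r = c * ((2 * g x - g (x + h) - g (x - h)) / r)" for h r
    by (simp add: algebra_simps diff_divide_distrib)
  then show ?thesis unfolding frac_lap_def by (simp only: integral_mult_right_zero)
qed

lemma frac_lap_odd:
  fixes g :: "real ^ 'n \<Rightarrow> real"
  assumes "\<And>x. g (- x) = - g x"
  shows "frac_lap s g (- x) = - frac_lap s g x"
proof -
  have "g (- x + h) = - g (x - h)" "g (- x - h) = - g (x + h)" for h :: "real ^ 'n"
    using assms[of "x - h"] assms[of "x + h"] by (simp_all add: minus_add_distrib)
  then have "frac_lap s g (- x) = (LINT h|lborel. - ((2 * g x - g (x + h) - g (x - h)) / kern s h))"
    unfolding frac_lap_def assms
    by (intro Bochner_Integration.integral_cong refl) (simp add: minus_divide_left)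
  then show ?thesis unfolding frac_lap_def by simp
qed

section \<open>Energy form\<close>

lemma integrable_lborel_pair_mult:
  fixes f :: "'a::euclidean_space \<Rightarrow> real" and g :: "'b::euclidean_space \<Rightarrow> real"
  assumes f: "integrable lborel f" and g: "integrable lborel g"
  shows "integrable (lborel \<Otimes>\<^sub>M lborel) (\<lambda>(x, y). f x * g y)"
proof -
  have [measurable]: "f \<in> borel_measurable borel" "g \<in> borel_measurable borel" using f g by auto
  show ?thesis
  proof (rule lborel_pair.Fubini_integrable)
    show "integrable lborel (\<lambda>x. LINT y|lborel. norm (case (x, y) of (x, y) \<Rightarrow> f x * g y))"
      using f by (simp add: abs_mult)
    show "AE x in lborel. integrable lborel (\<lambda>y. case (x, y) of (x, y) \<Rightarrow> f x * g y)"
      using g by simp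
  qed measurable
qed

text \<open>Translation invariance in the inner integral. In the coordinates (h, x) with y = x + h
  the kernel of the energy depends on h alone.\<close>

lemma distr_lborel_pair_shear:
  "distr (lborel \<Otimes>\<^sub>M lborel) (lborel \<Otimes>\<^sub>M lborel) (\<lambda>(h, x). (x, x + h)) =
     (lborel \<Otimes>\<^sub>M lborel :: ('a::euclidean_space \<times> 'a) measure)" (is "?D = ?L")
proof (rule measure_eqI)
  fix A :: "('a \<times> 'a) set" assume "A \<in> sets ?D"
  then have A: "A \<in> sets ?L" by simp
  have A'[measurable]: "A \<in> sets (borel \<Otimes>\<^sub>M borel)" using A by (simp cong: sets_pair_measure_cong)
  have i[measurable]: "indicator A \<in> borel_measurable (borel \<Otimes>\<^sub>M borel)" by simp
  have "emeasure ?D A = (\<integral>\<^sup>+z. indicator A z \<partial>?D)" using A by simp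
  also have "\<dots> = (\<integral>\<^sup>+z. indicator A (case z of (h, x) \<Rightarrow> (x, x + h)) \<partial>?L)"
    using A by (subst nn_integral_distr) auto
  also have "\<dots> = (\<integral>\<^sup>+x. \<integral>\<^sup>+h. indicator A (x, x + h) \<partial>lborel \<partial>lborel)"
    by (subst lborel_pair.nn_integral_snd[symmetric]) auto
  also have "\<dots> = (\<integral>\<^sup>+x. \<integral>\<^sup>+y. indicator A (x, y) \<partial>lborel \<partial>lborel)"
  proof (rule nn_integral_cong)
    fix x :: 'a
    show "(\<integral>\<^sup>+h. indicator A (x, x + h) \<partial>lborel) = (\<integral>\<^sup>+y. indicator A (x, y) \<partial>lborel)"
      by (rule nn_integral_lborel_shift[of "\<lambda>y. indicator A (x, y)" x]) measurable
  qed
  also have "\<dots> = (\<integral>\<^sup>+z. indicator A z \<partial>?L)"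
    by (subst lborel.nn_integral_fst) auto
  also have "\<dots> = emeasure ?L A" using A by simp
  finally show "emeasure ?D A = emeasure ?L A" .
qed simp

lemma shear_measurable:
  "(\<lambda>(h, x). (x, x + h)) \<in> lborel \<Otimes>\<^sub>M lborel \<rightarrow>\<^sub>M
     (lborel \<Otimes>\<^sub>M lborel :: ('a::euclidean_space \<times> 'a) measure)"
  by measurable

lemma integrable_lborel_pair_shear_iff:
  fixes F :: "'a::euclidean_space \<times> 'a \<Rightarrow> real"
  assumes "F \<in> borel_measurable (lborel \<Otimes>\<^sub>M lborel)"
  shows "integrable (lborel \<Otimes>\<^sub>M lborel) (\<lambda>(h, x). F (x, x + h)) \<longleftrightarrow>
     integrable (lborel \<Otimes>\<^sub>M lborel) F"
  using integrable_distr_eq[OF shear_measurable assms]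
  by (simp add: distr_lborel_pair_shear[unfolded case_prod_unfold] case_prod_unfold)

lemma integral_lborel_pair_shear:
  fixes F :: "'a::euclidean_space \<times> 'a \<Rightarrow> real"
  assumes "F \<in> borel_measurable (lborel \<Otimes>\<^sub>M lborel)"
  shows "(LINT (h, x)|(lborel \<Otimes>\<^sub>M lborel). F (x, x + h)) = (LINT z|(lborel \<Otimes>\<^sub>M lborel). F z)"
  using integral_distr[OF shear_measurable assms]
  by (simp add: distr_lborel_pair_shear[unfolded case_prod_unfold] case_prod_unfold)

text \<open>Taken over the product of Borel measures, not over Lebesgue measure on pairs as in
  \<open>energy\<close>, so that Fubini and the shear apply; the two are reconciled when the
  eigenfunctions are replaced by Borel representatives.\<close>

abbreviation finite_energy :: "real \<Rightarrow> (real ^ 'n \<Rightarrow> real) \<Rightarrow> (real ^ 'n \<Rightarrow> real) \<Rightarrow> bool" where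
  "finite_energy s u v \<equiv> integrable (lborel \<Otimes>\<^sub>M lborel) (energy_integrand s u v)"

abbreviation energy_form :: "real \<Rightarrow> (real ^ 'n \<Rightarrow> real) \<Rightarrow> (real ^ 'n \<Rightarrow> real) \<Rightarrow> real" where
  "energy_form s u v \<equiv> (LINT z|(lborel \<Otimes>\<^sub>M lborel). energy_integrand s u v z)"

lemma energy_integrand_measurable [measurable]:
  fixes u v :: "real ^ 'n \<Rightarrow> real"
  assumes [measurable]: "u \<in> borel_measurable borel" "v \<in> borel_measurable borel"
  shows "energy_integrand s u v \<in> borel_measurable (lborel \<Otimes>\<^sub>M lborel)"
  unfolding energy_integrand_def by measurable

lemma energy_integrand_shear:
  "energy_integrand s u v (x, x + h) =
     (u x - u (x + h)) * (v x - v (x + h)) / kern s (h::real^'n)"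
  unfolding energy_integrand_def by simp

text \<open>The mixed integrand is dominated pointwise by the sum of the two diagonal ones, since
  |ab| \<le> a^2 + b^2.\<close>

lemma energy_integrable_cross:
  fixes u v :: "real ^ 'n \<Rightarrow> real"
  assumes [measurable]: "u \<in> borel_measurable borel" "v \<in> borel_measurable borel"
    and u: "finite_energy s u u"
    and v: "finite_energy s v v"
  shows "finite_energy s u v"
proof (rule Bochner_Integration.integrable_bound[OF Bochner_Integration.integrable_add[OF u v]])
  show "AE z in lborel \<Otimes>\<^sub>M lborel. norm (energy_integrand s u v z) \<le>
      norm (energy_integrand s u u z + energy_integrand s v v z)"
  proof (rule AE_I2, clarify)
    fix x y :: "real^'n"
    have ab: "\<bar>a * b\<bar> \<le> a * a + b * b" for a b :: real
    proof -
      have "2 * (a * b) \<le> a * a + b * b" "- 2 * (a * b) \<le> a * a + b * b"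
        using sum_squares_ge_zero[of "a - b" 0] sum_squares_ge_zero[of "a + b" 0]
        by (simp_all add: algebra_simps)
      moreover have "0 \<le> a * a + b * b" by (rule sum_squares_ge_zero)
      ultimately show ?thesis by linarith
    qed
    have "\<bar>(u x - u y) * (v x - v y)\<bar> / kern s (x - y)
      \<le> ((u x - u y) * (u x - u y) + (v x - v y) * (v x - v y)) / kern s (x - y)"
      by (intro divide_right_mono ab) simp
    then show "norm (energy_integrand s u v (x, y)) \<le>
      norm (energy_integrand s u u (x, y) + energy_integrand s v v (x, y))"
      unfolding energy_integrand_def by (simp add: abs_divide add_divide_distrib)
  qed
qed measurable

lemma energy_integrable_add:
  fixes u v :: "real ^ 'n \<Rightarrow> real"
  assumes [measurable]: "u \<in> borel_measurable borel" "v \<in> borel_measurable borel"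
    and u: "finite_energy s u u"
    and v: "finite_energy s v v"
  shows "finite_energy s (\<lambda>x. u x + v x) (\<lambda>x. u x + v x)"
proof -
  have "energy_integrand s (\<lambda>x. u x + v x) (\<lambda>x. u x + v x) =
     (\<lambda>z. energy_integrand s u u z + 2 * energy_integrand s u v z + energy_integrand s v v z)"
    unfolding energy_integrand_def
    by (rule ext) (auto simp: algebra_simps add_divide_distrib diff_divide_distrib)
  then show ?thesis
    using u v energy_integrable_cross[OF assms] by simp
qed

lemma energy_integrable_cmult:
  fixes u :: "real ^ 'n \<Rightarrow> real"
  assumes u: "finite_energy s u u"
  shows "finite_energy s (\<lambda>x. c * u x) (\<lambda>x. c * u x)"
proof -
  have "energy_integrand s (\<lambda>x. c * u x) (\<lambda>x. c * u x) = (\<lambda>z. c\<^sup>2 * energy_integrand s u u z)"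
    unfolding energy_integrand_def
    by (rule ext) (auto simp: algebra_simps power2_eq_square diff_divide_distrib)
  then show ?thesis using u by simp
qed

context
  fixes s :: real
  assumes s: "0 < s" "s < 1"
begin

text \<open>In sheared coordinates the integrand vanishes unless x or x + h lies in the ball, so it
  is at most a multiple of min(1, |h|^2) / |h|^(N+2s) times the sum of the two indicators;
  translation makes both products integrable.\<close>

lemma energy_integrable_compact_support:
  fixes g :: "real ^ 'n \<Rightarrow> real"
  assumes g: "bdd_C11 g" and R: "\<And>x. x \<notin> cball 0 R \<Longrightarrow> g x = 0"
  shows "finite_energy s g g"
proof -
  have gm[measurable]: "g \<in> borel_measurable borel" using g by (rule bdd_C11_borel)
  obtain C where C0: "C \<ge> 0" and C: "\<And>x. \<bar>g x\<bar> \<le> C" "\<And>x h. \<bar>g (x + h) - g x\<bar> \<le> C * norm h"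
    using g by (rule bdd_C11E) blast
  define k where "k h = min 1 ((norm h)\<^sup>2) / kern s h" for h :: "real^'n"
  have k: "integrable lborel k" unfolding k_def by (rule integrable_min_kernel[OF s])
  have k0: "k h \<ge> 0" for h unfolding k_def by simp
  define b where "b x = (indicator (cball 0 R) x :: real)" for x :: "real^'n"
  have b: "integrable lborel b"
    by (rule integrable_bounded_support[of _ 1 "cball 0 R"]) (auto simp: b_def[abs_def] indicator_def)
  have [measurable]: "k \<in> borel_measurable borel" "b \<in> borel_measurable borel" using k b by auto
  have i1: "integrable (lborel \<Otimes>\<^sub>M lborel) (\<lambda>(h, x). k h * b x)"
    by (rule integrable_lborel_pair_mult[OF k b])
  have i2: "integrable (lborel \<Otimes>\<^sub>M lborel) (\<lambda>(h, x). k h * b (x + h))"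
  proof (rule lborel_pair.Fubini_integrable)
    have bs: "(LINT x|lborel. b (x + h)) = (LINT x|lborel. b x)" for h
      using integral_lborel_shift[of b h] by (simp add: add.commute)
    have b0: "b x \<ge> 0" for x unfolding b_def by simp
    show "integrable lborel (\<lambda>h. LINT x|lborel. norm (case (h, x) of (h, x) \<Rightarrow> k h * b (x + h)))"
      using k k0 b0 by (simp add: abs_mult bs)
    show "AE h in lborel. integrable lborel (\<lambda>x. case (h, x) of (h, x) \<Rightarrow> k h * b (x + h))"
    proof (rule AE_I2)
      fix h :: "real^'n"
      show "integrable lborel (\<lambda>x. case (h, x) of (h, x) \<Rightarrow> k h * b (x + h))"
        using integrable_lborel_shift[OF b, of h] by (simp add: add.commute)
    qed
  qed measurable
  have "integrable (lborel \<Otimes>\<^sub>M lborel) (\<lambda>(h, x). energy_integrand s g g (x, x + h))"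
  proof (rule Bochner_Integration.integrable_bound[OF integrable_mult_right[OF Bochner_Integration.integrable_add[OF i1 i2], of "4 * C\<^sup>2"]])
    show "AE z in lborel \<Otimes>\<^sub>M lborel. norm (case z of (h, x) \<Rightarrow> energy_integrand s g g (x, x + h))
        \<le> norm (4 * C\<^sup>2 * ((case z of (h, x) \<Rightarrow> k h * b x) + (case z of (h, x) \<Rightarrow> k h * b (x + h))))"
    proof (rule AE_I2, clarify)
      fix h x :: "real^'n"
      show "norm (energy_integrand s g g (x, x + h)) \<le> norm (4 * C\<^sup>2 * (k h * b x + k h * b (x + h)))"
      proof (cases "x \<in> cball 0 R \<or> x + h \<in> cball 0 R")
        case False
        then have "g x = 0" "g (x + h) = 0" using R by blast+
        then show ?thesis by (simp add: energy_integrand_shear)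
      next
        case True
        have "\<bar>g x - g (x + h)\<bar> \<le> 2 * C" using C(1)[of x] C(1)[of "x + h"] by linarith
        then have "\<bar>g x - g (x + h)\<bar>\<^sup>2 \<le> (2 * C)\<^sup>2" by (intro power_mono) auto
        moreover have "\<bar>g x - g (x + h)\<bar>\<^sup>2 \<le> (C * norm h)\<^sup>2"
          using C(2)[of x h] by (intro power_mono) auto
        ultimately have "(g x - g (x + h)) * (g x - g (x + h)) \<le> 4 * C\<^sup>2 * min 1 ((norm h)\<^sup>2)"
          using zero_le_power2[of "C * norm h"]
          by (auto simp: min_def power2_eq_square mult.assoc algebra_simps)
        then have "energy_integrand s g g (x, x + h) \<le> 4 * C\<^sup>2 * k h"
          unfolding energy_integrand_shear k_def times_divide_eq_right
          by (intro divide_right_mono) simp_all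
        moreover have "energy_integrand s g g (x, x + h) \<ge> 0"
          unfolding energy_integrand_shear by simp
        moreover have "4 * C\<^sup>2 * k h \<le> 4 * C\<^sup>2 * (k h * b x + k h * b (x + h))"
          using True k0[of h] unfolding b_def by (intro mult_left_mono) (auto simp: indicator_def)
        ultimately show ?thesis by simp
      qed
    qed
  qed measurable
  then show ?thesis by (subst (asm) integrable_lborel_pair_shear_iff) auto
qed

lemma frac_lap_integrable_pair:
  fixes g v :: "real ^ 'n \<Rightarrow> real"
  assumes g: "bdd_C11 g" and v: "integrable lborel v"
  shows "integrable (lborel \<Otimes>\<^sub>M lborel)
    (\<lambda>(h, x). v x * ((2 * g x - g (x + h) - g (x - h)) / kern s h))"
proof -
  have [measurable]: "g \<in> borel_measurable borel" "v \<in> borel_measurable borel"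
    using g v by (auto intro: bdd_C11_borel)
  obtain C where C: "C \<ge> 0" "\<And>x h. \<bar>(2 * g x - g (x + h) - g (x - h)) / kern s h\<bar>
     \<le> C * (min 1 ((norm h)\<^sup>2) / kern s h)"
    using g by (rule bdd_C11_min) blast
  show ?thesis
  proof (rule Bochner_Integration.integrable_bound)
    show "integrable (lborel \<Otimes>\<^sub>M lborel)
       (\<lambda>(h::real^'n, x). C * (min 1 ((norm h)\<^sup>2) / kern s h) * v x)"
      by (intro integrable_lborel_pair_mult integrable_mult_right integrable_min_kernel s v)
    show "AE z in lborel \<Otimes>\<^sub>M lborel.
       norm (case z of (h, x) \<Rightarrow> v x * ((2 * g x - g (x + h) - g (x - h)) / kern s h))
       \<le> norm (case z of (h::real^'n, x) \<Rightarrow> C * (min 1 ((norm h)\<^sup>2) / kern s h) * v x)"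
    proof (rule AE_I2, clarify)
      fix h x :: "real^'n"
      have "\<bar>v x\<bar> * \<bar>(2 * g x - g (x + h) - g (x - h)) / kern s h\<bar> \<le>
         \<bar>v x\<bar> * (C * (min 1 ((norm h)\<^sup>2) / kern s h))"
        by (intro mult_left_mono C) simp
      then show "norm (v x * ((2 * g x - g (x + h) - g (x - h)) / kern s h))
         \<le> norm (C * (min 1 ((norm h)\<^sup>2) / kern s h) * v x)"
        using C(1) by (simp add: abs_mult mult.commute)
    qed
  qed measurable
qed

lemma integrable_mult_frac_lap:
  fixes g v :: "real ^ 'n \<Rightarrow> real"
  assumes g: "bdd_C11 g" and v: "integrable lborel v"
  shows "integrable lborel (\<lambda>x. v x * frac_lap s g x)"
proof -
  obtain K where K: "\<And>x. \<bar>frac_lap s g x\<bar> \<le> K" using frac_lap_bounded[OF s g] by blast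
  have [measurable]: "frac_lap s g \<in> borel_measurable borel" "v \<in> borel_measurable borel"
    using frac_lap_continuous[OF s g] v by (auto intro: borel_measurable_continuous_onI)
  show ?thesis
  proof (rule Bochner_Integration.integrable_bound[OF integrable_mult_left[OF v, of K]])
    show "AE x in lborel. norm (v x * frac_lap s g x) \<le> norm (v x * K)"
      using K by (intro AE_I2) (simp add: abs_mult mult_left_mono order_trans[OF K abs_ge_self])
  qed measurable
qed

text \<open>A discrete integration by parts. For fixed h the term with v(x + h) is translated back
  to v(x), which turns a first difference of \<open>g\<close> into a second one. Only after this is
  the double integral absolutely convergent for merely integrable \<open>v\<close>, so the order of
  integration is exchanged after, not before, the rearrangement.\<close>

lemma energy_eq_integral_frac_lap:
  fixes g v :: "real ^ 'n \<Rightarrow> real"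
  assumes g: "bdd_C11 g" and v: "integrable lborel v"
    and E: "finite_energy s g v"
  shows "energy_form s g v = (LINT x|lborel. v x * frac_lap s g x)"
proof -
  have [measurable]: "g \<in> borel_measurable borel" "v \<in> borel_measurable borel"
    using g v by (auto intro: bdd_C11_borel)
  obtain C where C0: "C \<ge> 0" and C: "\<And>x. \<bar>g x\<bar> \<le> C"
    using g by (rule bdd_C11E) blast
  have bv: "integrable lborel (\<lambda>x. p x * w x)"
    if w: "integrable lborel w" and [measurable]: "p \<in> borel_measurable borel" and p: "\<And>x. \<bar>p x\<bar> \<le> 2 * C"
    for p w :: "real^'n \<Rightarrow> real"
  proof (rule Bochner_Integration.integrable_bound[OF integrable_mult_right[OF w, of "2 * C"]])
    show "(\<lambda>x. p x * w x) \<in> borel_measurable lborel" using w by measurable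
    show "AE x in lborel. norm (p x * w x) \<le> norm (2 * C * w x)"
      using p C0 by (intro AE_I2) (simp add: abs_mult mult_right_mono)
  qed
  let ?N = "\<lambda>h::real^'n. kern s h"
  have Es: "integrable (lborel \<Otimes>\<^sub>M lborel) (\<lambda>(h, x). energy_integrand s g v (x, x + h))"
    using E by (subst integrable_lborel_pair_shear_iff) auto
  have inner: "(LINT x|lborel. energy_integrand s g v (x, x + h)) =
     (LINT x|lborel. v x * ((2 * g x - g (x + h) - g (x - h)) / ?N h))" for h
  proof -
    have d1: "\<bar>g x - g (x + h)\<bar> \<le> 2 * C" for x using C[of x] C[of "x + h"] by linarith
    have d2: "\<bar>g (x - h) - g x\<bar> \<le> 2 * C" for x using C[of x] C[of "x - h"] by linarith
    have i1: "integrable lborel (\<lambda>x. (g x - g (x + h)) * v x)"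
      by (rule bv[OF v]) (use d1 in measurable)
    have i2: "integrable lborel (\<lambda>x. (g (x - h) - g x) * v x)"
      by (rule bv[OF v]) (use d2 in measurable)
    have i3: "integrable lborel (\<lambda>x. (g x - g (x + h)) * v (x + h))"
      using integrable_lborel_shift[OF i2, of h] by (simp add: algebra_simps)
    \<comment> \<open>The translation x to x - h, which moves the difference from \<open>v\<close>
      to \<open>g\<close>.\<close>
    have e3: "(LINT x|lborel. (g x - g (x + h)) * v (x + h)) = (LINT x|lborel. (g (x - h) - g x) * v x)"
      using integral_lborel_shift[of "\<lambda>x. (g (x - h) - g x) * v x" h] by (simp add: algebra_simps)
    have "(LINT x|lborel. energy_integrand s g v (x, x + h)) =
       (LINT x|lborel. ((g x - g (x + h)) * v x - (g x - g (x + h)) * v (x + h)) / ?N h)"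
      unfolding energy_integrand_shear by (simp add: algebra_simps)
    also have "\<dots> = ((LINT x|lborel. (g x - g (x + h)) * v x) - (LINT x|lborel. (g x - g (x + h)) * v (x + h))) / ?N h"
      using i1 i3 by (simp only: integral_divide_zero Bochner_Integration.integral_diff)
    also have "\<dots> = (LINT x|lborel. ((g x - g (x + h)) * v x - (g (x - h) - g x) * v x) / ?N h)"
      using i1 i2 by (simp only: e3 integral_divide_zero Bochner_Integration.integral_diff)
    also have "\<dots> = (LINT x|lborel. v x * ((2 * g x - g (x + h) - g (x - h)) / ?N h))"
      by (intro Bochner_Integration.integral_cong refl) (simp add: algebra_simps diff_divide_distrib)
    finally show ?thesis .
  qed
  have "energy_form s g v =
     (LINT (h, x)|(lborel \<Otimes>\<^sub>M lborel). energy_integrand s g v (x, x + h))"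
    by (rule integral_lborel_pair_shear[symmetric]) measurable
  also have "\<dots> = (LINT h|lborel. LINT x|lborel. energy_integrand s g v (x, x + h))"
    using lborel_pair.integral_fst'[OF Es] by simp
  also have "\<dots> = (LINT h|lborel. LINT x|lborel. v x * ((2 * g x - g (x + h) - g (x - h)) / ?N h))"
    by (simp only: inner)
  also have "\<dots> = (LINT x|lborel. LINT h|lborel. v x * ((2 * g x - g (x + h) - g (x - h)) / ?N h))"
    using lborel_pair.Fubini_integral[of "\<lambda>h x. v x * ((2 * g x - g (x + h) - g (x - h)) / ?N h)"]
      frac_lap_integrable_pair[OF g v] by simp
  also have "\<dots> = (LINT x|lborel. v x * frac_lap s g x)"
    unfolding frac_lap_def by (simp only: integral_mult_right_zero)
  finally show ?thesis .
qed

end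

section \<open>Weak maximum principle\<close>

text \<open>The Borel measurable counterpart of \<open>Htilde\<close>, with integrals over
  \<open>lborel\<close>; these are the admissible test functions in every weak inequality
  below.\<close>

definition form_fun :: "real \<Rightarrow> (real ^ 'n) set \<Rightarrow> (real ^ 'n \<Rightarrow> real) \<Rightarrow> bool" where
  "form_fun s \<Omega> v \<longleftrightarrow> v \<in> borel_measurable borel \<and> integrable lborel (\<lambda>x. (v x)\<^sup>2) \<and>
     finite_energy s v v \<and> (\<forall>x. x \<notin> \<Omega> \<longrightarrow> v x = 0)"

text \<open>Squaring removes the corner of the positive part at 0, so the squared L^2 norm of a
  positive part can be differentiated in time.\<close>

lemma has_real_derivative_pos_part_square:
  fixes r :: real
  shows "((\<lambda>r. (max 0 r)\<^sup>2) has_real_derivative 2 * max 0 r) (at r)"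
proof -
  consider "r > 0" | "r < 0" | "r = 0" by linarith
  then show ?thesis
  proof cases
    case 1
    have "((\<lambda>r. r\<^sup>2) has_real_derivative 2 * max 0 r) (at r)"
      using 1 by (auto intro!: derivative_eq_intros)
    then show ?thesis
      by (rule has_field_derivative_transform_within_open[where S = "{0<..}"]) (use 1 in auto)
  next
    case 2
    have "((\<lambda>r. 0) has_real_derivative 2 * max 0 r) (at r)" using 2 by simp
    then show ?thesis
      by (rule has_field_derivative_transform_within_open[where S = "{..<0}"]) (use 2 in auto)
  next
    case 3
    have "((\<lambda>h::real. (max 0 h)\<^sup>2 / h) \<longlongrightarrow> 0) (at 0)"
    proof (rule Lim_null_comparison)
      have "norm ((max 0 h)\<^sup>2 / h) \<le> \<bar>h\<bar>" for h :: real
        by (cases "h \<ge> 0") (auto simp: max_def power2_eq_square)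
      then show "\<forall>\<^sub>F h in at 0. norm ((max 0 h)\<^sup>2 / h) \<le> \<bar>h::real\<bar>" by simp
      show "((\<lambda>h::real. \<bar>h\<bar>) \<longlongrightarrow> 0) (at 0)"
        by (rule tendsto_rabs_zero) (rule tendsto_ident_at)
    qed
    then show ?thesis using 3 by (simp add: has_field_derivative_iff)
  qed
qed

text \<open>The positive part is nondecreasing and 1-Lipschitz: the first inequality gives the sign
  of the energy tested with the positive part, the second the finiteness of the energy of the
  positive part.\<close>

lemma pos_part_energy:
  fixes a b :: real
  shows "(max 0 a - max 0 b) * (max 0 a - max 0 b) \<le> (a - b) * (max 0 a - max 0 b)"
    and "(max 0 a - max 0 b) * (max 0 a - max 0 b) \<le> (a - b) * (a - b)"
proof -
  have a: "\<bar>max 0 a - max 0 b\<bar> \<le> \<bar>a - b\<bar>" by (auto simp: max_def abs_if)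
  then show "(max 0 a - max 0 b) * (max 0 a - max 0 b) \<le> (a - b) * (a - b)"
    by (metis abs_mult_self_eq mult_mono' abs_ge_zero)
  show "(max 0 a - max 0 b) * (max 0 a - max 0 b) \<le> (a - b) * (max 0 a - max 0 b)"
    by (cases "a \<ge> 0"; cases "b \<ge> 0")
       (auto simp: max_def mult_nonneg_nonpos mult_nonpos_nonneg algebra_simps mult_nonneg_nonneg)
qed

text \<open>The subsolution is tested with its own positive part.\<close>

lemma pos_part_L2_decreasing:
  fixes \<Psi> \<Psi>' :: "real \<Rightarrow> real ^ 'n \<Rightarrow> real"
  assumes \<Omega>[measurable]: "\<Omega> \<in> sets borel" and \<mu>: "0 \<le> \<mu>"
    and meas[measurable]: "\<And>t. \<Psi> t \<in> borel_measurable borel"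
    and deriv: "\<And>t x. ((\<lambda>r. \<Psi> r x) has_real_derivative \<Psi>' t x) (at t)"
    and bound: "\<And>t x. x \<in> \<Omega> \<Longrightarrow> -1 < t \<Longrightarrow> t < T + 1 \<Longrightarrow> \<bar>\<Psi> t x\<bar> \<le> b x \<and> \<bar>\<Psi>' t x\<bar> \<le> b x"
    and b: "integrable lborel (\<lambda>x. indicator \<Omega> x * (b x)\<^sup>2)"
    and out: "\<And>t x. 0 \<le> t \<Longrightarrow> t \<le> T \<Longrightarrow> x \<notin> \<Omega> \<Longrightarrow> \<Psi> t x \<le> 0"
    and E: "\<And>t. 0 \<le> t \<Longrightarrow> t \<le> T \<Longrightarrow> finite_energy s (\<Psi> t) (\<Psi> t)"
    and weak: "\<And>t p. 0 \<le> t \<Longrightarrow> t \<le> T \<Longrightarrow> form_fun s \<Omega> p \<Longrightarrow> (\<And>x. 0 \<le> p x) \<Longrightarrow>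
      (LINT x|lborel. \<Psi>' t x * p x) \<le> - \<mu> * energy_form s (\<Psi> t) p"
    and T: "0 \<le> T"
  shows "(LINT x|lborel. indicator \<Omega> x * (max 0 (\<Psi> T x))\<^sup>2) \<le> (LINT x|lborel. indicator \<Omega> x * (max 0 (\<Psi> 0 x))\<^sup>2)"
proof -
  define y where "y t = (LINT x|lborel. indicator \<Omega> x * (max 0 (\<Psi> t x))\<^sup>2)" for t
  have sq: "(max 0 (\<Psi> t x))\<^sup>2 \<le> (b x)\<^sup>2" if "x \<in> \<Omega>" "-1 < t" "t < T + 1" for t x
    using bound[OF that] by (intro power_mono) auto
  have int: "integrable lborel (\<lambda>x. indicator \<Omega> x * (max 0 (\<Psi> t x))\<^sup>2)" if "-1 < t" "t < T + 1" for t
  proof (rule Bochner_Integration.integrable_bound[OF b])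
    show "AE x in lborel. norm (indicator \<Omega> x * (max 0 (\<Psi> t x))\<^sup>2) \<le> norm (indicator \<Omega> x * (b x)\<^sup>2)"
      using sq that by (intro AE_I2) (auto simp: indicator_def)
  qed measurable
  have "\<exists>d. (y has_real_derivative d) (at t) \<and> d \<le> 0" if t: "0 \<le> t" "t \<le> T" for t
  proof -
    have dy: "(y has_real_derivative (LINT x|lborel. indicator \<Omega> x * (2 * max 0 (\<Psi> t x) * \<Psi>' t x))) (at t)"
      unfolding y_def
    \<comment> \<open>The bounds are assumed on (-1, T + 1) so that a two-sided derivative exists at
      the end points 0 and T as well.\<close>
    proof (rule has_real_derivative_lebesgue_integral[where e = 1 and B = "\<lambda>x. 2 * (indicator \<Omega> x * (b x)\<^sup>2)"])
      fix r :: real and x :: "real^'n" assume r: "\<bar>r - t\<bar> < 1"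
      have r': "-1 < r" "r < T + 1" using r t by auto
      show "integrable lborel (\<lambda>x. indicator \<Omega> x * (max 0 (\<Psi> r x))\<^sup>2)" by (rule int[OF r'])
      have "((\<lambda>r. (max 0 (\<Psi> r x))\<^sup>2) has_real_derivative (2 * max 0 (\<Psi> r x)) * \<Psi>' r x) (at r)"
        by (rule DERIV_chain2[OF has_real_derivative_pos_part_square deriv])
      then show "((\<lambda>r. indicator \<Omega> x * (max 0 (\<Psi> r x))\<^sup>2) has_real_derivative
          indicator \<Omega> x * (2 * max 0 (\<Psi> r x) * \<Psi>' r x)) (at r)"
        by (rule DERIV_cmult)
      show "\<bar>indicator \<Omega> x * (2 * max 0 (\<Psi> r x) * \<Psi>' r x)\<bar> \<le> 2 * (indicator \<Omega> x * (b x)\<^sup>2)"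
      proof (cases "x \<in> \<Omega>")
        case True
        have "\<bar>max 0 (\<Psi> r x)\<bar> * \<bar>\<Psi>' r x\<bar> \<le> b x * b x"
          using bound[OF True r'] by (intro mult_mono) auto
        then show ?thesis using True by (simp add: abs_mult power2_eq_square)
      qed simp
    qed (use b in auto)
    define p where "p x = max 0 (\<Psi> t x)" for x
    have [measurable]: "p \<in> borel_measurable borel" unfolding p_def by measurable
    have pout: "p x = 0" if "x \<notin> \<Omega>" for x using out[OF t that] unfolding p_def by simp
    have p0: "p x \<ge> 0" for x unfolding p_def by simp
    \<comment> \<open>\<open>le1\<close> makes the positive part an admissible test function;
      \<open>ge\<close> and \<open>le2\<close> make the tested energy nonnegative, hence the time
      derivative nonpositive.\<close>
    have le1: "energy_integrand s p p z \<le> energy_integrand s (\<Psi> t) (\<Psi> t) z"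
      and le2: "energy_integrand s p p z \<le> energy_integrand s (\<Psi> t) p z"
      and ge: "0 \<le> energy_integrand s p p z" for z
      unfolding energy_integrand_def p_def
      by (auto simp: case_prod_unfold intro!: divide_right_mono pos_part_energy)
    have Ep: "finite_energy s p p"
      by (rule Bochner_Integration.integrable_bound[OF E[OF t]])
         (auto intro!: order_trans[OF _ abs_ge_self] le1 simp: ge)
    have p2: "(p x)\<^sup>2 = indicator \<Omega> x * (max 0 (\<Psi> t x))\<^sup>2" for x
      using pout[of x] unfolding p_def by (auto simp: indicator_def)
    have form: "form_fun s \<Omega> p"
      unfolding form_fun_def p2 using Ep pout int[of t] t by auto
    have "0 \<le> energy_form s (\<Psi> t) p"
      by (intro Bochner_Integration.integral_nonneg order_trans[OF ge le2])
    then have "(LINT x|lborel. \<Psi>' t x * p x) \<le> 0"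
      using weak[OF t form p0] \<mu> by (simp add: order_trans)
    moreover have "(LINT x|lborel. indicator \<Omega> x * (2 * max 0 (\<Psi> t x) * \<Psi>' t x)) = 2 * (LINT x|lborel. \<Psi>' t x * p x)"
    proof -
      have "indicator \<Omega> x * (2 * max 0 (\<Psi> t x) * \<Psi>' t x) = 2 * (\<Psi>' t x * p x)" for x
        using pout[of x] unfolding p_def by (auto simp: indicator_def)
      then show ?thesis by (simp only: integral_mult_right_zero)
    qed
    ultimately show ?thesis using dy by auto
  qed
  then have "y T \<le> y 0" using T by (intro DERIV_nonpos_imp_nonincreasing[of 0 T y]) auto
  then show ?thesis unfolding y_def .
qed

text \<open>The positive part of \<open>D\<close> is at most that of \<open>G m\<close> plus |D - G
  m|, so its squared L^2 norm is at most twice the sum of two null sequences.\<close>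

lemma AE_nonpos_if_L2_limit:
  fixes D :: "real ^ 'n \<Rightarrow> real" and G :: "nat \<Rightarrow> real ^ 'n \<Rightarrow> real"
  assumes [measurable]: "\<Omega> \<in> sets borel" "D \<in> borel_measurable borel" "\<And>m. G m \<in> borel_measurable borel"
    and D: "integrable lborel (\<lambda>x. indicator \<Omega> x * (D x)\<^sup>2)"
    and G: "\<And>m. integrable lborel (\<lambda>x. indicator \<Omega> x * (G m x)\<^sup>2)"
    and lim1: "(\<lambda>m. LINT x|lborel. indicator \<Omega> x * (max 0 (G m x))\<^sup>2) \<longlonglongrightarrow> 0"
    and lim2: "(\<lambda>m. LINT x|lborel. indicator \<Omega> x * (D x - G m x)\<^sup>2) \<longlonglongrightarrow> 0"
  shows "AE x in lborel. x \<in> \<Omega> \<longrightarrow> D x \<le> 0"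
proof -
  have i1: "integrable lborel (\<lambda>x. indicator \<Omega> x * (max 0 (G m x))\<^sup>2)" for m
    by (rule Bochner_Integration.integrable_bound[OF G[of m]]) (auto simp: indicator_def max_def)
  have i2: "integrable lborel (\<lambda>x. indicator \<Omega> x * (D x - G m x)\<^sup>2)" for m
  proof (rule Bochner_Integration.integrable_bound[OF integrable_mult_right[OF Bochner_Integration.integrable_add[OF D G[of m]], of 2]])
    show "AE x in lborel. norm (indicator \<Omega> x * (D x - G m x)\<^sup>2) \<le>
        norm (2 * (indicator \<Omega> x * (D x)\<^sup>2 + indicator \<Omega> x * (G m x)\<^sup>2))"
    proof (rule AE_I2)
      fix x
      have "(D x - G m x)\<^sup>2 \<le> 2 * ((D x)\<^sup>2 + (G m x)\<^sup>2)"
        using zero_le_power2[of "D x + G m x"] by (simp add: power2_eq_square algebra_simps)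
      then show "norm (indicator \<Omega> x * (D x - G m x)\<^sup>2) \<le>
        norm (2 * (indicator \<Omega> x * (D x)\<^sup>2 + indicator \<Omega> x * (G m x)\<^sup>2))"
        by (auto simp: indicator_def)
    qed
  qed measurable
  have i0: "integrable lborel (\<lambda>x. indicator \<Omega> x * (max 0 (D x))\<^sup>2)"
    by (rule Bochner_Integration.integrable_bound[OF D]) (auto simp: indicator_def max_def)
  have "(LINT x|lborel. indicator \<Omega> x * (max 0 (D x))\<^sup>2) \<le>
     2 * (LINT x|lborel. indicator \<Omega> x * (max 0 (G m x))\<^sup>2) + 2 * (LINT x|lborel. indicator \<Omega> x * (D x - G m x)\<^sup>2)" for m
  proof -
    have "(LINT x|lborel. indicator \<Omega> x * (max 0 (D x))\<^sup>2) \<le>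
      (LINT x|lborel. 2 * (indicator \<Omega> x * (max 0 (G m x))\<^sup>2) + 2 * (indicator \<Omega> x * (D x - G m x)\<^sup>2))"
    proof (intro integral_mono)
      fix x
      have "max 0 (D x) \<le> max 0 (G m x) + \<bar>D x - G m x\<bar>" by (auto simp: max_def)
      then have "(max 0 (D x))\<^sup>2 \<le> (max 0 (G m x) + \<bar>D x - G m x\<bar>)\<^sup>2" by (intro power_mono) auto
      also have "\<dots> \<le> 2 * (max 0 (G m x))\<^sup>2 + 2 * \<bar>D x - G m x\<bar>\<^sup>2"
        using zero_le_power2[of "max 0 (G m x) - \<bar>D x - G m x\<bar>"]
        by (simp add: power2_sum power2_diff)
      finally show "indicator \<Omega> x * (max 0 (D x))\<^sup>2 \<le>
        2 * (indicator \<Omega> x * (max 0 (G m x))\<^sup>2) + 2 * (indicator \<Omega> x * (D x - G m x)\<^sup>2)"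
        by (auto simp: indicator_def)
    qed (use i0 i1 i2 in auto)
    then show ?thesis using i1 i2 by simp
  qed
  moreover have "(\<lambda>m. 2 * (LINT x|lborel. indicator \<Omega> x * (max 0 (G m x))\<^sup>2) + 2 * (LINT x|lborel. indicator \<Omega> x * (D x - G m x)\<^sup>2)) \<longlonglongrightarrow> 2 * 0 + 2 * 0"
    by (intro tendsto_intros lim1 lim2)
  ultimately have "(LINT x|lborel. indicator \<Omega> x * (max 0 (D x))\<^sup>2) \<le> 0"
    by (intro LIMSEQ_le_const[where X = "\<lambda>m. 2 * (LINT x|lborel. indicator \<Omega> x * (max 0 (G m x))\<^sup>2) + 2 * (LINT x|lborel. indicator \<Omega> x * (D x - G m x)\<^sup>2)"]) auto
  then have "(LINT x|lborel. indicator \<Omega> x * (max 0 (D x))\<^sup>2) = 0"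
    by (intro antisym Bochner_Integration.integral_nonneg) auto
  then have "AE x in lborel. indicator \<Omega> x * (max 0 (D x))\<^sup>2 = 0"
    using integral_nonneg_eq_0_iff_AE[OF i0] by simp
  then show ?thesis
    by eventually_elim (auto simp: indicator_def max_def split: if_splits)
qed

lemma integrable_indicator_square_bounded:
  fixes f :: "real ^ 'n \<Rightarrow> real"
  assumes "\<Omega> \<in> sets borel" "f \<in> borel_measurable borel" "bounded \<Omega>" "\<And>x. \<bar>f x\<bar> \<le> C"
  shows "integrable lborel (\<lambda>x. indicator \<Omega> x * (f x)\<^sup>2)"
proof (rule integrable_bounded_support[OF _ _ \<open>bounded \<Omega>\<close>])
  show "(\<lambda>x. indicator \<Omega> x * (f x)\<^sup>2) \<in> borel_measurable borel" using assms(1,2) by measurable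
  show "\<bar>indicator \<Omega> x * (f x)\<^sup>2\<bar> \<le> C\<^sup>2" for x
    using power_mono[OF assms(4)[of x], of 2] by (auto simp: indicator_def)
qed simp

text \<open>The set where a continuous function is positive is open, and a nonempty open set is not
  null. This recovers pointwise values from L^2 information.\<close>

lemma nonpos_if_AE_nonpos:
  fixes f :: "real ^ 'n \<Rightarrow> real"
  assumes ae: "AE x in lborel. x \<in> \<Omega> \<longrightarrow> f x \<le> 0" and "open \<Omega>" "continuous_on \<Omega> f" "x \<in> \<Omega>"
  shows "f x \<le> 0"
proof (rule ccontr)
  assume "\<not> f x \<le> 0"
  have op: "open (\<Omega> \<inter> f -` {0<..})"
    by (rule continuous_open_preimage) (use assms in auto)
  have "AE y in lborel. y \<notin> \<Omega> \<inter> f -` {0<..}" using ae by eventually_elim auto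
  then have "\<Omega> \<inter> f -` {0<..} \<in> null_sets lborel"
    using op by (subst AE_iff_null_sets) auto
  then have "negligible (\<Omega> \<inter> f -` {0<..})"
    by (simp add: negligible_iff_null_sets null_sets_completionI)
  then have "\<Omega> \<inter> f -` {0<..} = {}" using op open_not_negligible by blast
  then show False using \<open>\<not> f x \<le> 0\<close> \<open>x \<in> \<Omega>\<close> by auto
qed

section \<open>Eigenfunction series\<close>

lemma integrable_mult_L2:
  fixes f g :: "'a \<Rightarrow> real"
  assumes [measurable]: "f \<in> borel_measurable M" "g \<in> borel_measurable M"
    and f: "integrable M (\<lambda>x. (f x)\<^sup>2)" and g: "integrable M (\<lambda>x. (g x)\<^sup>2)"
  shows "integrable M (\<lambda>x. f x * g x)"
proof (rule Bochner_Integration.integrable_bound[OF Bochner_Integration.integrable_add[OF f g]])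
  have "\<bar>a * b\<bar> \<le> a\<^sup>2 + b\<^sup>2" for a b :: real
  proof -
    have "0 \<le> \<bar>a\<bar> * \<bar>b\<bar>" by simp
    moreover have "2 * \<bar>a\<bar> * \<bar>b\<bar> \<le> a\<^sup>2 + b\<^sup>2"
      using sum_squares_bound[of "\<bar>a\<bar>" "\<bar>b\<bar>"] by simp
    ultimately show ?thesis unfolding abs_mult by linarith
  qed
  then show "AE x in M. norm (f x * g x) \<le> norm ((f x)\<^sup>2 + (g x)\<^sup>2)" by simp
qed measurable

lemma integrable_square_add:
  fixes f g :: "'a \<Rightarrow> real"
  assumes m: "f \<in> borel_measurable M" "g \<in> borel_measurable M"
    and f: "integrable M (\<lambda>x. (f x)\<^sup>2)" and g: "integrable M (\<lambda>x. (g x)\<^sup>2)"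
  shows "integrable M (\<lambda>x. (f x + g x)\<^sup>2)"
  using integrable_mult_L2[OF m f g] f g by (simp add: power2_sum mult.assoc)

lemma integrable_square_sum:
  fixes f :: "nat \<Rightarrow> 'a \<Rightarrow> real"
  assumes "\<And>k. f k \<in> borel_measurable M" "\<And>k. integrable M (\<lambda>x. (f k x)\<^sup>2)"
  shows "integrable M (\<lambda>x. (\<Sum>k<m. f k x)\<^sup>2)"
proof (induction m)
  case (Suc m)
  have "(\<lambda>x. \<Sum>k<m. f k x) \<in> borel_measurable M" using assms(1) by measurable
  then show ?case using integrable_square_add[OF _ assms(1) Suc assms(2)] by simp
qed simp

lemma form_fun_D:
  assumes "form_fun s \<Omega> v"
  shows "v \<in> borel_measurable borel" "integrable lborel (\<lambda>x. (v x)\<^sup>2)"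
    "finite_energy s v v" "\<And>x. x \<notin> \<Omega> \<Longrightarrow> v x = 0"
  using assms unfolding form_fun_def by auto

lemma energy_uminus:
  fixes u v :: "real ^ 'n \<Rightarrow> real"
  shows "finite_energy s u v \<Longrightarrow>
      finite_energy s (\<lambda>x. u (- x)) (\<lambda>x. v (- x))"
    and "energy_form s (\<lambda>x. u (- x)) (\<lambda>x. v (- x)) =
      energy_form s u v"
proof -
  have e: "energy_integrand s (\<lambda>x. u (- x)) (\<lambda>x. v (- x)) = (\<lambda>z. energy_integrand s u v (- z))"
    unfolding energy_integrand_def by (auto simp: norm_minus_commute)
  show "finite_energy s u v \<Longrightarrow>
      finite_energy s (\<lambda>x. u (- x)) (\<lambda>x. v (- x))"
    unfolding e lborel_prod by (rule integrable_lborel_uminus)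
  show "energy_form s (\<lambda>x. u (- x)) (\<lambda>x. v (- x)) =
      energy_form s u v"
    unfolding e lborel_prod by (rule integral_lborel_uminus)
qed

lemma energy_integrand_add_left:
  "energy_integrand s (\<lambda>x. u x + v x) p z = energy_integrand s u p z + energy_integrand s v p z"
proof (cases z)
  case (Pair x y)
  have "(u x + v x - (u y + v y)) * q = (u x - u y) * q + (v x - v y) * q" for q :: real
    by (simp add: algebra_simps)
  then show ?thesis unfolding Pair energy_integrand_def by (simp add: add_divide_distrib)
qed

lemma energy_integrand_diff_left:
  "energy_integrand s (\<lambda>x. u x - v x) p z = energy_integrand s u p z - energy_integrand s v p z"
proof (cases z)
  case (Pair x y)
  have "(u x - v x - (u y - v y)) * q = (u x - u y) * q - (v x - v y) * q" for q :: real
    by (simp add: algebra_simps)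
  then show ?thesis unfolding Pair energy_integrand_def by (simp add: diff_divide_distrib)
qed

text \<open>Completeness of the modes is deliberately kept out: comparison is proved for finite
  sums, and completeness enters only when the sums converge at time 0. As \<open>\<alpha>\<close>
  occurs in no assumption, the results hold for every coefficient sequence, which the reflection
  argument uses with a change of sign.\<close>

locale frac_modes =
  fixes s :: real and \<Omega> :: "(real ^ 'n) set" and \<mu> :: real
    and \<psi> :: "nat \<Rightarrow> real ^ 'n \<Rightarrow> real" and ev \<alpha> :: "nat \<Rightarrow> real"
  assumes \<Omega>: "open \<Omega>" "bounded \<Omega>" and \<mu>: "0 < \<mu>"
    and form: "\<And>k. form_fun s \<Omega> (\<psi> k)"
    and eigen: "\<And>k v. form_fun s \<Omega> v \<Longrightarrow>
      \<mu> * energy_form s (\<psi> k) v = ev k * (LINT x|lborel. \<psi> k x * v x)"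
begin

definition flow :: "nat \<Rightarrow> real \<Rightarrow> real ^ 'n \<Rightarrow> real" where
  "flow m t x = (\<Sum>k<m. exp (- ev k * t) * \<alpha> k * \<psi> k x)"

definition flow' :: "nat \<Rightarrow> real \<Rightarrow> real ^ 'n \<Rightarrow> real" where
  "flow' m t x = (\<Sum>k<m. - ev k * exp (- ev k * t) * \<alpha> k * \<psi> k x)"

lemma \<Omega>_borel [measurable]: "\<Omega> \<in> sets borel"
  using \<Omega> by simp

lemma \<psi>_borel [measurable]: "\<psi> k \<in> borel_measurable borel"
  using form by (rule form_fun_D)

lemma flow_borel [measurable]: "flow m t \<in> borel_measurable borel" "flow' m t \<in> borel_measurable borel"
  unfolding flow_def[abs_def] flow'_def[abs_def] by measurable

lemma flow_outside: "x \<notin> \<Omega> \<Longrightarrow> flow m t x = 0"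
  using form_fun_D(4)[OF form] by (simp add: flow_def)

lemma flow_deriv: "((\<lambda>r. flow m r x) has_real_derivative flow' m t x) (at t)"
  unfolding flow_def flow'_def by (auto intro!: derivative_eq_intros sum.cong)

lemma flow_square_integrable:
  "integrable lborel (\<lambda>x. (flow m t x)\<^sup>2)" "integrable lborel (\<lambda>x. (flow' m t x)\<^sup>2)"
  unfolding flow_def flow'_def
  by (intro integrable_square_sum; use form_fun_D[OF form] in \<open>simp add: power_mult_distrib\<close>)+

lemma flow_L2_integrable: "integrable lborel (\<lambda>x. indicator \<Omega> x * (flow m t x)\<^sup>2)"
  by (rule Bochner_Integration.integrable_bound[OF flow_square_integrable(1)[of m t]]) (auto simp: indicator_def)

lemma flow_bound:
  obtains b where "b \<in> borel_measurable borel" "integrable lborel (\<lambda>x. (b x)\<^sup>2)"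
    "\<And>t x. -1 < t \<Longrightarrow> t < T + 1 \<Longrightarrow> \<bar>flow m t x\<bar> \<le> b x \<and> \<bar>flow' m t x\<bar> \<le> b x"
proof
  \<comment> \<open>The sign of \<open>ev k\<close> is left open, and negative times above -1 must
    be covered, hence the absolute values; the factor 1 + |ev k| serves \<open>flow\<close> and its
    time derivative at once.\<close>
  define c where "c k = (1 + \<bar>ev k\<bar>) * exp (\<bar>ev k\<bar> * (\<bar>T\<bar> + 1)) * \<bar>\<alpha> k\<bar>" for k
  define b where "b x = (\<Sum>k<m. c k * \<bar>\<psi> k x\<bar>)" for x
  show "b \<in> borel_measurable borel" unfolding b_def by measurable
  show "integrable lborel (\<lambda>x. (b x)\<^sup>2)"
    unfolding b_def
    by (intro integrable_square_sum; use form_fun_D[OF form] in \<open>simp add: power_mult_distrib\<close>)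
  fix t :: real and x assume t: "-1 < t" "t < T + 1"
  have ex: "exp (- ev k * t) \<le> exp (\<bar>ev k\<bar> * (\<bar>T\<bar> + 1))" for k
  proof -
    have "- ev k * t \<le> \<bar>ev k\<bar> * \<bar>t\<bar>" by (metis abs_ge_self abs_minus_cancel abs_mult)
    also have "\<dots> \<le> \<bar>ev k\<bar> * (\<bar>T\<bar> + 1)" using t by (intro mult_left_mono) auto
    finally show ?thesis by simp
  qed
  have 1: "\<bar>exp (- ev k * t) * \<alpha> k * \<psi> k x\<bar> \<le> c k * \<bar>\<psi> k x\<bar>" for k
  proof -
    have "1 * exp (- ev k * t) \<le> (1 + \<bar>ev k\<bar>) * exp (\<bar>ev k\<bar> * (\<bar>T\<bar> + 1))"
      by (intro mult_mono ex) auto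
    then show ?thesis unfolding c_def by (simp add: abs_mult mult_right_mono)
  qed
  have 2: "\<bar>- ev k * exp (- ev k * t) * \<alpha> k * \<psi> k x\<bar> \<le> c k * \<bar>\<psi> k x\<bar>" for k
  proof -
    have "\<bar>ev k\<bar> * exp (- ev k * t) \<le> (1 + \<bar>ev k\<bar>) * exp (\<bar>ev k\<bar> * (\<bar>T\<bar> + 1))"
      by (intro mult_mono ex) auto
    then show ?thesis unfolding c_def by (simp add: abs_mult mult_right_mono)
  qed
  show "\<bar>flow m t x\<bar> \<le> b x \<and> \<bar>flow' m t x\<bar> \<le> b x"
    unfolding flow_def flow'_def b_def
    by (intro conjI order_trans[OF sum_abs] sum_mono 1 2)
qed

lemma flow_energy_integrable: "finite_energy s (flow m t) (flow m t)"
proof (induction m)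
  case 0
  have "energy_integrand s (flow 0 t) (flow 0 t) = (\<lambda>z. 0)"
    unfolding energy_integrand_def flow_def by auto
  then show ?case by simp
next
  case (Suc m)
  have "flow (Suc m) t = (\<lambda>x. flow m t x + (exp (- ev m * t) * \<alpha> m) * \<psi> m x)"
    unfolding flow_def by auto
  then show ?case
    using energy_integrable_add[OF _ _ Suc energy_integrable_cmult[OF form_fun_D(3)[OF form[of m]]]]
    by simp
qed

lemma flow_weak:
  assumes p: "form_fun s \<Omega> p"
  shows "(LINT x|lborel. flow' m t x * p x) = - \<mu> * energy_form s (flow m t) p"
proof -
  note p' = form_fun_D[OF p]
  have i1: "integrable lborel (\<lambda>x. \<psi> k x * p x)" for k
    using integrable_mult_L2[of "\<psi> k" lborel p] form_fun_D[OF form] p' by simp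
  have i2: "finite_energy s (\<psi> k) p" for k
    by (rule energy_integrable_cross) (use form_fun_D[OF form] p' in auto)
  have f: "flow' m t x * p x = (\<Sum>k<m. (- exp (- ev k * t) * \<alpha> k * ev k) * (\<psi> k x * p x))" for x
    unfolding flow'_def sum_distrib_right by (intro sum.cong refl) simp
  have g: "energy_integrand s (flow m t) p z = (\<Sum>k<m. (exp (- ev k * t) * \<alpha> k) * energy_integrand s (\<psi> k) p z)" for z
  proof (cases z)
    case (Pair x y)
    have "flow m t x - flow m t y = (\<Sum>k<m. (exp (- ev k * t) * \<alpha> k) * (\<psi> k x - \<psi> k y))"
      unfolding flow_def sum_subtractf[symmetric] right_diff_distrib ..
    then show ?thesis
      unfolding Pair energy_integrand_def prod.case
      by (simp only: sum_distrib_right sum_divide_distrib mult.assoc times_divide_eq_right)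
  qed
  have "(LINT x|lborel. flow' m t x * p x) = (\<Sum>k<m. (- exp (- ev k * t) * \<alpha> k) * (ev k * (LINT x|lborel. \<psi> k x * p x)))"
    unfolding f using i1
    by (subst Bochner_Integration.integral_sum) (auto intro!: sum.cong integrable_mult_right)
  also have "\<dots> = (\<Sum>k<m. (- \<mu>) * ((exp (- ev k * t) * \<alpha> k) * energy_form s (\<psi> k) p))"
    unfolding eigen[OF p, symmetric] by (intro sum.cong refl) simp
  also have "\<dots> = - \<mu> * energy_form s (flow m t) p"
    unfolding g using i2
    by (subst Bochner_Integration.integral_sum) (auto simp: sum_distrib_left intro!: sum.cong integrable_mult_right)
  finally show ?thesis .
qed

lemma form_fun_integrable:
  assumes "form_fun s \<Omega> p" shows "integrable lborel p"
proof -
  note p = form_fun_D[OF assms]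
  have [measurable]: "p \<in> borel_measurable borel" by (rule p)
  have "integrable lborel (indicator \<Omega> :: _ \<Rightarrow> real)"
    by (rule integrable_bounded_support[OF _ _ \<Omega>(2), of _ 1]) (auto simp: indicator_def)
  then have "integrable lborel (\<lambda>x. indicator \<Omega> x + (p x)\<^sup>2)"
    using p(2) by (rule Bochner_Integration.integrable_add)
  then show ?thesis
  proof (rule Bochner_Integration.integrable_bound)
    have "\<bar>p x\<bar> \<le> indicator \<Omega> x + (p x)\<^sup>2" for x
    proof (cases "x \<in> \<Omega>")
      case True
      have "2 * \<bar>p x\<bar> \<le> 1 + (p x)\<^sup>2" using zero_le_power2[of "\<bar>p x\<bar> - 1"] by (simp add: power2_diff)
      then show ?thesis using True by simp
    next
      case False then show ?thesis using p(4) by simp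
    qed
    then show "AE x in lborel. norm (p x) \<le> norm (indicator \<Omega> x + (p x)\<^sup>2)"
      by (intro AE_I2) (auto intro!: order_trans[OF _ abs_ge_self])
  qed measurable
qed

text \<open>The difference of a finite eigenfunction sum and a weak supersolution is a weak
  subsolution; it is nonpositive outside \<Omega>, where the sum vanishes and the barrier is
  nonnegative. Hence the L^2 norm of its positive part cannot grow.\<close>

lemma flow_barrier:
  assumes T: "0 \<le> T"
    and [measurable]: "\<And>t. \<Phi> t \<in> borel_measurable borel" "\<And>t. \<Phi>' t \<in> borel_measurable borel"
    and deriv: "\<And>t x. ((\<lambda>r. \<Phi> r x) has_real_derivative \<Phi>' t x) (at t)"
    and bound: "\<And>t x. -1 < t \<Longrightarrow> t < T + 1 \<Longrightarrow> \<bar>\<Phi> t x\<bar> \<le> C \<and> \<bar>\<Phi>' t x\<bar> \<le> C"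
    and out: "\<And>t x. 0 \<le> t \<Longrightarrow> t \<le> T \<Longrightarrow> x \<notin> \<Omega> \<Longrightarrow> 0 \<le> \<Phi> t x"
    and E: "\<And>t. finite_energy s (\<Phi> t) (\<Phi> t)"
    and super: "\<And>t p. 0 \<le> t \<Longrightarrow> t \<le> T \<Longrightarrow> form_fun s \<Omega> p \<Longrightarrow> (\<And>x. 0 \<le> p x) \<Longrightarrow>
      - \<mu> * energy_form s (\<Phi> t) p \<le> (LINT x|lborel. \<Phi>' t x * p x)"
  shows "(LINT x|lborel. indicator \<Omega> x * (max 0 (flow m T x - \<Phi> T x))\<^sup>2)
    \<le> (LINT x|lborel. indicator \<Omega> x * (max 0 (flow m 0 x - \<Phi> 0 x))\<^sup>2)"
proof -
  obtain b where b[measurable]: "b \<in> borel_measurable borel" and b2: "integrable lborel (\<lambda>x. (b x)\<^sup>2)"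
    and bf: "\<And>t x. -1 < t \<Longrightarrow> t < T + 1 \<Longrightarrow> \<bar>flow m t x\<bar> \<le> b x \<and> \<bar>flow' m t x\<bar> \<le> b x"
    using flow_bound[of T m] by blast
  have C0: "C \<ge> 0" using bound[of 0 0] T by linarith
  show ?thesis
  proof (rule pos_part_L2_decreasing[where \<Psi>' = "\<lambda>t x. flow' m t x - \<Phi>' t x" and \<mu> = \<mu> and s = s and b = "\<lambda>x. b x + C"])
    show "((\<lambda>r. flow m r x - \<Phi> r x) has_real_derivative flow' m t x - \<Phi>' t x) (at t)" for t x
      by (intro DERIV_diff flow_deriv deriv)
    show "\<bar>flow m t x - \<Phi> t x\<bar> \<le> b x + C \<and> \<bar>flow' m t x - \<Phi>' t x\<bar> \<le> b x + C"
      if "-1 < t" "t < T + 1" for t x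
      using bf[OF that, of x] bound[OF that, of x] by auto
    have "integrable lborel (\<lambda>x. (C * indicator \<Omega> x)\<^sup>2)"
      by (rule integrable_bounded_support[OF _ _ \<Omega>(2), of _ "C\<^sup>2"]) (auto simp: indicator_def)
    then have "integrable lborel (\<lambda>x. (b x + C * indicator \<Omega> x)\<^sup>2)"
      by (intro integrable_square_add b2) auto
    then show "integrable lborel (\<lambda>x. indicator \<Omega> x * (b x + C)\<^sup>2)"
      by (rule Bochner_Integration.integrable_bound) (auto simp: indicator_def)
    show "finite_energy s (\<lambda>x. flow m t x - \<Phi> t x) (\<lambda>x. flow m t x - \<Phi> t x)" for t
      using energy_integrable_add[OF _ _ flow_energy_integrable[of m t] energy_integrable_cmult[OF E[of t], of "-1"]]
      by simp
    fix t p assume t: "0 \<le> t" "t \<le> T" and p: "form_fun s \<Omega> p" and p0: "\<And>x. 0 \<le> p x"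
    note p' = form_fun_D[OF p]
    have [measurable]: "p \<in> borel_measurable borel" by (rule p')
    have i1: "integrable lborel (\<lambda>x. flow' m t x * p x)"
      using integrable_mult_L2[of "flow' m t" lborel p] flow_square_integrable p' by simp
    have i2: "integrable lborel (\<lambda>x. \<Phi>' t x * p x)"
    proof (rule Bochner_Integration.integrable_bound[OF integrable_mult_right[OF form_fun_integrable[OF p], of C]])
      show "AE x in lborel. norm (\<Phi>' t x * p x) \<le> norm (C * p x)"
        using bound[of t] t C0 by (intro AE_I2) (simp add: abs_mult mult_right_mono)
    qed measurable
    have j1: "finite_energy s (flow m t) p"
      by (rule energy_integrable_cross) (use flow_energy_integrable p' in auto)
    have j2: "finite_energy s (\<Phi> t) p"
      by (rule energy_integrable_cross) (use E p' in auto)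
    have "(LINT x|lborel. (flow' m t x - \<Phi>' t x) * p x) = (LINT x|lborel. flow' m t x * p x) - (LINT x|lborel. \<Phi>' t x * p x)"
      using i1 i2 by (simp add: left_diff_distrib)
    also have "\<dots> \<le> - \<mu> * (energy_form s (flow m t) p
        - energy_form s (\<Phi> t) p)"
      using super[OF t p p0] flow_weak[OF p, of m t] by (simp add: algebra_simps)
    also have "energy_form s (flow m t) p
        - energy_form s (\<Phi> t) p =
       (LINT z|(lborel \<Otimes>\<^sub>M lborel). energy_integrand s (flow m t) p z - energy_integrand s (\<Phi> t) p z)"
      using j1 j2 by simp
    also have "(\<lambda>z. energy_integrand s (flow m t) p z - energy_integrand s (\<Phi> t) p z) =
        energy_integrand s (\<lambda>x. flow m t x - \<Phi> t x) p"
      by (rule ext) (simp add: energy_integrand_diff_left)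
    finally show "(LINT x|lborel. (flow' m t x - \<Phi>' t x) * p x)
       \<le> - \<mu> * energy_form s (\<lambda>x. flow m t x - \<Phi> t x) p" .
  qed (use \<mu> T out flow_outside in auto)
qed

text \<open>Reflection preserves the energy form and, for symmetric \<Omega>, the test functions, so
  the sum of \<open>flow\<close> and its reflection solves the same weak equation.\<close>

lemma flow_reflection:
  assumes T: "0 \<le> T" and sym: "\<And>x. x \<in> \<Omega> \<Longrightarrow> - x \<in> \<Omega>"
  shows "(LINT x|lborel. indicator \<Omega> x * (max 0 (flow m T x + flow m T (- x)))\<^sup>2)
    \<le> (LINT x|lborel. indicator \<Omega> x * (max 0 (flow m 0 x + flow m 0 (- x)))\<^sup>2)"
proof -
  obtain b where b[measurable]: "b \<in> borel_measurable borel" and b2: "integrable lborel (\<lambda>x. (b x)\<^sup>2)"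
    and bf: "\<And>t x. -1 < t \<Longrightarrow> t < T + 1 \<Longrightarrow> \<bar>flow m t x\<bar> \<le> b x \<and> \<bar>flow' m t x\<bar> \<le> b x"
    using flow_bound[of T m] by blast
  have sym': "x \<notin> \<Omega> \<Longrightarrow> - x \<notin> \<Omega>" for x using sym[of "- x"] by auto
  show ?thesis
  proof (rule pos_part_L2_decreasing[where \<Psi>' = "\<lambda>t x. flow' m t x + flow' m t (- x)" and \<mu> = \<mu> and s = s and b = "\<lambda>x. b x + b (- x)"])
    show "((\<lambda>r. flow m r x + flow m r (- x)) has_real_derivative flow' m t x + flow' m t (- x)) (at t)" for t x
      by (intro DERIV_add flow_deriv)
    show "\<bar>flow m t x + flow m t (- x)\<bar> \<le> b x + b (- x) \<and> \<bar>flow' m t x + flow' m t (- x)\<bar> \<le> b x + b (- x)"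
      if "-1 < t" "t < T + 1" for t x
      using bf[OF that, of x] bf[OF that, of "- x"] by linarith
    have "integrable lborel (\<lambda>x. (b x + b (- x))\<^sup>2)"
      using integrable_lborel_uminus[OF b2] by (intro integrable_square_add b2) auto
    then show "integrable lborel (\<lambda>x. indicator \<Omega> x * (b x + b (- x))\<^sup>2)"
      by (rule Bochner_Integration.integrable_bound) (auto simp: indicator_def)
    show "finite_energy s (\<lambda>x. flow m t x + flow m t (- x)) (\<lambda>x. flow m t x + flow m t (- x))" for t
      using energy_integrable_add[OF _ _ flow_energy_integrable[of m t] energy_uminus(1)[OF flow_energy_integrable[of m t]]]
      by simp
    fix t p assume t: "0 \<le> t" "t \<le> T" and p: "form_fun s \<Omega> p" and p0: "\<And>x. 0 \<le> p x"
    note p' = form_fun_D[OF p]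
    have [measurable]: "p \<in> borel_measurable borel" by (rule p')
    \<comment> \<open>This is the only place where the symmetry of \<Omega> yields an admissible
      test function: the reflected one must still vanish outside \<Omega>.\<close>
    have q: "form_fun s \<Omega> (\<lambda>x. p (- x))"
      unfolding form_fun_def
      using integrable_lborel_uminus[OF p'(2)] energy_uminus(1)[OF p'(3)] sym' p'(4) by auto
    have i1: "integrable lborel (\<lambda>x. flow' m t x * p x)"
      using integrable_mult_L2[of "flow' m t" lborel p] flow_square_integrable p' by simp
    have i2: "integrable lborel (\<lambda>x. flow' m t (- x) * p x)"
      using integrable_mult_L2[of "\<lambda>x. flow' m t (- x)" lborel p]
        integrable_lborel_uminus[OF flow_square_integrable(2)] p' by simp
    have j1: "finite_energy s (flow m t) p"
      by (rule energy_integrable_cross) (use flow_energy_integrable p' in auto)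
    have j2: "finite_energy s (\<lambda>x. flow m t (- x)) p"
      by (rule energy_integrable_cross) (use energy_uminus(1)[OF flow_energy_integrable] p' in auto)
    have "(LINT x|lborel. flow' m t (- x) * p x) = (LINT x|lborel. flow' m t x * p (- x))"
      using integral_lborel_uminus[of "\<lambda>x. flow' m t x * p (- x)"] by simp
    also have "\<dots> = - \<mu> * energy_form s (flow m t) (\<lambda>x. p (- x))"
      by (rule flow_weak[OF q])
    also have "\<dots> = - \<mu> * energy_form s (\<lambda>x. flow m t (- x)) p"
      using energy_uminus(2)[of s "flow m t" "\<lambda>x. p (- x)"] by simp
    finally have e2: "(LINT x|lborel. flow' m t (- x) * p x) =
      - \<mu> * energy_form s (\<lambda>x. flow m t (- x)) p" .
    have "(LINT x|lborel. (flow' m t x + flow' m t (- x)) * p x) =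
        (LINT x|lborel. flow' m t x * p x) + (LINT x|lborel. flow' m t (- x) * p x)"
      using i1 i2 by (simp add: distrib_right)
    also have "\<dots> = - \<mu> * (energy_form s (flow m t) p
        + energy_form s (\<lambda>x. flow m t (- x)) p)"
      unfolding e2 flow_weak[OF p] by (simp add: algebra_simps)
    also have "energy_form s (flow m t) p
        + energy_form s (\<lambda>x. flow m t (- x)) p =
       (LINT z|(lborel \<Otimes>\<^sub>M lborel). energy_integrand s (flow m t) p z + energy_integrand s (\<lambda>x. flow m t (- x)) p z)"
      using j1 j2 by simp
    also have "(\<lambda>z. energy_integrand s (flow m t) p z + energy_integrand s (\<lambda>x. flow m t (- x)) p z) =
        energy_integrand s (\<lambda>x. flow m t x + flow m t (- x)) p"
      by (rule ext) (simp add: energy_integrand_add_left)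
    finally show "(LINT x|lborel. (flow' m t x + flow' m t (- x)) * p x)
       \<le> - \<mu> * energy_form s (\<lambda>x. flow m t x + flow m t (- x)) p" by simp
  qed (use \<mu> T flow_outside sym' in auto)
qed

end

section \<open>Borel representatives of the eigenfunctions and of the series\<close>

lemma AE_lborel_pair:
  fixes P :: "'a::euclidean_space \<Rightarrow> bool"
  assumes "AE x in lborel. P x"
  shows "AE z in lborel \<Otimes>\<^sub>M lborel. P (fst z) \<and> P (snd z)"
proof -
  obtain N where N: "N \<in> null_sets lborel" "{x \<in> space lborel. \<not> P x} \<subseteq> N"
    by (rule AE_E3[OF assms]) (rule that, auto)
  have [measurable]: "N \<in> sets borel" using N by auto
  have n: "AE x in lborel. x \<notin> N" using N(1) by (rule AE_not_in)
  have "AE z in lborel \<Otimes>\<^sub>M lborel. fst z \<notin> N \<and> snd z \<notin> N"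
  proof (rule lborel_pair.AE_pair_measure)
    show "{z \<in> space (lborel \<Otimes>\<^sub>M lborel). fst z \<notin> N \<and> snd z \<notin> N} \<in> sets (lborel \<Otimes>\<^sub>M lborel)"
      by measurable
    show "AE x in lborel. AE y in lborel. fst (x, y) \<notin> N \<and> snd (x, y) \<notin> N"
      using n by eventually_elim (use n in simp)
  qed
  then show ?thesis by eventually_elim (use N in auto)
qed

lemma borel_measurable_completion_AE_eq:
  fixes f g :: "'a \<Rightarrow> 'b::topological_space"
  assumes ae: "AE x in M. f x = g x" and g: "g \<in> borel_measurable M"
  shows "f \<in> borel_measurable (completion M)"
proof -
  obtain N where N: "N \<in> null_sets M" "{x \<in> space M. f x \<noteq> g x} \<subseteq> N"
    by (rule AE_E3[OF ae]) (rule that, auto)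
  show ?thesis
  proof (rule borel_measurableI)
    fix S :: "'b set" assume "open S"
    have "f -` S \<inter> N \<inter> space M \<in> null_sets (completion M)"
      by (rule null_sets_completion_subset[of _ N]) (use N in \<open>auto intro: null_sets_completionI\<close>)
    moreover have "(g -` S \<inter> space M) - N \<in> sets (completion M)"
    proof -
      have "g -` S \<inter> space M \<in> sets M" using g \<open>open S\<close> by (auto intro: measurable_sets)
      then show ?thesis using N by (intro sets_completionI_sets) auto
    qed
    moreover have "f -` S \<inter> space (completion M) = (f -` S \<inter> N \<inter> space M) \<union> ((g -` S \<inter> space M) - N)"
      using N(2) by auto
    ultimately show "f -` S \<inter> space (completion M) \<in> sets (completion M)" by auto
  qed
qed

lemma form_fun_Htilde:
  assumes "form_fun s \<Omega> v" shows "v \<in> Htilde s \<Omega>"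
proof -
  note v = form_fun_D[OF assms]
  have [measurable]: "v \<in> borel_measurable borel" by (rule v)
  have "energy_integrand s v v \<in> borel_measurable lborel"
    using energy_integrand_measurable[of v v s] v(1) by (simp add: lborel_prod)
  then have "integrable lebesgue (energy_integrand s v v)"
    using v(3) by (simp add: integrable_completion lborel_prod)
  moreover have "v \<in> L2_on UNIV"
    using v(1,2)
    by (simp add: L2_on_def set_borel_measurable_def set_integrable_def measurable_completion integrable_completion)
  ultimately show ?thesis using v(4) by (simp add: Htilde_def)
qed

text \<open>The eigenfunctions are only Lebesgue measurable, while Fubini is used on Borel products.
  A modification on a null set of points alters the energy integrand only on a null set of pairs, so
  the eigenvalue equation survives.\<close>

lemma eigenbasis_borel_modes:
  fixes \<phi> :: "nat \<Rightarrow> real ^ 'n \<Rightarrow> real"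
  assumes eb: "frac_eigenbasis s \<Omega> \<phi> ev" and \<Omega>: "open \<Omega>"
  obtains \<psi> where "\<And>k. form_fun s \<Omega> (\<psi> k)" "\<And>k. AE x in lborel. \<phi> k x = \<psi> k x"
    "\<And>k v. form_fun s \<Omega> v \<Longrightarrow> frac_const TYPE('n) s / 2 *
      energy_form s (\<psi> k) v = ev k * (LINT x|lborel. \<psi> k x * v x)"
proof -
  have H: "\<phi> k \<in> Htilde s \<Omega>" for k using eb unfolding frac_eigenbasis_def by blast
  have \<phi>m: "\<phi> k \<in> borel_measurable lebesgue" for k
    using H[of k] unfolding Htilde_def L2_on_def set_borel_measurable_def by simp
  then have "\<exists>g\<in>borel_measurable lborel. AE x in lborel. \<phi> k x = g x" for k
    by (rule completion_ex_borel_measurable_real)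
  then obtain g where g: "\<And>k. g k \<in> borel_measurable lborel" "\<And>k. AE x in lborel. \<phi> k x = g k x"
    by metis
  \<comment> \<open>The indicator keeps the exterior condition everywhere, not just almost
    everywhere.\<close>
  define \<psi> where "\<psi> k x = indicator \<Omega> x * g k x" for k x
  have [measurable]: "\<Omega> \<in> sets borel" using \<Omega> by simp
  have \<psi>m[measurable]: "\<psi> k \<in> borel_measurable borel" for k
    using g(1)[of k] unfolding \<psi>_def by measurable
  have out: "x \<notin> \<Omega> \<Longrightarrow> \<phi> k x = 0" for k x using H[of k] by (simp add: Htilde_def)
  have ae: "AE x in lborel. \<phi> k x = \<psi> k x" for k
    using g(2)[of k]
    by eventually_elim (auto simp: \<psi>_def indicator_def out)
  have ae2: "AE z in lborel. energy_integrand s (\<phi> k) v z = energy_integrand s (\<psi> k) v z" for k v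
    using AE_lborel_pair[OF ae[of k]] unfolding lborel_prod
    by eventually_elim (auto simp: energy_integrand_def)
  have ae3: "AE z in lborel. energy_integrand s (\<phi> k) (\<phi> k) z = energy_integrand s (\<psi> k) (\<psi> k) z" for k
    using AE_lborel_pair[OF ae[of k]] unfolding lborel_prod
    by eventually_elim (auto simp: energy_integrand_def)
  have Em: "energy_integrand s (\<psi> k) v \<in> borel_measurable lborel" if "v \<in> borel_measurable borel" for k v
    using energy_integrand_measurable[OF \<psi>m that] by (simp add: lborel_prod)
  have "integrable lebesgue (energy_integrand s (\<psi> k) (\<psi> k))" for k
  proof -
    have "integrable lebesgue (energy_integrand s (\<phi> k) (\<phi> k))" using H[of k] by (simp add: Htilde_def)
    then show ?thesis
      by (rule integrable_cong_AE_imp) (use AE_completion[OF ae3] Em in \<open>auto intro: measurable_completion\<close>)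
  qed
  then have E: "finite_energy s (\<psi> k) (\<psi> k)" for k
    using Em[OF \<psi>m] by (simp add: integrable_completion lborel_prod)
  have "integrable lebesgue (\<lambda>x. (\<psi> k x)\<^sup>2)" for k
  proof -
    have "integrable lebesgue (\<lambda>x. (\<phi> k x)\<^sup>2)"
      using H[of k] by (simp add: Htilde_def L2_on_def set_integrable_def)
    then show ?thesis
      by (rule integrable_cong_AE_imp) (use AE_completion[OF ae[of k]] in \<open>auto intro: measurable_completion\<close>)
  qed
  then have sq: "integrable lborel (\<lambda>x. (\<psi> k x)\<^sup>2)" for k
    by (subst (asm) integrable_completion) auto
  have form: "form_fun s \<Omega> (\<psi> k)" for k
    unfolding form_fun_def using E sq by (auto simp: \<psi>_def)
  have eig: "frac_const TYPE('n) s / 2 *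
      energy_form s (\<psi> k) v = ev k * (LINT x|lborel. \<psi> k x * v x)"
    if v: "form_fun s \<Omega> v" for k v
  proof -
    note v' = form_fun_D[OF v]
    have [measurable]: "v \<in> borel_measurable borel" by (rule v')
    have vl: "v \<in> borel_measurable lebesgue" using v'(1) by (auto intro: measurable_completion)
    have "energy s (\<phi> k) v = (LINT z|lebesgue. energy_integrand s (\<psi> k) v z)"
      unfolding energy_def
    proof (rule integral_cong_AE)
      show 1: "energy_integrand s (\<psi> k) v \<in> borel_measurable lebesgue"
        using Em[OF v'(1)] by (rule measurable_completion)
      show 2: "AE z in lebesgue. energy_integrand s (\<phi> k) v z = energy_integrand s (\<psi> k) v z"
        using ae2 by (rule AE_completion)
      show "energy_integrand s (\<phi> k) v \<in> borel_measurable lebesgue"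
        using ae2 Em[OF v'(1)] by (intro borel_measurable_completion_AE_eq[of _ "energy_integrand s (\<psi> k) v"]) auto
    qed
    also have "\<dots> = energy_form s (\<psi> k) v"
      using Em[OF v'(1)] by (simp add: integral_completion lborel_prod)
    finally have 1: "energy s (\<phi> k) v = energy_form s (\<psi> k) v" .
    have "L2_inner \<Omega> (\<phi> k) v = (LINT x|lebesgue. \<psi> k x * v x)"
      unfolding L2_inner_def set_lebesgue_integral_def
    proof (rule integral_cong_AE)
      show "AE x in lebesgue. indicator \<Omega> x *\<^sub>R (\<phi> k x * v x) = \<psi> k x * v x"
        using AE_completion[OF ae[of k]]
        by eventually_elim (auto simp: indicator_def v'(4))
      show "(\<lambda>x. indicator \<Omega> x *\<^sub>R (\<phi> k x * v x)) \<in> borel_measurable lebesgue"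
        unfolding real_scaleR_def
        by (intro borel_measurable_times \<phi>m vl) (auto intro: measurable_completion)
      show "(\<lambda>x. \<psi> k x * v x) \<in> borel_measurable lebesgue"
        using \<psi>m[of k] v'(1) by (auto intro: measurable_completion)
    qed
    also have "\<dots> = (LINT x|lborel. \<psi> k x * v x)"
      by (rule integral_completion) simp
    finally have 2: "L2_inner \<Omega> (\<phi> k) v = (LINT x|lborel. \<psi> k x * v x)" .
    show ?thesis
      using eb form_fun_Htilde[OF v] unfolding frac_eigenbasis_def 1[symmetric] 2[symmetric] by blast
  qed
  show thesis using that form ae eig by blast
qed

lemma L2_sums_borel:
  fixes f g :: "nat \<Rightarrow> real ^ 'n \<Rightarrow> real"
  assumes "L2_sums \<Omega> f w" and \<Omega>: "open \<Omega>" and w: "w \<in> borel_measurable borel"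
    and g: "\<And>k. g k \<in> borel_measurable borel" and ae: "\<And>k. AE x in lborel. f k x = g k x"
  shows "(\<lambda>n. LINT x|lborel. indicator \<Omega> x * (w x - (\<Sum>k<n. g k x))\<^sup>2) \<longlonglongrightarrow> 0"
    and "integrable lborel (\<lambda>x. indicator \<Omega> x * (w x)\<^sup>2)"
proof -
  have [measurable]: "\<Omega> \<in> sets borel" "w \<in> borel_measurable borel" "g k \<in> borel_measurable borel" for k
    using \<Omega> w g by auto
  have wL: "w \<in> L2_on \<Omega>" and fL: "f k \<in> L2_on \<Omega>" for k using assms(1) by (auto simp: L2_sums_def)
  show "integrable lborel (\<lambda>x. indicator \<Omega> x * (w x)\<^sup>2)"
    using wL by (simp add: L2_on_def set_integrable_def) (subst (asm) integrable_completion, auto)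
  have fm: "(\<lambda>x. indicator \<Omega> x * f k x) \<in> borel_measurable lebesgue" for k
    using fL[of k] by (simp add: L2_on_def set_borel_measurable_def)
  have "(LINT x:\<Omega>|lebesgue. (w x - (\<Sum>k<n. f k x))\<^sup>2) =
     (LINT x|lborel. indicator \<Omega> x * (w x - (\<Sum>k<n. g k x))\<^sup>2)" for n
  proof -
    have "(LINT x:\<Omega>|lebesgue. (w x - (\<Sum>k<n. f k x))\<^sup>2) =
      (LINT x|lebesgue. indicator \<Omega> x * (w x - (\<Sum>k<n. g k x))\<^sup>2)"
      unfolding set_lebesgue_integral_def
    proof (rule integral_cong_AE)
      have "AE x in lborel. \<forall>k. f k x = g k x" using ae by (simp add: AE_all_countable)
      then have "AE x in lebesgue. \<forall>k. f k x = g k x" by (rule AE_completion)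
      then show "AE x in lebesgue. indicator \<Omega> x *\<^sub>R (w x - (\<Sum>k<n. f k x))\<^sup>2
          = indicator \<Omega> x * (w x - (\<Sum>k<n. g k x))\<^sup>2"
        by eventually_elim simp
      have wl: "w \<in> borel_measurable lebesgue" using w by (auto intro: measurable_completion)
      have il: "(indicator \<Omega> :: _ \<Rightarrow> real) \<in> borel_measurable lebesgue"
        by (auto intro: measurable_completion)
      have "(\<lambda>x. (indicator \<Omega> x * w x - (\<Sum>k<n. indicator \<Omega> x * f k x))\<^sup>2) \<in> borel_measurable lebesgue"
        using wl il fm by (intro borel_measurable_power borel_measurable_diff borel_measurable_sum borel_measurable_times[OF il wl] fm)
      also have "(\<lambda>x. (indicator \<Omega> x * w x - (\<Sum>k<n. indicator \<Omega> x * f k x))\<^sup>2) =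
          (\<lambda>x. indicator \<Omega> x *\<^sub>R (w x - (\<Sum>k<n. f k x))\<^sup>2)"
        by (auto simp: indicator_def fun_eq_iff)
      finally show "(\<lambda>x. indicator \<Omega> x *\<^sub>R (w x - (\<Sum>k<n. f k x))\<^sup>2) \<in> borel_measurable lebesgue" .
      have "(\<lambda>x. indicator \<Omega> x * (w x - (\<Sum>k<n. g k x))\<^sup>2) \<in> borel_measurable lborel" by measurable
      then show "(\<lambda>x. indicator \<Omega> x * (w x - (\<Sum>k<n. g k x))\<^sup>2) \<in> borel_measurable lebesgue"
        by (rule measurable_completion)
    qed
    also have "\<dots> = (LINT x|lborel. indicator \<Omega> x * (w x - (\<Sum>k<n. g k x))\<^sup>2)"
      by (rule integral_completion) measurable
    finally show ?thesis .
  qed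
  then show "(\<lambda>n. LINT x|lborel. indicator \<Omega> x * (w x - (\<Sum>k<n. g k x))\<^sup>2) \<longlonglongrightarrow> 0"
    using assms(1) unfolding L2_sums_def by simp
qed

lemma smooth_on_continuous: "smooth_on S f \<Longrightarrow> continuous_on S f"
  unfolding smooth_on_def using Ck_on.simps(1) by blast

text \<open>Collects all that the comparison arguments take from the notion of solution: finite sums
  of Borel modes converging in L^2 to \<open>u\<close> at positive times and to \<open>u0\<close> at
  time 0, and the measurability, square integrability and interior continuity of
  \<open>u\<close>.\<close>

lemma heat_solution_modes:
  fixes u0 :: "real ^ 'n \<Rightarrow> real"
  assumes sol: "frac_heat_solution s \<Omega> u0 u" and \<Omega>: "open \<Omega>" "bounded \<Omega>"
    and c: "0 < frac_const TYPE('n) s"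
    and u0: "u0 \<in> borel_measurable borel" "\<And>x. \<bar>u0 x\<bar> \<le> C"
  obtains \<psi> ev \<alpha> where "frac_modes s \<Omega> (frac_const TYPE('n) s / 2) \<psi> ev"
    "(\<lambda>n. LINT x|lborel. indicator \<Omega> x * (u0 x - frac_modes.flow \<psi> ev \<alpha> n 0 x)\<^sup>2) \<longlonglongrightarrow> 0"
    "\<And>t. t > 0 \<Longrightarrow> (\<lambda>n. LINT x|lborel. indicator \<Omega> x * (u x t - frac_modes.flow \<psi> ev \<alpha> n t x)\<^sup>2) \<longlonglongrightarrow> 0"
    "\<And>t. t > 0 \<Longrightarrow> (\<lambda>x. u x t) \<in> borel_measurable borel"
    "\<And>t. t > 0 \<Longrightarrow> integrable lborel (\<lambda>x. indicator \<Omega> x * (u x t)\<^sup>2)"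
    "\<And>t. t > 0 \<Longrightarrow> continuous_on \<Omega> (\<lambda>x. u x t)"
proof -
  obtain \<phi> ev where eb: "frac_eigenbasis s \<Omega> \<phi> ev"
    and ser: "\<And>t. t > 0 \<Longrightarrow> L2_sums \<Omega> (\<lambda>k x. exp (- ev k * t) * L2_inner \<Omega> u0 (\<phi> k) * \<phi> k x) (\<lambda>x. u x t)"
    using sol unfolding frac_heat_solution_def by blast
  obtain \<psi> where \<psi>: "\<And>k. form_fun s \<Omega> (\<psi> k)" "\<And>k. AE x in lborel. \<phi> k x = \<psi> k x"
    "\<And>k v. form_fun s \<Omega> v \<Longrightarrow> frac_const TYPE('n) s / 2 *
      energy_form s (\<psi> k) v = ev k * (LINT x|lborel. \<psi> k x * v x)"
    using eigenbasis_borel_modes[OF eb \<Omega>(1)] by blast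
  have [measurable]: "\<psi> k \<in> borel_measurable borel" for k using \<psi>(1) by (rule form_fun_D)
  have [measurable]: "\<Omega> \<in> sets borel" using \<Omega> by simp
  define \<alpha> where "\<alpha> k = L2_inner \<Omega> u0 (\<phi> k)" for k
  interpret frac_modes s \<Omega> "frac_const TYPE('n) s / 2" \<psi> ev \<alpha>
    by unfold_locales (use \<Omega> c \<psi> in auto)
  have cont: "continuous_on \<Omega> (\<lambda>x. u x t)" if "t > 0" for t
    using sol that unfolding frac_heat_solution_def by (auto intro: smooth_on_continuous)
  have ub: "(\<lambda>x. u x t) \<in> borel_measurable borel" if "t > 0" for t
  proof -
    \<comment> \<open>Continuity inside \<Omega> and the value 0 outside make the solution Borel
      measurable.\<close>
    have "(\<lambda>x. indicator \<Omega> x *\<^sub>R u x t) \<in> borel_measurable borel"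
      by (rule borel_measurable_continuous_on_indicator) (use cont[OF that] in auto)
    also have "(\<lambda>x. indicator \<Omega> x *\<^sub>R u x t) = (\<lambda>x. u x t)"
      using sol that unfolding frac_heat_solution_def by (auto simp: indicator_def fun_eq_iff)
    finally show ?thesis .
  qed
  have ae: "AE x in lborel. exp (- ev k * t) * L2_inner \<Omega> u0 (\<phi> k) * \<phi> k x = exp (- ev k * t) * \<alpha> k * \<psi> k x" for k t
    using \<psi>(2)[of k] by eventually_elim (simp add: \<alpha>_def)
  have lt: "(\<lambda>n. LINT x|lborel. indicator \<Omega> x * (u x t - flow n t x)\<^sup>2) \<longlonglongrightarrow> 0"
      "integrable lborel (\<lambda>x. indicator \<Omega> x * (u x t)\<^sup>2)" if "t > 0" for t
    using L2_sums_borel[OF ser[OF that] \<Omega>(1) ub[OF that] _ ae] unfolding flow_def by auto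
  have "u0 \<in> L2_on \<Omega>"
  proof -
    have "integrable lborel (\<lambda>x. indicator \<Omega> x * (u0 x)\<^sup>2)"
      by (rule integrable_indicator_square_bounded) (use \<Omega> u0 in auto)
    moreover have "(\<lambda>x. indicator \<Omega> x *\<^sub>R u0 x) \<in> borel_measurable lborel" using u0(1) by simp
    moreover have "(\<lambda>x. indicator \<Omega> x * (u0 x)\<^sup>2) \<in> borel_measurable lborel" using u0(1) by simp
    ultimately show ?thesis
      unfolding L2_on_def set_borel_measurable_def set_integrable_def
      by (auto simp: integrable_completion intro: measurable_completion)
  qed
  \<comment> \<open>The series assumption speaks of positive times only; convergence at time 0 comes
    from the completeness of the basis.\<close>
  then have "L2_sums \<Omega> (\<lambda>k x. \<alpha> k * \<phi> k x) u0"
    using eb unfolding frac_eigenbasis_def L2_orthonormal_basis_def \<alpha>_def by blast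
  then have l0: "(\<lambda>n. LINT x|lborel. indicator \<Omega> x * (u0 x - flow n 0 x)\<^sup>2) \<longlonglongrightarrow> 0"
    unfolding flow_def
    by (rule L2_sums_borel(1)[OF _ \<Omega>(1) u0(1)]) (use ae[of _ 0] in \<open>auto simp: \<alpha>_def\<close>)
  show thesis
    by (rule that[OF frac_modes_axioms l0 lt(1) ub lt(2) cont])
qed

lemma frac_const_pos:
  assumes "0 < s" "s < 1" shows "0 < frac_const TYPE('n) s"
  unfolding frac_const_def using assms
  by (intro divide_pos_pos mult_pos_pos Gamma_real_pos) auto

lemma integral_square_reflection_le:
  fixes e :: "real ^ 'n \<Rightarrow> real"
  assumes [measurable]: "e \<in> borel_measurable borel" "\<Omega> \<in> sets borel"
    and e: "integrable lborel (\<lambda>x. indicator \<Omega> x * (e x)\<^sup>2)" and sym: "\<And>x. x \<in> \<Omega> \<Longrightarrow> - x \<in> \<Omega>"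
  shows "(LINT x|lborel. indicator \<Omega> x * (e x + e (- x))\<^sup>2) \<le> 4 * (LINT x|lborel. indicator \<Omega> x * (e x)\<^sup>2)"
    and "integrable lborel (\<lambda>x. indicator \<Omega> x * (e x + e (- x))\<^sup>2)"
proof -
  have ind: "indicator \<Omega> (- x) = (indicator \<Omega> x :: real)" for x
    using sym[of x] sym[of "- x"] by (auto simp: indicator_def)
  have e': "integrable lborel (\<lambda>x. indicator \<Omega> x * (e (- x))\<^sup>2)"
    using integrable_lborel_uminus[OF e] by (simp add: ind)
  have eq: "(LINT x|lborel. indicator \<Omega> x * (e (- x))\<^sup>2) = (LINT x|lborel. indicator \<Omega> x * (e x)\<^sup>2)"
    using integral_lborel_uminus[of "\<lambda>x. indicator \<Omega> x * (e x)\<^sup>2"] by (simp add: ind)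
  have le: "indicator \<Omega> x * (e x + e (- x))\<^sup>2 \<le> 2 * (indicator \<Omega> x * (e x)\<^sup>2) + 2 * (indicator \<Omega> x * (e (- x))\<^sup>2)" for x
    using zero_le_power2[of "e x - e (- x)"] by (auto simp: indicator_def power2_sum power2_diff)
  show i: "integrable lborel (\<lambda>x. indicator \<Omega> x * (e x + e (- x))\<^sup>2)"
    by (rule Bochner_Integration.integrable_bound[where f = "\<lambda>x. 2 * (indicator \<Omega> x * (e x)\<^sup>2) + 2 * (indicator \<Omega> x * (e (- x))\<^sup>2)"])
       (use e e' le in auto)
  have "(LINT x|lborel. indicator \<Omega> x * (e x + e (- x))\<^sup>2) \<le>
     (LINT x|lborel. 2 * (indicator \<Omega> x * (e x)\<^sup>2) + 2 * (indicator \<Omega> x * (e (- x))\<^sup>2))"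
    by (rule integral_mono) (use i e e' le in auto)
  also have "\<dots> = 4 * (LINT x|lborel. indicator \<Omega> x * (e x)\<^sup>2)"
    using e e' eq by simp
  finally show "(LINT x|lborel. indicator \<Omega> x * (e x + e (- x))\<^sup>2) \<le> 4 * (LINT x|lborel. indicator \<Omega> x * (e x)\<^sup>2)" .
qed

lemma integrable_indicator_square_diff:
  fixes f g :: "real ^ 'n \<Rightarrow> real"
  assumes [measurable]: "\<Omega> \<in> sets borel" "f \<in> borel_measurable borel" "g \<in> borel_measurable borel"
    and f: "integrable lborel (\<lambda>x. indicator \<Omega> x * (f x)\<^sup>2)" and g: "integrable lborel (\<lambda>x. indicator \<Omega> x * (g x)\<^sup>2)"
  shows "integrable lborel (\<lambda>x. indicator \<Omega> x * (f x - g x)\<^sup>2)"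
proof -
  have le: "indicator \<Omega> x * (f x - g x)\<^sup>2 \<le> 2 * (indicator \<Omega> x * (f x)\<^sup>2) + 2 * (indicator \<Omega> x * (g x)\<^sup>2)" for x
    using zero_le_power2[of "f x + g x"] by (auto simp: indicator_def power2_sum power2_diff)
  show ?thesis
    by (rule Bochner_Integration.integrable_bound[where f = "\<lambda>x. 2 * (indicator \<Omega> x * (f x)\<^sup>2) + 2 * (indicator \<Omega> x * (g x)\<^sup>2)"])
       (use f g le in auto)
qed

section \<open>Pointwise comparison for the solution of the heat equation\<close>

context
  fixes s :: real and \<Omega> :: "(real ^ 'n) set" and u0 u
  assumes s: "0 < s" "s < 1" and \<Omega>: "open \<Omega>" "bounded \<Omega>"
    and sol: "frac_heat_solution s \<Omega> u0 u" and u0: "bdd_C11 u0"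
begin

text \<open>The sign \<sigma> = 1 or -1 covers both one-sided estimates. The initial data being odd,
  the symmetrised finite sums tend to 0 in L^2 at time 0, and by \<open>flow_reflection\<close> so
  do their positive parts at time \<open>T\<close>.\<close>

lemma heat_solution_odd_nonpos:
  assumes sym: "\<And>x. x \<in> \<Omega> \<Longrightarrow> - x \<in> \<Omega>" and odd: "\<And>x. u0 (- x) = - u0 x"
    and T: "T > 0" and x: "x \<in> \<Omega>" and \<sigma>: "\<sigma>\<^sup>2 = 1"
  shows "\<sigma> * (u x T + u (- x) T) \<le> 0"
proof -
  obtain C where C: "\<And>x. \<bar>u0 x\<bar> \<le> C" using u0 by (rule bdd_C11E) blast
  have u0b[measurable]: "u0 \<in> borel_measurable borel" using u0 by (rule bdd_C11_borel)
  obtain \<psi> ev \<alpha> where m: "frac_modes s \<Omega> (frac_const TYPE('n) s / 2) \<psi> ev"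
    and l0: "(\<lambda>n. LINT x|lborel. indicator \<Omega> x * (u0 x - frac_modes.flow \<psi> ev \<alpha> n 0 x)\<^sup>2) \<longlonglongrightarrow> 0"
    and lt: "\<And>t. t > 0 \<Longrightarrow> (\<lambda>n. LINT x|lborel. indicator \<Omega> x * (u x t - frac_modes.flow \<psi> ev \<alpha> n t x)\<^sup>2) \<longlonglongrightarrow> 0"
    and ub: "\<And>t. t > 0 \<Longrightarrow> (\<lambda>x. u x t) \<in> borel_measurable borel"
    and ui: "\<And>t. t > 0 \<Longrightarrow> integrable lborel (\<lambda>x. indicator \<Omega> x * (u x t)\<^sup>2)"
    and uc: "\<And>t. t > 0 \<Longrightarrow> continuous_on \<Omega> (\<lambda>x. u x t)"
    using heat_solution_modes[OF sol \<Omega> frac_const_pos[OF s] u0b C] by blast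
  interpret frac_modes s \<Omega> "frac_const TYPE('n) s / 2" \<psi> ev \<alpha> by (rule m)
  have [measurable]: "(\<lambda>x. u x T) \<in> borel_measurable borel" by (rule ub[OF T])
  have u0i: "integrable lborel (\<lambda>x. indicator \<Omega> x * (u0 x)\<^sup>2)"
    by (rule integrable_indicator_square_bounded) (use \<Omega> C in auto)
  have e0: "integrable lborel (\<lambda>x. indicator \<Omega> x * (u0 x - flow n 0 x)\<^sup>2)" for n
    by (rule integrable_indicator_square_diff) (use u0i flow_L2_integrable in auto)
  have eT: "integrable lborel (\<lambda>x. indicator \<Omega> x * (u x T - flow n T x)\<^sup>2)" for n
    by (rule integrable_indicator_square_diff) (use ui[OF T] flow_L2_integrable in auto)
  have refl: "(LINT x|lborel. indicator \<Omega> x * (max 0 (\<sigma> * (flow n T x + flow n T (- x))))\<^sup>2)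
     \<le> (LINT x|lborel. indicator \<Omega> x * (max 0 (\<sigma> * (flow n 0 x + flow n 0 (- x))))\<^sup>2)" for n
  proof -
    \<comment> \<open>The sign is absorbed into the coefficients, so \<open>flow_reflection\<close>
      applies unchanged.\<close>
    have "frac_modes.flow \<psi> ev (\<lambda>k. \<sigma> * \<alpha> k) n t x = \<sigma> * flow n t x" for t x
      unfolding frac_modes.flow_def[OF m] by (simp add: sum_distrib_left mult_ac)
    then show ?thesis
      using frac_modes.flow_reflection[OF m, where T = T and m = n and \<alpha> = "\<lambda>k. \<sigma> * \<alpha> k"] T sym by (simp add: distrib_left)
  qed
  have "AE x in lborel. x \<in> \<Omega> \<longrightarrow> \<sigma> * (u x T + u (- x) T) \<le> 0"
  proof (rule AE_nonpos_if_L2_limit[where G = "\<lambda>n x. \<sigma> * (flow n T x + flow n T (- x))"])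
    show "integrable lborel (\<lambda>x. indicator \<Omega> x * (\<sigma> * (u x T + u (- x) T))\<^sup>2)"
      unfolding power_mult_distrib \<sigma> mult_1
      by (rule integral_square_reflection_le(2)[OF _ _ ui[OF T]]) (use sym in auto)
    show "integrable lborel (\<lambda>x. indicator \<Omega> x * (\<sigma> * (flow n T x + flow n T (- x)))\<^sup>2)" for n
      unfolding power_mult_distrib \<sigma> mult_1
      by (rule integral_square_reflection_le(2)[OF _ _ flow_L2_integrable]) (use sym in auto)
    show "(\<lambda>n. LINT x|lborel. indicator \<Omega> x * (max 0 (\<sigma> * (flow n T x + flow n T (- x))))\<^sup>2) \<longlonglongrightarrow> 0"
    proof (rule tendsto_sandwich[OF _ _ tendsto_const])
      show "\<forall>\<^sub>F n in sequentially. 0 \<le> (LINT x|lborel. indicator \<Omega> x * (max 0 (\<sigma> * (flow n T x + flow n T (- x))))\<^sup>2)"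
        by (intro always_eventually allI Bochner_Integration.integral_nonneg) auto
      have "(LINT x|lborel. indicator \<Omega> x * (max 0 (\<sigma> * (flow n T x + flow n T (- x))))\<^sup>2)
         \<le> 4 * (LINT x|lborel. indicator \<Omega> x * (u0 x - flow n 0 x)\<^sup>2)" for n
      proof -
        have "(LINT x|lborel. indicator \<Omega> x * (max 0 (\<sigma> * (flow n T x + flow n T (- x))))\<^sup>2)
           \<le> (LINT x|lborel. indicator \<Omega> x * (max 0 (\<sigma> * (flow n 0 x + flow n 0 (- x))))\<^sup>2)"
          by (rule refl)
        also have "\<dots> \<le> (LINT x|lborel. indicator \<Omega> x * (u0 x - flow n 0 x + (u0 (- x) - flow n 0 (- x)))\<^sup>2)"
        proof (rule integral_mono_AE)
          show "integrable lborel (\<lambda>x. indicator \<Omega> x * (u0 x - flow n 0 x + (u0 (- x) - flow n 0 (- x)))\<^sup>2)"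
            by (rule integral_square_reflection_le(2)[OF _ _ e0]) (use sym in auto)
          have "integrable lborel (\<lambda>x. indicator \<Omega> x * (flow n 0 x + flow n 0 (- x))\<^sup>2)"
            by (rule integral_square_reflection_le(2)[OF _ _ flow_L2_integrable]) (use sym in auto)
          note li = this
          have ml: "(max 0 (\<sigma> * a))\<^sup>2 \<le> a\<^sup>2" for a :: real
          proof -
            have "(max 0 (\<sigma> * a))\<^sup>2 \<le> (\<sigma> * a)\<^sup>2" by (auto simp: max_def)
            then show ?thesis by (simp add: power_mult_distrib \<sigma>)
          qed
          show "integrable lborel (\<lambda>x. indicator \<Omega> x * (max 0 (\<sigma> * (flow n 0 x + flow n 0 (- x))))\<^sup>2)"
            by (rule Bochner_Integration.integrable_bound[OF li]) (use ml in \<open>auto simp: indicator_def\<close>)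
          \<comment> \<open>As \<open>u0\<close> is odd it drops out of the symmetrised error,
            leaving the symmetrised sum itself, up to sign.\<close>
          have "(u0 x - flow n 0 x + (u0 (- x) - flow n 0 (- x)))\<^sup>2 = (flow n 0 x + flow n 0 (- x))\<^sup>2" for x
            unfolding odd by (simp add: power2_eq_square algebra_simps)
          then show "AE x in lborel. indicator \<Omega> x * (max 0 (\<sigma> * (flow n 0 x + flow n 0 (- x))))\<^sup>2
             \<le> indicator \<Omega> x * (u0 x - flow n 0 x + (u0 (- x) - flow n 0 (- x)))\<^sup>2"
            using ml by (intro AE_I2 mult_left_mono) auto
        qed
        also have "\<dots> \<le> 4 * (LINT x|lborel. indicator \<Omega> x * (u0 x - flow n 0 x)\<^sup>2)"
          by (rule integral_square_reflection_le(1)[OF _ _ e0]) (use sym in auto)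
        finally show ?thesis .
      qed
      then show "\<forall>\<^sub>F n in sequentially. (LINT x|lborel. indicator \<Omega> x * (max 0 (\<sigma> * (flow n T x + flow n T (- x))))\<^sup>2)
         \<le> 4 * (LINT x|lborel. indicator \<Omega> x * (u0 x - flow n 0 x)\<^sup>2)" by simp
      show "(\<lambda>n. 4 * (LINT x|lborel. indicator \<Omega> x * (u0 x - flow n 0 x)\<^sup>2)) \<longlonglongrightarrow> 0"
        using tendsto_mult_left[OF l0, of 4] by simp
    qed
    show "(\<lambda>n. LINT x|lborel. indicator \<Omega> x * (\<sigma> * (u x T + u (- x) T) - \<sigma> * (flow n T x + flow n T (- x)))\<^sup>2) \<longlonglongrightarrow> 0"
      unfolding right_diff_distrib[symmetric] power_mult_distrib \<sigma> mult_1
    proof (rule tendsto_sandwich[OF _ _ tendsto_const])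
      show "\<forall>\<^sub>F n in sequentially. 0 \<le> (LINT x|lborel. indicator \<Omega> x * (u x T + u (- x) T - (flow n T x + flow n T (- x)))\<^sup>2)"
        by (intro always_eventually allI Bochner_Integration.integral_nonneg) auto
      have "(LINT x|lborel. indicator \<Omega> x * (u x T - flow n T x + (u (- x) T - flow n T (- x)))\<^sup>2)
         \<le> 4 * (LINT x|lborel. indicator \<Omega> x * (u x T - flow n T x)\<^sup>2)" for n
        by (rule integral_square_reflection_le(1)[OF _ _ eT]) (use sym in auto)
      then show "\<forall>\<^sub>F n in sequentially. (LINT x|lborel. indicator \<Omega> x * (u x T + u (- x) T - (flow n T x + flow n T (- x)))\<^sup>2)
         \<le> 4 * (LINT x|lborel. indicator \<Omega> x * (u x T - flow n T x)\<^sup>2)"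
        by (simp add: algebra_simps)
      show "(\<lambda>n. 4 * (LINT x|lborel. indicator \<Omega> x * (u x T - flow n T x)\<^sup>2)) \<longlonglongrightarrow> 0"
        using tendsto_mult_left[OF lt[OF T], of 4] by simp
    qed
  qed auto
  then show ?thesis
  proof (rule nonpos_if_AE_nonpos[OF _ \<Omega>(1) _ x])
    show "continuous_on \<Omega> (\<lambda>x. \<sigma> * (u x T + u (- x) T))"
      by (intro continuous_on_mult_left continuous_on_add uc T continuous_on_compose2[OF uc[OF T], of \<Omega> uminus] continuous_intros)
         (use sym in auto)
  qed
qed

text \<open>The t^2 coefficient is split into a constant \<open>K\<close> and a compactly supported
  \<open>q\<close>: the constant adds nothing to differences and hence nothing to the energy, but it
  can keep the barrier nonnegative outside \<Omega>. Compact support of the rest gives finite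
  energy.\<close>

lemma heat_solution_le_barrier:
  assumes T: "T > 0" and x: "x \<in> \<Omega>"
    and g: "bdd_C11 g" and q: "bdd_C11 q"
    and R: "\<And>x. x \<notin> cball 0 R \<Longrightarrow> u0 x = 0 \<and> g x = 0 \<and> q x = 0"
    and super: "\<And>t x. 0 \<le> t \<Longrightarrow> t \<le> T \<Longrightarrow> x \<in> \<Omega> \<Longrightarrow>
      0 \<le> - g x + 2 * t * (K + q x) + frac_const TYPE('n) s / 2 *
        (frac_lap s u0 x - t * frac_lap s g x + t\<^sup>2 * frac_lap s q x)"
    and out: "\<And>t x. 0 \<le> t \<Longrightarrow> t \<le> T \<Longrightarrow> x \<notin> \<Omega> \<Longrightarrow> 0 \<le> u0 x - t * g x + t\<^sup>2 * (K + q x)"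
  shows "u x T \<le> u0 x - T * g x + T\<^sup>2 * (K + q x)"
proof -
  define \<Phi> where "\<Phi> t x = u0 x - t * g x + t\<^sup>2 * (K + q x)" for t x
  define \<Phi>' where "\<Phi>' t x = - g x + 2 * t * (K + q x)" for t x
  \<comment> \<open>The barrier without its spatially constant part: same energy integrand, but
    compactly supported and in \<open>bdd_C11\<close>.\<close>
  define P where "P t x = u0 x + (- t) * g x + t\<^sup>2 * q x" for t x
  obtain C1 where C1: "\<And>x. \<bar>u0 x\<bar> \<le> C1" "C1 \<ge> 0" using u0 by (rule bdd_C11E) blast
  obtain C2 where C2: "\<And>x. \<bar>g x\<bar> \<le> C2" "C2 \<ge> 0" using g by (rule bdd_C11E) blast
  obtain C3 where C3: "\<And>x. \<bar>q x\<bar> \<le> C3" "C3 \<ge> 0" using q by (rule bdd_C11E) blast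
  have u0b[measurable]: "u0 \<in> borel_measurable borel" using u0 by (rule bdd_C11_borel)
  have [measurable]: "g \<in> borel_measurable borel" "q \<in> borel_measurable borel"
    using g q by (auto intro: bdd_C11_borel)
  have \<Phi>m[measurable]: "\<Phi> t \<in> borel_measurable borel" "\<Phi>' t \<in> borel_measurable borel" for t
    unfolding \<Phi>_def[abs_def] \<Phi>'_def[abs_def] by measurable
  obtain \<psi> ev \<alpha> where m: "frac_modes s \<Omega> (frac_const TYPE('n) s / 2) \<psi> ev"
    and l0: "(\<lambda>n. LINT x|lborel. indicator \<Omega> x * (u0 x - frac_modes.flow \<psi> ev \<alpha> n 0 x)\<^sup>2) \<longlonglongrightarrow> 0"
    and lt: "\<And>t. t > 0 \<Longrightarrow> (\<lambda>n. LINT x|lborel. indicator \<Omega> x * (u x t - frac_modes.flow \<psi> ev \<alpha> n t x)\<^sup>2) \<longlonglongrightarrow> 0"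
    and ub: "\<And>t. t > 0 \<Longrightarrow> (\<lambda>x. u x t) \<in> borel_measurable borel"
    and ui: "\<And>t. t > 0 \<Longrightarrow> integrable lborel (\<lambda>x. indicator \<Omega> x * (u x t)\<^sup>2)"
    and uc: "\<And>t. t > 0 \<Longrightarrow> continuous_on \<Omega> (\<lambda>x. u x t)"
    using heat_solution_modes[OF sol \<Omega> frac_const_pos[OF s] u0b C1(1)] by blast
  interpret frac_modes s \<Omega> "frac_const TYPE('n) s / 2" \<psi> ev \<alpha> by (rule m)
  have [measurable]: "(\<lambda>x. u x T) \<in> borel_measurable borel" by (rule ub[OF T])
  have u0i: "integrable lborel (\<lambda>x. indicator \<Omega> x * (u0 x)\<^sup>2)"
    by (rule integrable_indicator_square_bounded) (use \<Omega> C1 in auto)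
  have e0: "integrable lborel (\<lambda>x. indicator \<Omega> x * (u0 x - flow n 0 x)\<^sup>2)" for n
    by (rule integrable_indicator_square_diff) (use u0i flow_L2_integrable in auto)
  have P: "bdd_C11 (P t)" for t
    unfolding P_def[abs_def] by (intro bdd_C11_add bdd_C11_cmult u0 g q)
  have EP: "energy_integrand s (\<Phi> t) v = energy_integrand s (P t) v" for t v
    unfolding energy_integrand_def \<Phi>_def P_def by (auto simp: algebra_simps fun_eq_iff)
  have EP': "energy_integrand s (P t) (\<Phi> t) = energy_integrand s (P t) (P t)" for t
    unfolding energy_integrand_def \<Phi>_def P_def by (auto simp: algebra_simps fun_eq_iff)
  have EPi: "finite_energy s (P t) (P t)" for t
    by (rule energy_integrable_compact_support[OF s P, of R]) (use R in \<open>auto simp: P_def\<close>)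
  define C where "C = C1 + (T + 1) * C2 + (T + 1)\<^sup>2 * (\<bar>K\<bar> + C3) + C2 + 2 * (T + 1) * (\<bar>K\<bar> + C3)"
  have bd: "\<bar>\<Phi> t x\<bar> \<le> C \<and> \<bar>\<Phi>' t x\<bar> \<le> C" if t: "-1 < t" "t < T + 1" for t x
  proof -
    have t1: "\<bar>t\<bar> \<le> T + 1" using t T by auto
    have k: "\<bar>K + q x\<bar> \<le> \<bar>K\<bar> + C3" using C3(1)[of x] by linarith
    have 1: "\<bar>t * g x\<bar> \<le> (T + 1) * C2" unfolding abs_mult using t1 C2 by (intro mult_mono) auto
    have 2: "\<bar>t\<^sup>2 * (K + q x)\<bar> \<le> (T + 1)\<^sup>2 * (\<bar>K\<bar> + C3)"
      unfolding abs_mult using k power_mono[OF t1, of 2] by (intro mult_mono) auto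
    have 3: "\<bar>2 * t * (K + q x)\<bar> \<le> 2 * (T + 1) * (\<bar>K\<bar> + C3)"
      unfolding abs_mult using k t1 by (intro mult_mono) auto
    have nn: "0 \<le> (T + 1) * C2" "0 \<le> (T + 1)\<^sup>2 * (\<bar>K\<bar> + C3)" "0 \<le> 2 * (T + 1) * (\<bar>K\<bar> + C3)"
      using T C2 C3 by auto
    show ?thesis
      unfolding \<Phi>_def \<Phi>'_def C_def using 1 2 3 nn C1(1)[of x] C2(1)[of x] C1(2) C2(2) by linarith
  qed
  have \<Phi>i: "integrable lborel (\<lambda>x. indicator \<Omega> x * (\<Phi> T x)\<^sup>2)"
    by (rule integrable_indicator_square_bounded) (use \<Omega> bd[of T] T in auto)
  have "AE x in lborel. x \<in> \<Omega> \<longrightarrow> u x T - \<Phi> T x \<le> 0"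
  proof (rule AE_nonpos_if_L2_limit[where G = "\<lambda>n x. flow n T x - \<Phi> T x"])
    show "integrable lborel (\<lambda>x. indicator \<Omega> x * (u x T - \<Phi> T x)\<^sup>2)"
      by (rule integrable_indicator_square_diff) (use ui[OF T] \<Phi>i in auto)
    show "integrable lborel (\<lambda>x. indicator \<Omega> x * (flow n T x - \<Phi> T x)\<^sup>2)" for n
      by (rule integrable_indicator_square_diff) (use flow_L2_integrable \<Phi>i in auto)
    show "(\<lambda>n. LINT x|lborel. indicator \<Omega> x * (max 0 (flow n T x - \<Phi> T x))\<^sup>2) \<longlonglongrightarrow> 0"
    proof (rule tendsto_sandwich[OF _ _ tendsto_const l0])
      show "\<forall>\<^sub>F n in sequentially. 0 \<le> (LINT x|lborel. indicator \<Omega> x * (max 0 (flow n T x - \<Phi> T x))\<^sup>2)"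
        by (intro always_eventually allI Bochner_Integration.integral_nonneg) auto
      have "(LINT x|lborel. indicator \<Omega> x * (max 0 (flow n T x - \<Phi> T x))\<^sup>2)
         \<le> (LINT x|lborel. indicator \<Omega> x * (u0 x - flow n 0 x)\<^sup>2)" for n
      proof -
        have "(LINT x|lborel. indicator \<Omega> x * (max 0 (flow n T x - \<Phi> T x))\<^sup>2)
           \<le> (LINT x|lborel. indicator \<Omega> x * (max 0 (flow n 0 x - \<Phi> 0 x))\<^sup>2)"
        proof (rule flow_barrier)
          show "((\<lambda>r. \<Phi> r x) has_real_derivative \<Phi>' t x) (at t)" for t x
            unfolding \<Phi>_def \<Phi>'_def by (auto intro!: derivative_eq_intros)
          show "\<bar>\<Phi> t x\<bar> \<le> C \<and> \<bar>\<Phi>' t x\<bar> \<le> C" if "-1 < t" "t < T + 1" for t x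
            by (rule bd[OF that])
          show "0 \<le> \<Phi> t x" if "0 \<le> t" "t \<le> T" "x \<notin> \<Omega>" for t x
            unfolding \<Phi>_def by (rule out[OF that])
          show "finite_energy s (\<Phi> t) (\<Phi> t)" for t
            unfolding EP EP' by (rule EPi)
          fix t p assume t: "0 \<le> t" "t \<le> T" and p: "form_fun s \<Omega> p" and p0: "\<And>x. 0 \<le> p x"
          note p' = form_fun_D[OF p]
          have [measurable]: "p \<in> borel_measurable borel" by (rule p')
          have pi: "integrable lborel p" by (rule form_fun_integrable[OF p])
          have "energy_form s (P t) p = (LINT x|lborel. p x * frac_lap s (P t) x)"
          proof (rule energy_eq_integral_frac_lap[OF s P pi])
            show "finite_energy s (P t) p"
              by (rule energy_integrable_cross) (use EPi p' bdd_C11_borel[OF P] in auto)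
          qed
          then have e: "- (frac_const TYPE('n) s / 2) * energy_form s (\<Phi> t) p
             = (LINT x|lborel. - (frac_const TYPE('n) s / 2) * (p x * frac_lap s (P t) x))"
            unfolding EP by (simp only: integral_mult_right_zero)
          have i1: "integrable lborel (\<lambda>x. - (frac_const TYPE('n) s / 2) * (p x * frac_lap s (P t) x))"
            by (intro integrable_mult_right integrable_mult_frac_lap s P pi)
          have i2: "integrable lborel (\<lambda>x. \<Phi>' t x * p x)"
          proof (rule Bochner_Integration.integrable_bound[OF integrable_mult_right[OF pi, of C]])
            show "AE x in lborel. norm (\<Phi>' t x * p x) \<le> norm (C * p x)"
              using bd[of t] t by (intro AE_I2) (auto simp: abs_mult p0 intro!: mult_right_mono order_trans[OF _ abs_ge_self])
          qed measurable
          have fl: "frac_lap s (P t) x = frac_lap s u0 x + - t * frac_lap s g x + t\<^sup>2 * frac_lap s q x" for x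
            unfolding P_def[abs_def]
            by (simp only: frac_lap_add[OF s bdd_C11_add[OF u0 bdd_C11_cmult[OF g]] bdd_C11_cmult[OF q]]
                  frac_lap_add[OF s u0 bdd_C11_cmult[OF g]] frac_lap_cmult)
          show "- (frac_const TYPE('n) s / 2) * energy_form s (\<Phi> t) p
             \<le> (LINT x|lborel. \<Phi>' t x * p x)"
            unfolding e
          proof (rule integral_mono[OF i1 i2])
            fix x
            show "- (frac_const TYPE('n) s / 2) * (p x * frac_lap s (P t) x) \<le> \<Phi>' t x * p x"
            proof (cases "x \<in> \<Omega>")
              case True
              have "0 \<le> (\<Phi>' t x + frac_const TYPE('n) s / 2 * frac_lap s (P t) x) * p x"
                using super[OF t True] p0[of x] unfolding \<Phi>'_def fl by (intro mult_nonneg_nonneg) auto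
              then show ?thesis by (simp add: algebra_simps)
            next
              case False then show ?thesis using p'(4) by simp
            qed
          qed
        qed (use T in auto)
        also have "\<dots> \<le> (LINT x|lborel. indicator \<Omega> x * (u0 x - flow n 0 x)\<^sup>2)"
        proof (rule integral_mono_AE)
          have "(max 0 (b - a))\<^sup>2 \<le> (a - b)\<^sup>2" for a b :: real
            by (auto simp: max_def power2_commute)
          then show "AE x in lborel. indicator \<Omega> x * (max 0 (flow n 0 x - \<Phi> 0 x))\<^sup>2 \<le> indicator \<Omega> x * (u0 x - flow n 0 x)\<^sup>2"
            by (intro AE_I2 mult_left_mono) (auto simp: \<Phi>_def)
          show "integrable lborel (\<lambda>x. indicator \<Omega> x * (max 0 (flow n 0 x - \<Phi> 0 x))\<^sup>2)"
            by (rule Bochner_Integration.integrable_bound[OF e0[of n]])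
               (auto simp: indicator_def \<Phi>_def max_def power2_commute)
        qed (rule e0)
        finally show ?thesis .
      qed
      then show "\<forall>\<^sub>F n in sequentially. (LINT x|lborel. indicator \<Omega> x * (max 0 (flow n T x - \<Phi> T x))\<^sup>2)
         \<le> (LINT x|lborel. indicator \<Omega> x * (u0 x - flow n 0 x)\<^sup>2)" by simp
    qed
    show "(\<lambda>n. LINT x|lborel. indicator \<Omega> x * (u x T - \<Phi> T x - (flow n T x - \<Phi> T x))\<^sup>2) \<longlonglongrightarrow> 0"
      using lt[OF T] by simp
  qed auto
  then have "u x T - \<Phi> T x \<le> 0"
  proof (rule nonpos_if_AE_nonpos[OF _ \<Omega>(1) _ x])
    have "continuous_on \<Omega> u0" "continuous_on \<Omega> g" "continuous_on \<Omega> q"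
      using u0 g q by (auto intro: continuous_on_subset[OF bdd_C11_continuous])
    then show "continuous_on \<Omega> (\<lambda>x. u x T - \<Phi> T x)"
      unfolding \<Phi>_def by (intro continuous_intros uc[OF T])
  qed
  then show ?thesis unfolding \<Phi>_def by simp
qed

end

section \<open>Difference bounds for smooth functions\<close>

definition fdiff :: "'a::real_normed_vector \<Rightarrow> ('a \<Rightarrow> real) \<Rightarrow> 'a \<Rightarrow> real" where
  "fdiff h g x = g (x + h) - g x"

lemma has_derivative_fold_fdiff:
  fixes g :: "real ^ 'n \<Rightarrow> real"
  assumes "\<And>x. (g has_derivative (\<lambda>v. \<Sum>i\<in>UNIV. v $ i * p i x)) (at x)"
  shows "(fold fdiff hs g has_derivative (\<lambda>v. \<Sum>i\<in>UNIV. v $ i * fold fdiff hs (p i) x)) (at x)"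
  using assms
proof (induction hs arbitrary: g p)
  case (Cons h hs)
  have "(fdiff h g has_derivative (\<lambda>v. \<Sum>i\<in>UNIV. v $ i * fdiff h (p i) x)) (at x)" for x
  proof -
    have "((\<lambda>x. g (x + h)) has_derivative (\<lambda>v. \<Sum>i\<in>UNIV. v $ i * p i (x + h))) (at x)"
      by (rule has_derivative_compose[of "\<lambda>x. x + h" "\<lambda>v. v", OF _ Cons.prems]) (auto intro!: derivative_eq_intros)
    then have "((\<lambda>x. g (x + h) - g x) has_derivative
       (\<lambda>v. (\<Sum>i\<in>UNIV. v $ i * p i (x + h)) - (\<Sum>i\<in>UNIV. v $ i * p i x))) (at x)"
      by (rule has_derivative_diff[OF _ Cons.prems])
    then show ?thesis
      unfolding fdiff_def[abs_def] by (simp add: sum_subtractf right_diff_distrib)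
  qed
  from Cons.IH[OF this] show ?case by simp
qed simp

lemma Ck_on_Suc_partials:
  fixes g :: "real ^ 'n \<Rightarrow> real"
  assumes "Ck_on (Suc k) UNIV g"
  shows "(g has_derivative (\<lambda>v. \<Sum>i\<in>UNIV. v $ i * frechet_derivative g (at x) (axis i 1))) (at x)"
proof -
  have d: "(g has_derivative frechet_derivative g (at x)) (at x)"
    using assms frechet_derivative_works by auto
  then interpret bounded_linear "frechet_derivative g (at x)" by (rule has_derivative_bounded_linear)
  have "frechet_derivative g (at x) v = (\<Sum>i\<in>UNIV. v $ i * frechet_derivative g (at x) (axis i 1))" for v
  proof -
    have "v = (\<Sum>i\<in>UNIV. v $ i *\<^sub>R axis i 1)"
      using basis_expansion[of v] by (simp add: scalar_mult_eq_scaleR)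
    then have "frechet_derivative g (at x) v = frechet_derivative g (at x) (\<Sum>i\<in>UNIV. v $ i *\<^sub>R axis i 1)" by simp
    then show ?thesis by (simp add: sum scaleR)
  qed
  then have "frechet_derivative g (at x) = (\<lambda>v. \<Sum>i\<in>UNIV. v $ i * frechet_derivative g (at x) (axis i 1))" by blast
  then show ?thesis using d by metis
qed

text \<open>Induction on the order: the gradient of an m-fold difference consists of m-fold
  differences of the partial derivatives, and the mean value inequality accounts for one further
  difference. The vanishing outside a ball is inherited by the partial derivatives.\<close>

lemma iterated_difference_bound:
  fixes g :: "real ^ 'n \<Rightarrow> real"
  assumes "Ck_on m UNIV g" "\<And>x. R < norm x \<Longrightarrow> g x = 0"
  shows "\<exists>C\<ge>0. \<forall>hs x. length hs = m \<longrightarrow> \<bar>fold fdiff hs g x\<bar> \<le> C * prod_list (map norm hs)"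
  using assms
proof (induction m arbitrary: g)
  case 0
  then have "compact (g ` cball 0 R)"
    by (intro compact_continuous_image) (auto intro: continuous_on_subset)
  then obtain C where C: "\<And>x. x \<in> cball 0 R \<Longrightarrow> \<bar>g x\<bar> \<le> C"
    by (metis bounded_iff compact_imp_bounded imageI real_norm_def)
  have "\<bar>g x\<bar> \<le> \<bar>C\<bar>" for x
  proof (cases "x \<in> cball 0 R")
    case True then show ?thesis using C[of x] by linarith
  next
    case False then show ?thesis using 0(2)[of x] by simp
  qed
  then show ?case by (intro exI[of _ "\<bar>C\<bar>"]) auto
next
  case (Suc m)
  define p where "p i x = frechet_derivative g (at x) (axis i 1)" for i x
  have d: "(g has_derivative (\<lambda>v. \<Sum>i\<in>UNIV. v $ i * p i x)) (at x)" for x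
    unfolding p_def by (rule Ck_on_Suc_partials[OF Suc.prems(1)])
  have "\<exists>C\<ge>0. \<forall>hs x. length hs = m \<longrightarrow> \<bar>fold fdiff hs (p i) x\<bar> \<le> C * prod_list (map norm hs)" for i
  proof (rule Suc.IH)
    show "Ck_on m UNIV (p i)" using Suc.prems(1) unfolding p_def[abs_def] by simp
    fix x :: "real^'n" assume x: "R < norm x"
    have op: "open {x :: real^'n. R < norm x}" by (intro open_Collect_less continuous_intros)
    have "(g has_derivative (\<lambda>v. 0)) (at x)"
      by (rule has_derivative_transform_within_open[OF has_derivative_const op]) (use x Suc.prems(2) in auto)
    then have "frechet_derivative g (at x) = (\<lambda>v. 0)" by (metis frechet_derivative_at)
    then show "p i x = 0" unfolding p_def by simp
  qed
  then obtain C where C0: "\<And>i. C i \<ge> 0"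
    and C: "\<And>i hs x. length hs = m \<Longrightarrow> \<bar>fold fdiff hs (p i) x\<bar> \<le> C i * prod_list (map norm hs)"
    by metis
  show ?case
  proof (intro exI[of _ "\<Sum>i\<in>UNIV. C i"] conjI allI impI)
    show "0 \<le> (\<Sum>i\<in>UNIV. C i)" using C0 by (simp add: sum_nonneg)
    fix hs :: "(real^'n) list" and x assume "length hs = Suc m"
    \<comment> \<open>\<open>fold\<close> applies the last increment last, so splitting at the end
      exposes the outermost difference.\<close>
    then obtain hs' h where hs: "hs = hs' @ [h]" "length hs' = m"
      by (metis length_Suc_conv_rev)
    define G where "G = fold fdiff hs' g"
    have dG: "(G has_derivative (\<lambda>v. \<Sum>i\<in>UNIV. v $ i * fold fdiff hs' (p i) x)) (at x)" for x
      unfolding G_def by (rule has_derivative_fold_fdiff[OF d])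
    have "norm (G (x + h) - G x) \<le> ((\<Sum>i\<in>UNIV. C i) * prod_list (map norm hs')) * norm (x + h - x)"
    proof (rule differentiable_bound[of UNIV G "\<lambda>x v. \<Sum>i\<in>UNIV. v $ i * fold fdiff hs' (p i) x"])
      show "onorm (\<lambda>v. \<Sum>i\<in>UNIV. v $ i * fold fdiff hs' (p i) x) \<le> (\<Sum>i\<in>UNIV. C i) * prod_list (map norm hs')" for x
      proof (rule onorm_bound)
        show "0 \<le> (\<Sum>i\<in>UNIV. C i) * prod_list (map norm hs')"
          using C0 by (intro mult_nonneg_nonneg sum_nonneg) (auto intro!: prod_list_nonneg)
        fix v :: "real^'n"
        have "\<bar>v $ i * fold fdiff hs' (p i) x\<bar> \<le> norm v * (C i * prod_list (map norm hs'))" for i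
          unfolding abs_mult using C[OF hs(2), of i x] by (intro mult_mono component_le_norm_cart) auto
        then have "norm (\<Sum>i\<in>UNIV. v $ i * fold fdiff hs' (p i) x) \<le> (\<Sum>i\<in>UNIV. norm v * (C i * prod_list (map norm hs')))"
          unfolding real_norm_def by (intro order_trans[OF sum_abs] sum_mono)
        then show "norm (\<Sum>i\<in>UNIV. v $ i * fold fdiff hs' (p i) x) \<le> (\<Sum>i\<in>UNIV. C i) * prod_list (map norm hs') * norm v"
          by (simp add: sum_distrib_left sum_distrib_right mult_ac)
      qed
    qed (use dG in auto)
    then show "\<bar>fold fdiff hs g x\<bar> \<le> (\<Sum>i\<in>UNIV. C i) * prod_list (map norm hs)"
      unfolding hs by (simp add: G_def fdiff_def mult.assoc)
  qed
qed

text \<open>Order 4 is what the second difference of a fractional Laplacian requires: two increments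
  from the kernel and two from the point of evaluation.\<close>

lemma test_function_differences:
  fixes g :: "real ^ 'n \<Rightarrow> real"
  assumes "smooth_on UNIV g" "\<And>x. R < norm x \<Longrightarrow> g x = 0"
  obtains C where "C \<ge> 0" "\<And>hs x. length hs \<le> 4 \<Longrightarrow> \<bar>fold fdiff hs g x\<bar> \<le> C * prod_list (map norm hs)"
proof -
  have "\<exists>C\<ge>0. \<forall>hs x. length hs = m \<longrightarrow> \<bar>fold fdiff hs g x\<bar> \<le> C * prod_list (map norm hs)" for m
    using assms by (intro iterated_difference_bound) (auto simp: smooth_on_def)
  then obtain C where C0: "\<And>m. C m \<ge> 0"
    and C: "\<And>m hs x. length hs = m \<Longrightarrow> \<bar>fold fdiff hs g x\<bar> \<le> C m * prod_list (map norm hs)"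
    by metis
  show thesis
  proof (rule that[of "\<Sum>m\<le>4. C m"])
    show "0 \<le> (\<Sum>m\<le>4. C m)" using C0 by (simp add: sum_nonneg)
    fix hs :: "(real^'n) list" and x assume l: "length hs \<le> 4"
    have "C (length hs) \<le> (\<Sum>m\<le>4. C m)" by (rule member_le_sum) (use l C0 in auto)
    then have "C (length hs) * prod_list (map norm hs) \<le> (\<Sum>m\<le>4. C m) * prod_list (map norm hs)"
      by (intro mult_right_mono prod_list_nonneg) auto
    then show "\<bar>fold fdiff hs g x\<bar> \<le> (\<Sum>m\<le>4. C m) * prod_list (map norm hs)"
      using C[of hs "length hs" x] by simp
  qed
qed

lemma smooth_bdd_C11:
  fixes g :: "real ^ 'n \<Rightarrow> real"
  assumes "smooth_on UNIV g" "\<And>x. R < norm x \<Longrightarrow> g x = 0"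
  shows "bdd_C11 g"
proof -
  obtain C where C: "C \<ge> 0" "\<And>hs x. length hs \<le> 4 \<Longrightarrow> \<bar>fold fdiff hs g x\<bar> \<le> C * prod_list (map norm hs)"
    using test_function_differences[OF assms] by blast
  show ?thesis
  proof (rule bdd_C11I[of g C C C])
    fix x h :: "real^'n"
    show "\<bar>g x\<bar> \<le> C" using C(2)[of "[]" x] by simp
    show "\<bar>g (x + h) - g x\<bar> \<le> C * norm h" using C(2)[of "[h]" x] by (simp add: fdiff_def)
    have "fold fdiff [h, h] g (x - h) = - (2 * g x - g (x + h) - g (x - h))"
      by (simp add: fdiff_def add.commute)
    then show "\<bar>2 * g x - g (x + h) - g (x - h)\<bar> \<le> C * (norm h)\<^sup>2"
      using C(2)[of "[h, h]" "x - h"] by (simp add: power2_eq_square)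
  qed
qed

text \<open>Differences in x pass under the integral and combine with the second difference in k.
  Using smoothness in k near k = 0 and boundedness for large k gives the integrable majorant min(1,
  |k|^2) / |k|^(N+2s), with the power of |h| in front.\<close>

lemma smooth_frac_lap_bdd_C11:
  fixes g :: "real ^ 'n \<Rightarrow> real"
  assumes g: "smooth_on UNIV g" "\<And>x. R < norm x \<Longrightarrow> g x = 0" and s: "0 < s" "s < 1"
  shows "bdd_C11 (frac_lap s g)"
proof -
  obtain C where C0: "C \<ge> 0"
    and C: "\<And>hs x. length hs \<le> 4 \<Longrightarrow> \<bar>fold fdiff hs g x\<bar> \<le> C * prod_list (map norm hs)"
    using test_function_differences[OF g] by blast
  have le4: "a \<le> 4 * a" if "0 \<le> a" for a :: real using that by simp
  have bg: "bdd_C11 g" by (rule smooth_bdd_C11[OF g])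
  define G where "G x k = 2 * g x - g (x + k) - g (x - k)" for x k
  have G: "G x k = - fold fdiff [k, k] g (x - k)" for x k
    unfolding G_def by (simp add: fdiff_def add.commute)
  let ?N = "\<lambda>k::real^'n. kern s k"
  define w where "w k = min 1 ((norm k)\<^sup>2) / ?N k" for k :: "real^'n"
  have wi: "integrable lborel w" unfolding w_def by (rule integrable_min_kernel[OF s])
  have w0: "w k \<ge> 0" for k unfolding w_def by simp
  have Gi: "integrable lborel (\<lambda>k. G x k / ?N k)" for x
    unfolding G_def by (rule frac_lap_integrable[OF s bg])
  have fl: "frac_lap s g x = (LINT k|lborel. G x k / ?N k)" for x unfolding frac_lap_def G_def ..
  \<comment> \<open>The common pattern of both estimates: a numerator bounded by B and by B |k|^2
    integrates to at most B times a fixed constant.\<close>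
  have lem: "\<bar>LINT k|lborel. F k / ?N k\<bar> \<le> B * (LINT k|lborel. w k)"
    if Fi: "integrable lborel (\<lambda>k. F k / ?N k)" and F1: "\<And>k. \<bar>F k\<bar> \<le> B" and F2: "\<And>k. \<bar>F k\<bar> \<le> B * (norm k)\<^sup>2" for F B
  proof -
    have "\<bar>F k / ?N k\<bar> \<le> B * w k" for k
    proof -
      have "\<bar>F k\<bar> \<le> B * min 1 ((norm k)\<^sup>2)" using F1[of k] F2[of k] by (auto simp: min_def)
      then show ?thesis unfolding w_def times_divide_eq_right abs_divide by (simp add: divide_right_mono)
    qed
    then have "\<bar>LINT k|lborel. F k / ?N k\<bar> \<le> (LINT k|lborel. B * w k)"
      by (intro order_trans[OF integral_abs_bound] integral_mono integrable_abs Fi integrable_mult_right wi)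
    then show ?thesis by simp
  qed
  define I where "I = (LINT k|lborel. w k)"
  obtain K where K: "\<And>x. \<bar>frac_lap s g x\<bar> \<le> K" using frac_lap_bounded[OF s bg] by blast
  show ?thesis
  proof (rule bdd_C11I[of _ K "4 * C * I" "4 * C * I"])
    fix x h :: "real^'n"
    show "\<bar>frac_lap s g x\<bar> \<le> K" by (rule K)
    have "frac_lap s g (x + h) - frac_lap s g x = (LINT k|lborel. (G (x + h) k - G x k) / ?N k)"
      unfolding fl diff_divide_distrib using Gi by simp
    also have "\<bar>\<dots>\<bar> \<le> (4 * C * norm h) * (LINT k|lborel. w k)"
    proof (rule lem)
      show "integrable lborel (\<lambda>k. (G (x + h) k - G x k) / ?N k)"
        unfolding diff_divide_distrib using Gi by simp
      have g1: "\<bar>g (y + h) - g y\<bar> \<le> C * norm h" for y using C[of "[h]" y] by (simp add: fdiff_def)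
      show "\<bar>G (x + h) k - G x k\<bar> \<le> 4 * C * norm h" for k
        using g1[of x] g1[of "x + k"] g1[of "x - k"] unfolding G_def
        by (simp add: abs_le_iff algebra_simps)
      show "\<bar>G (x + h) k - G x k\<bar> \<le> 4 * C * norm h * (norm k)\<^sup>2" for k
      proof -
        have "G (x + h) k - G x k = - fold fdiff [k, k, h] g (x - k)"
          unfolding G by (simp add: fdiff_def algebra_simps)
        then have "\<bar>G (x + h) k - G x k\<bar> \<le> C * (norm k * norm k * norm h)"
          using C[of "[k, k, h]" "x - k"] by (simp add: mult.assoc)
        also have "\<dots> \<le> 4 * (C * (norm k * norm k * norm h))"
          by (rule le4) (use C0 in simp)
        finally show ?thesis by (simp add: power2_eq_square mult_ac)
      qed
    qed
    finally show "\<bar>frac_lap s g (x + h) - frac_lap s g x\<bar> \<le> 4 * C * I * norm h"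
      by (simp add: I_def mult_ac)
    have "2 * frac_lap s g x - frac_lap s g (x + h) - frac_lap s g (x - h) =
       (LINT k|lborel. (2 * G x k - G (x + h) k - G (x - h) k) / ?N k)"
      unfolding fl diff_divide_distrib times_divide_eq_right[symmetric]
      by (simp only: Bochner_Integration.integral_diff[OF Bochner_Integration.integrable_diff[OF integrable_mult_right[OF Gi] Gi] Gi]
          Bochner_Integration.integral_diff[OF integrable_mult_right[OF Gi] Gi] integral_mult_right_zero)
    also have "\<bar>\<dots>\<bar> \<le> (4 * C * (norm h)\<^sup>2) * (LINT k|lborel. w k)"
    proof (rule lem)
      show "integrable lborel (\<lambda>k. (2 * G x k - G (x + h) k - G (x - h) k) / ?N k)"
        unfolding diff_divide_distrib times_divide_eq_right[symmetric]
        by (intro Bochner_Integration.integrable_diff integrable_mult_right Gi)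
      have g2: "\<bar>2 * g y - g (y + h) - g (y - h)\<bar> \<le> C * (norm h)\<^sup>2" for y
      proof -
        have "fold fdiff [h, h] g (y - h) = - (2 * g y - g (y + h) - g (y - h))"
          by (simp add: fdiff_def add.commute)
        then show ?thesis using C[of "[h, h]" "y - h"] by (simp add: power2_eq_square)
      qed
      show "\<bar>2 * G x k - G (x + h) k - G (x - h) k\<bar> \<le> 4 * C * (norm h)\<^sup>2" for k
        using g2[of x] g2[of "x + k"] g2[of "x - k"] unfolding G_def
        by (simp add: abs_le_iff algebra_simps)
      show "\<bar>2 * G x k - G (x + h) k - G (x - h) k\<bar> \<le> 4 * C * (norm h)\<^sup>2 * (norm k)\<^sup>2" for k
      proof -
        have "2 * G x k - G (x + h) k - G (x - h) k = fold fdiff [k, k, h, h] g (x - k - h)"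
          unfolding G by (simp add: fdiff_def algebra_simps)
        then have "\<bar>2 * G x k - G (x + h) k - G (x - h) k\<bar> \<le> C * (norm k * norm k * norm h * norm h)"
          using C[of "[k, k, h, h]" "x - k - h"] by (simp add: mult.assoc)
        also have "\<dots> \<le> 4 * (C * (norm k * norm k * norm h * norm h))"
          by (rule le4) (use C0 in simp)
        finally show ?thesis by (simp add: power2_eq_square mult_ac)
      qed
    qed
    finally show "\<bar>2 * frac_lap s g x - frac_lap s g (x + h) - frac_lap s g (x - h)\<bar> \<le> 4 * C * I * (norm h)\<^sup>2"
      by (simp add: I_def mult_ac)
  qed
qed

section \<open>Bump functions and cutoffs\<close>

text \<open>The powers of 1 / r are included so that the family is closed under differentiation: the
  derivative of member m combines members m + 1 and m + 2.\<close>

definition exp_flat :: "nat \<Rightarrow> real \<Rightarrow> real" where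
  "exp_flat m r = (if r > 0 then (1 / r) ^ m * exp (- 1 / r) else 0)"

lemma exp_flat_tendsto_0: "((\<lambda>h. exp_flat m h) \<longlongrightarrow> 0) (at_right 0)"
proof -
  have "((\<lambda>x::real. x ^ m / exp x) \<longlongrightarrow> 0) at_top" by (rule tendsto_power_div_exp_0)
  then have "((\<lambda>h::real. (inverse h) ^ m / exp (inverse h)) \<longlongrightarrow> 0) (at_right 0)"
    by (rule filterlim_compose[OF _ filterlim_inverse_at_top_right])
  then show ?thesis
    by (rule Lim_transform_eventually)
       (auto simp: exp_flat_def eventually_at_right_field exp_minus divide_inverse intro!: exI[of _ 1])
qed

lemma exp_flat_deriv:
  "(exp_flat m has_real_derivative - real m * exp_flat (Suc m) r + exp_flat (m + 2) r) (at r)"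
proof -
  consider "r > 0" | "r < 0" | "r = 0" by linarith
  then show ?thesis
  proof cases
    case 1
    have "((\<lambda>r. (1 / r) ^ m * exp (- 1 / r)) has_real_derivative
       - real m * exp_flat (Suc m) r + exp_flat (m + 2) r) (at r)"
      using 1
      by (cases m) (auto intro!: derivative_eq_intros simp: exp_flat_def field_simps power2_eq_square power_divide,
        metis One_nat_def Suc_pred gr0I power_Suc)
    then show ?thesis
      by (rule has_field_derivative_transform_within_open[where S = "{0<..}"])
         (use 1 in \<open>auto simp: exp_flat_def\<close>)
  next
    case 2
    have "((\<lambda>r. 0) has_real_derivative - real m * exp_flat (Suc m) r + exp_flat (m + 2) r) (at r)"
      using 2 by (simp add: exp_flat_def)
    then show ?thesis
      by (rule has_field_derivative_transform_within_open[where S = "{..<0}"])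
         (use 2 in \<open>auto simp: exp_flat_def\<close>)
  next
    case 3
    have "((\<lambda>h. exp_flat m h / h) \<longlongrightarrow> 0) (at 0)"
    proof (subst filterlim_at_split, intro conjI)
      show "((\<lambda>h. exp_flat m h / h) \<longlongrightarrow> 0) (at_left 0)"
        by (rule Lim_transform_eventually[OF tendsto_const])
           (auto simp: exp_flat_def eventually_at_left_field intro!: exI[of _ "-1"])
      \<comment> \<open>For h > 0 the difference quotient at 0 is the next member of the
        family.\<close>
      show "((\<lambda>h. exp_flat m h / h) \<longlongrightarrow> 0) (at_right 0)"
        by (rule Lim_transform_eventually[OF exp_flat_tendsto_0[of "Suc m"]])
           (auto simp: exp_flat_def eventually_at_right_field intro!: exI[of _ 1])
    qed
    then show ?thesis using 3 by (simp add: has_field_derivative_iff exp_flat_def)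
  qed
qed

lemma real_polynomial_function_deriv:
  assumes "real_polynomial_function p"
  shows "\<exists>p'. (\<forall>x. (p has_derivative p' x) (at x)) \<and> (\<forall>v. real_polynomial_function (\<lambda>x. p' x v))"
  using assms
proof induction
  case (linear f)
  then show ?case
    by (intro exI[of _ "\<lambda>x. f"]) (auto intro: bounded_linear_imp_has_derivative)
next
  case (const c)
  then show ?case by (intro exI[of _ "\<lambda>x v. 0"]) auto
next
  case (add f g)
  then obtain f' g' where "\<And>x. (f has_derivative f' x) (at x)" "\<And>v. real_polynomial_function (\<lambda>x. f' x v)"
    "\<And>x. (g has_derivative g' x) (at x)" "\<And>v. real_polynomial_function (\<lambda>x. g' x v)" by blast
  then show ?case by (intro exI[of _ "\<lambda>x v. f' x v + g' x v"]) (auto intro: has_derivative_add)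
next
  case (mult f g)
  then obtain f' g' where "\<And>x. (f has_derivative f' x) (at x)" "\<And>v. real_polynomial_function (\<lambda>x. f' x v)"
    "\<And>x. (g has_derivative g' x) (at x)" "\<And>v. real_polynomial_function (\<lambda>x. g' x v)" by blast
  with mult.hyps show ?case
    by (intro exI[of _ "\<lambda>x v. f x * g' x v + f' x v * g x"] conjI allI has_derivative_mult
        real_polynomial_function.intros(3,4))
qed

text \<open>A class containing the bumps and closed under directional derivatives when
  \<open>q\<close> is polynomial; smoothness of all orders then follows by induction, without
  formulas for the higher derivatives.\<close>

inductive flat_fun :: "(real ^ 'n \<Rightarrow> real) \<Rightarrow> (real ^ 'n \<Rightarrow> real) \<Rightarrow> bool" for q where
  base: "real_polynomial_function p \<Longrightarrow> flat_fun q (\<lambda>x. p x * exp_flat m (q x))"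
| add: "flat_fun q f \<Longrightarrow> flat_fun q g \<Longrightarrow> flat_fun q (\<lambda>x. f x + g x)"

lemma flat_fun_deriv:
  assumes q: "real_polynomial_function q" and "flat_fun q f"
  shows "\<exists>f'. (\<forall>x. (f has_derivative f' x) (at x)) \<and> (\<forall>v. flat_fun q (\<lambda>x. f' x v))"
  using assms(2)
proof induction
  case (base p m)
  obtain p' where p': "\<And>x. (p has_derivative p' x) (at x)" "\<And>v. real_polynomial_function (\<lambda>x. p' x v)"
    using real_polynomial_function_deriv[OF base] by blast
  obtain q' where q': "\<And>x. (q has_derivative q' x) (at x)" "\<And>v. real_polynomial_function (\<lambda>x. q' x v)"
    using real_polynomial_function_deriv[OF q] by blast
  have "((\<lambda>x. exp_flat m (q x)) has_derivative (\<lambda>v. q' x v * (- real m * exp_flat (Suc m) (q x) + exp_flat (m + 2) (q x)))) (at x)" for x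
    using has_derivative_compose[OF q'(1)[of x] exp_flat_deriv[of m "q x", unfolded has_field_derivative_def]]
    by (simp add: mult.commute)
  then have d: "((\<lambda>x. p x * exp_flat m (q x)) has_derivative
     (\<lambda>v. p x * (q' x v * (- real m * exp_flat (Suc m) (q x) + exp_flat (m + 2) (q x))) + p' x v * exp_flat m (q x))) (at x)" for x
    by (rule has_derivative_mult[OF p'(1)])
  have "flat_fun q (\<lambda>x. (p x * (- real m) * q' x v) * exp_flat (Suc m) (q x) +
     ((p x * q' x v) * exp_flat (m + 2) (q x) + p' x v * exp_flat m (q x)))" for v
    by (intro flat_fun.intros real_polynomial_function.intros base p' q')
  then have "flat_fun q (\<lambda>x. p x * (q' x v * (- real m * exp_flat (Suc m) (q x) + exp_flat (m + 2) (q x))) + p' x v * exp_flat m (q x))" for v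
    by (simp add: algebra_simps)
  with d show ?case
    by (intro exI[of _ "\<lambda>x v. p x * (q' x v * (- real m * exp_flat (Suc m) (q x) + exp_flat (m + 2) (q x))) + p' x v * exp_flat m (q x)"])
       blast
next
  case (add f g)
  then obtain f' g' where "\<And>x. (f has_derivative f' x) (at x)" "\<And>v. flat_fun q (\<lambda>x. f' x v)"
    "\<And>x. (g has_derivative g' x) (at x)" "\<And>v. flat_fun q (\<lambda>x. g' x v)" by blast
  then show ?case
    by (intro exI[of _ "\<lambda>x v. f' x v + g' x v"]) (auto intro: has_derivative_add flat_fun.add)
qed

lemma flat_fun_smooth:
  assumes q: "real_polynomial_function q" and "flat_fun q f"
  shows "smooth_on UNIV f"
proof -
  have "Ck_on k UNIV f" for k
    using assms(2)
  proof (induction k arbitrary: f)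
    case 0
    obtain f' where "\<And>x. (f has_derivative f' x) (at x)" using flat_fun_deriv[OF q 0] by blast
    then show ?case
      using has_derivative_continuous continuous_at_imp_continuous_on by (metis Ck_on.simps(1))
  next
    case (Suc k)
    obtain f' where f': "\<And>x. (f has_derivative f' x) (at x)" "\<And>v. flat_fun q (\<lambda>x. f' x v)"
      using flat_fun_deriv[OF q Suc.prems] by blast
    have "frechet_derivative f (at x) = f' x" for x
      using frechet_derivative_at[OF f'(1)] by simp
    then show ?case using Suc.IH[OF f'(2)] f'(1) by (auto simp: differentiable_def)
  qed
  then show ?thesis unfolding smooth_on_def by blast
qed

text \<open>The standard function exp(-1 / (\<rho>^2 - |x - z|^2)), scaled to equal 1 at the
  centre.\<close>

definition bump :: "real \<Rightarrow> real ^ 'n \<Rightarrow> real ^ 'n \<Rightarrow> real" where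
  "bump \<rho> z x = (1 / exp_flat 0 (\<rho>\<^sup>2)) * exp_flat 0 (\<rho>\<^sup>2 - (norm (x - z))\<^sup>2)"

lemma bump_smooth:
  fixes z :: "real ^ 'n"
  shows "smooth_on UNIV (bump \<rho> z)"
proof -
  define q :: "real ^ 'n \<Rightarrow> real" where "q x = \<rho>\<^sup>2 - (norm (x - z))\<^sup>2" for x
  have "q = (\<lambda>x. \<rho>\<^sup>2 + (\<Sum>i\<in>UNIV. (- 1) * ((x $ i + (- (z $ i))) * (x $ i + (- (z $ i))))))"
    unfolding q_def norm_vec_def L2_set_def
    by (auto simp: fun_eq_iff sum_nonneg sum_negf power2_eq_square)
  moreover have "real_polynomial_function \<dots>"
    by (intro real_polynomial_function.intros(2-4) real_polynomial_function_sum
        real_polynomial_function.intros(1)[OF bounded_linear_vec_nth]) auto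
  ultimately have q: "real_polynomial_function q" by simp
  have "flat_fun q (bump \<rho> z)"
    unfolding bump_def[abs_def] q_def[symmetric] by (intro flat_fun.base real_polynomial_function.intros)
  then show ?thesis by (rule flat_fun_smooth[OF q])
qed

lemma bump_uminus: "bump \<rho> (- z) x = bump \<rho> z (- x)"
proof -
  have "norm (x - - z) = norm (- x - z)" by (metis minus_diff_eq minus_minus norm_minus_cancel diff_minus_eq_add add.commute uminus_add_conv_diff)
  then show ?thesis by (simp only: bump_def)
qed

context
  fixes \<rho> :: real
  assumes \<rho>: "\<rho> > 0"
begin

lemma exp_flat_0_pos: "exp_flat 0 (\<rho>\<^sup>2) > 0"
  unfolding exp_flat_def using \<rho> by simp

lemma bump_nonneg: "0 \<le> bump \<rho> z x"
  unfolding bump_def using exp_flat_0_pos by (simp add: exp_flat_def)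

lemma bump_le_1: "bump \<rho> z x \<le> 1"
proof -
  define q where "q = \<rho>\<^sup>2 - (norm (x - z))\<^sup>2"
  have "exp_flat 0 q \<le> exp_flat 0 (\<rho>\<^sup>2)"
  proof (cases "q > 0")
    case True
    have "q \<le> \<rho>\<^sup>2" unfolding q_def by simp
    then have "- 1 / q \<le> - 1 / \<rho>\<^sup>2" using True by (simp add: frac_le)
    then show ?thesis using True \<rho> unfolding exp_flat_def by simp
  next
    case False then show ?thesis using exp_flat_0_pos by (simp add: exp_flat_def[of 0 q])
  qed
  then show ?thesis unfolding bump_def q_def[symmetric] using exp_flat_0_pos by simp
qed

lemma bump_center: "bump \<rho> z z = 1"
  unfolding bump_def using exp_flat_0_pos by simp

lemma bump_outside: "\<rho> \<le> norm (x - z) \<Longrightarrow> bump \<rho> z x = 0"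
proof -
  assume "\<rho> \<le> norm (x - z)"
  then have "\<rho>\<^sup>2 \<le> (norm (x - z))\<^sup>2" using \<rho> by (intro power_mono) auto
  then have "\<not> 0 < \<rho>\<^sup>2 - (norm (x - z))\<^sup>2" by linarith
  then show ?thesis unfolding bump_def exp_flat_def[of 0 "\<rho>\<^sup>2 - (norm (x - z))\<^sup>2"] by simp
qed

lemma bump_bdd_C11:
  fixes z :: "real ^ 'n"
  shows "bdd_C11 (bump \<rho> z)"
proof (rule smooth_bdd_C11[OF bump_smooth, of "\<rho> + norm z"])
  fix x :: "real ^ 'n" assume "\<rho> + norm z < norm x"
  then show "bump \<rho> z x = 0" using norm_triangle_ineq2[of x z] by (intro bump_outside) linarith
qed

end

text \<open>Mollification: the indicator of the closed e/2-neighbourhood of \<open>K\<close> is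
  convolved with a normalised bump of radius e/2. The difference bounds of the bump pass under the
  integral.\<close>

lemma bdd_C11_cutoff:
  fixes K :: "(real ^ 'n) set"
  assumes K: "compact K" and V: "open V" "K \<subseteq> V"
  obtains \<eta> where "bdd_C11 \<eta>" "\<And>x. 0 \<le> \<eta> x" "\<And>x. \<eta> x \<le> 1" "\<And>x. x \<in> K \<Longrightarrow> \<eta> x = 1"
    "\<And>x. x \<notin> V \<Longrightarrow> \<eta> x = 0"
proof -
  obtain e where e: "e > 0" "(\<Union>x\<in>K. ball x e) \<subseteq> V"
    using compact_subset_open_imp_ball_epsilon_subset[OF K V] by blast
  define \<beta> :: "real ^ 'n \<Rightarrow> real" where "\<beta> = bump (e / 2) 0"
  have e2: "e / 2 > 0" using e by simp
  have \<beta>: "\<And>x. 0 \<le> \<beta> x" "\<beta> 0 = 1" "\<And>x. e / 2 \<le> norm x \<Longrightarrow> \<beta> x = 0"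
    unfolding \<beta>_def using bump_nonneg[OF e2] bump_center[OF e2] bump_outside[OF e2, of _ 0] by auto
  have bC: "bdd_C11 \<beta>" unfolding \<beta>_def by (rule bump_bdd_C11[OF e2])
  then have [measurable]: "\<beta> \<in> borel_measurable borel" by (rule bdd_C11_borel)
  obtain C where C: "C \<ge> 0" "\<And>x. \<bar>\<beta> x\<bar> \<le> C" "\<And>x h. \<bar>\<beta> (x + h) - \<beta> x\<bar> \<le> C * norm h"
    "\<And>x h. \<bar>2 * \<beta> x - \<beta> (x + h) - \<beta> (x - h)\<bar> \<le> C * (norm h)\<^sup>2"
    using bC by (rule bdd_C11E) blast
  \<comment> \<open>Half of \<open>e\<close> is spent on this neighbourhood and half on the radius
    of the bump, so the cutoff is 1 on \<open>K\<close> and still vanishes outside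
    \<open>V\<close>.\<close>
  define E where "E = (\<Union>x\<in>K. \<Union>y\<in>cball 0 (e / 2). {x + y})"
  have "compact E" unfolding E_def by (intro compact_sums' K compact_cball)
  then have Em[measurable]: "E \<in> sets borel" and Eb: "bounded E" by (auto intro: compact_imp_bounded borel_compact)
  \<comment> \<open>The mass of the bump, by which the convolution is divided.\<close>
  define J where "J = (LINT y|lborel. \<beta> y)"
  have ind: "integrable lborel (\<lambda>y. indicator E y * f y)"
    if "f \<in> borel_measurable borel" "\<And>y. \<bar>f y\<bar> \<le> B" for f :: "real^'n \<Rightarrow> real" and B
    by (rule integrable_bounded_support[OF _ _ Eb, of _ "\<bar>B\<bar>"])
       (use that in \<open>auto simp: indicator_def intro: order_trans[OF _ abs_ge_self]\<close>)
  have \<beta>i: "integrable lborel \<beta>"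
    by (rule integrable_bounded_support[OF _ C(2) bounded_cball[of 0 "e / 2"]]) (use \<beta>(3) in auto)
  have J: "J > 0"
  proof -
    have "J \<ge> 0" unfolding J_def using \<beta>(1) by simp
    moreover have "J \<noteq> 0"
    proof
      assume "J = 0"
      then have "AE y in lborel. \<beta> y = 0"
        unfolding J_def using integral_nonneg_eq_0_iff_AE[OF \<beta>i] \<beta>(1) by simp
      then have "AE y in lborel. y \<in> ball 0 (e / 2) \<longrightarrow> \<beta> y \<le> 0" by eventually_elim simp
      then have "\<beta> 0 \<le> 0"
        by (rule nonpos_if_AE_nonpos) (use e bC in \<open>auto intro: continuous_on_subset[OF bdd_C11_continuous]\<close>)
      then show False using \<beta>(2) by simp
    qed
    ultimately show ?thesis by simp
  qed
  define \<eta> where "\<eta> x = (LINT y|lborel. indicator E y * \<beta> (x - y)) / J" for x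
  have i: "integrable lborel (\<lambda>y. indicator E y * \<beta> (x - y))" for x
    by (rule ind[of _ C]) (use C(2) in auto)
  have i': "integrable lborel (\<lambda>y. \<beta> (x - y))" for x
    using integrable_lborel_affine_isometry[where c = "-1" and f = \<beta> and t = x] \<beta>i by simp
  have eqJ: "(LINT y|lborel. \<beta> (x - y)) = J" for x
    using integral_lborel_affine_isometry[where c = "-1" and f = \<beta> and t = x] by (simp add: J_def)
  have Ei: "integrable lborel (indicator E :: _ \<Rightarrow> real)"
    using ind[of "\<lambda>y. 1" 1] by simp
  define M where "M = (LINT y|lborel. indicator E y :: real)"
  have lem: "\<bar>LINT y|lborel. indicator E y * f y\<bar> \<le> B * M"
    if f: "f \<in> borel_measurable borel" "\<And>y. \<bar>f y\<bar> \<le> B" for f B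
  proof -
    have "\<bar>LINT y|lborel. indicator E y * f y\<bar> \<le> (LINT y|lborel. B * indicator E y)"
    proof (intro order_trans[OF integral_abs_bound] integral_mono integrable_abs integrable_mult_right Ei)
      show "integrable lborel (\<lambda>y. indicator E y * f y)" by (rule ind[OF f])
      show "\<bar>indicator E y * f y\<bar> \<le> B * indicator E y" for y using f(2) by (auto simp: indicator_def)
    qed
    then show ?thesis unfolding M_def by simp
  qed
  show thesis
  proof (rule that[of \<eta>])
    show "bdd_C11 \<eta>"
    proof (rule bdd_C11I[of _ "C * M / J" "C * M / J" "C * M / J"])
      fix x h :: "real^'n"
      show "\<bar>\<eta> x\<bar> \<le> C * M / J"
        unfolding \<eta>_def abs_divide using J by (simp add: divide_right_mono lem C(2))
      have "\<eta> (x + h) - \<eta> x = (LINT y|lborel. indicator E y * (\<beta> ((x - y) + h) - \<beta> (x - y))) / J"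
        unfolding \<eta>_def diff_divide_distrib[symmetric] using i[of "x + h"] i[of x]
        by (simp add: right_diff_distrib algebra_simps)
      also have "\<bar>\<dots>\<bar> \<le> (C * norm h * M) / J"
        unfolding abs_divide using J C(3) by (simp add: divide_right_mono lem)
      finally show "\<bar>\<eta> (x + h) - \<eta> x\<bar> \<le> C * M / J * norm h" by (simp add: mult_ac)
      have "2 * \<eta> x - \<eta> (x + h) - \<eta> (x - h) =
        (LINT y|lborel. indicator E y * (2 * \<beta> (x - y) - \<beta> ((x - y) + h) - \<beta> ((x - y) - h))) / J"
      proof -
        have "(LINT y|lborel. indicator E y * (2 * \<beta> (x - y) - \<beta> ((x - y) + h) - \<beta> ((x - y) - h)))
           = (LINT y|lborel. 2 * (indicator E y * \<beta> (x - y)) - indicator E y * \<beta> (x + h - y) - indicator E y * \<beta> (x - h - y))"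
          by (intro Bochner_Integration.integral_cong refl) (simp add: algebra_simps)
        also have "\<dots> = 2 * (LINT y|lborel. indicator E y * \<beta> (x - y)) - (LINT y|lborel. indicator E y * \<beta> (x + h - y))
            - (LINT y|lborel. indicator E y * \<beta> (x - h - y))"
          using i by simp
        finally show ?thesis unfolding \<eta>_def by (simp add: diff_divide_distrib)
      qed
      also have "\<bar>\<dots>\<bar> \<le> (C * (norm h)\<^sup>2 * M) / J"
        unfolding abs_divide using J C(4) by (simp add: divide_right_mono lem)
      finally show "\<bar>2 * \<eta> x - \<eta> (x + h) - \<eta> (x - h)\<bar> \<le> C * M / J * (norm h)\<^sup>2" by (simp add: mult_ac)
    qed
    show "0 \<le> \<eta> x" for x
      unfolding \<eta>_def using J \<beta>(1) by (intro divide_nonneg_pos Bochner_Integration.integral_nonneg) auto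
    have "(LINT y|lborel. indicator E y * \<beta> (x - y)) \<le> J" for x
      unfolding eqJ[of x, symmetric] by (rule integral_mono[OF i i']) (use \<beta>(1) in \<open>auto simp: indicator_def\<close>)
    then show "\<eta> x \<le> 1" for x unfolding \<eta>_def using J by simp
    show "\<eta> x = 1" if x: "x \<in> K" for x
    proof -
      have "indicator E y * \<beta> (x - y) = \<beta> (x - y)" for y
      proof (cases "norm (x - y) < e / 2")
        case True
        then have "y = x + (y - x)" "y - x \<in> cball 0 (e / 2)" by (auto simp: norm_minus_commute)
        then have "y \<in> E" unfolding E_def using x by blast
        then show ?thesis by simp
      next
        case False then show ?thesis using \<beta>(3)[of "x - y"] by simp
      qed
      then show ?thesis unfolding \<eta>_def by (simp only: eqJ) (use J in simp)
    qed
    show "\<eta> x = 0" if x: "x \<notin> V" for x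
    proof -
      have "indicator E y * \<beta> (x - y) = 0" for y
      proof (cases "y \<in> E \<and> norm (x - y) < e / 2")
        case True
        then obtain k w where k: "k \<in> K" "norm w \<le> e / 2" "y = k + w" unfolding E_def by auto
        have "norm (x - k) \<le> norm (x - y) + norm w"
          using norm_triangle_ineq[of "x - y" w] k(3) by (simp add: algebra_simps)
        then have "x \<in> ball k e" using True k(2) by (simp add: dist_norm norm_minus_commute)
        then show ?thesis using e(2) k(1) x by blast
      next
        case False then show ?thesis using \<beta>(3)[of "x - y"] by (auto simp: indicator_def)
      qed
      then show ?thesis unfolding \<eta>_def by (simp only: Bochner_Integration.integral_zero div_0)
    qed
  qed
qed

section \<open>Unique continuation\<close>

text \<open>Uniform approximation is needed only on the set that carries \<open>w\<close>; the error
  is at most e times the L^1 norm of \<open>w\<close>.\<close>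

lemma integral_zero_if_approximable:
  fixes w \<psi> :: "real ^ 'n \<Rightarrow> real"
  assumes w: "integrable lborel w" and out: "\<And>y. y \<notin> K \<Longrightarrow> w y = 0"
    and \<psi>: "integrable lborel (\<lambda>y. w y * \<psi> y)"
    and approx: "\<And>e. e > 0 \<Longrightarrow> \<exists>g. integrable lborel (\<lambda>y. w y * g y) \<and> (LINT y|lborel. w y * g y) = 0 \<and>
      (\<forall>y\<in>K. \<bar>\<psi> y - g y\<bar> < e)"
  shows "(LINT y|lborel. w y * \<psi> y) = 0"
proof -
  define A where "A = (LINT y|lborel. \<bar>w y\<bar>)"
  have A: "A \<ge> 0" unfolding A_def by simp
  have "\<bar>LINT y|lborel. w y * \<psi> y\<bar> \<le> e * A" if e: "e > 0" for e
  proof -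
    obtain g where g: "integrable lborel (\<lambda>y. w y * g y)" "(LINT y|lborel. w y * g y) = 0"
      "\<And>y. y \<in> K \<Longrightarrow> \<bar>\<psi> y - g y\<bar> < e"
      using approx[OF e] by blast
    have "(LINT y|lborel. w y * \<psi> y) = (LINT y|lborel. w y * \<psi> y - w y * g y)"
      using \<psi> g by simp
    also have "\<bar>\<dots>\<bar> \<le> (LINT y|lborel. e * \<bar>w y\<bar>)"
    proof (intro order_trans[OF integral_abs_bound] integral_mono integrable_abs integrable_mult_right w)
      show "integrable lborel (\<lambda>y. w y * \<psi> y - w y * g y)" using \<psi> g by simp
      show "\<bar>w y * \<psi> y - w y * g y\<bar> \<le> e * \<bar>w y\<bar>" for y
      proof (cases "y \<in> K")
        case True
        have "\<bar>w y\<bar> * \<bar>\<psi> y - g y\<bar> \<le> \<bar>w y\<bar> * e" using g(3)[OF True] by (intro mult_left_mono) auto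
        then show ?thesis by (simp add: abs_mult[symmetric] right_diff_distrib mult.commute)
      next
        case False then show ?thesis using out by simp
      qed
    qed
    finally show ?thesis by (simp add: A_def)
  qed
  note le = this
  show ?thesis
  proof (rule ccontr)
    define X where "X = \<bar>LINT y|lborel. w y * \<psi> y\<bar>"
    assume "(LINT y|lborel. w y * \<psi> y) \<noteq> 0"
    then have X: "X > 0" unfolding X_def by simp
    have "X \<le> X / (2 * (A + 1)) * A" using le[of "X / (2 * (A + 1))"] X A unfolding X_def[symmetric] by simp
    also have "\<dots> \<le> X / 2" using X A by (simp add: field_simps)
    finally show False using X by simp
  qed
qed

text \<open>The linear span of constants and Gaussians centred in the ball. Constants are needed for
  the Stone-Weierstrass theorem and are the degenerate case l = 0 of a Gaussian.\<close>

inductive gaussian :: "real \<Rightarrow> (real ^ 'n \<Rightarrow> real) \<Rightarrow> bool" for \<delta> where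
  const: "gaussian \<delta> (\<lambda>y. c)"
| gauss: "0 < l \<Longrightarrow> z \<in> ball 0 \<delta> \<Longrightarrow> gaussian \<delta> (\<lambda>y. c * exp (- l * (norm (z - y))\<^sup>2))"
| add: "gaussian \<delta> f \<Longrightarrow> gaussian \<delta> g \<Longrightarrow> gaussian \<delta> (\<lambda>y. f y + g y)"

lemma gaussian_cmult: "gaussian \<delta> f \<Longrightarrow> gaussian \<delta> (\<lambda>y. c * f y)"
proof (induction rule: gaussian.induct)
  case (const d)
  then show ?case by (rule gaussian.const)
next
  case (gauss l z d)
  then show ?case using gaussian.gauss[of l z \<delta> "c * d"] by (simp add: mult.assoc)
next
  case (add f g)
  then show ?case using gaussian.add[OF add.IH] by (simp add: distrib_left)
qed

text \<open>Completing the square: a product of Gaussians is a multiple of the Gaussian centred at the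
  weighted mean, which stays in the ball by convexity.\<close>

lemma gaussian_product:
  fixes z1 z2 :: "real ^ 'n"
  assumes l: "0 < l1" "0 < l2" and z: "z1 \<in> ball 0 \<delta>" "z2 \<in> ball 0 \<delta>"
  shows "gaussian \<delta> (\<lambda>y. (c1 * exp (- l1 * (norm (z1 - y))\<^sup>2)) * (c2 * exp (- l2 * (norm (z2 - y))\<^sup>2)))"
proof -
  define p where "p = l1 / (l1 + l2)"
  define q where "q = l2 / (l1 + l2)"
  have pq: "p + q = 1" "p > 0" "q > 0" unfolding p_def q_def using l by (auto simp: add_divide_distrib[symmetric])
  define z where "z = p *\<^sub>R z1 + q *\<^sub>R z2"
  have zb: "z \<in> ball 0 \<delta>"
    unfolding z_def by (rule convexD[OF convex_ball]) (use z pq in auto)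
  have id: "p * (norm (z1 - y))\<^sup>2 + q * (norm (z2 - y))\<^sup>2 = (norm (z - y))\<^sup>2 + p * q * (norm (z1 - z2))\<^sup>2" for y
  proof -
    have "z - y = p *\<^sub>R (z1 - y) + q *\<^sub>R (z2 - y)"
      unfolding z_def using pq(1) by (simp add: algebra_simps scaleR_add_left[symmetric])
    moreover have "z1 - z2 = (z1 - y) - (z2 - y)" by simp
    ultimately have "(norm (z - y))\<^sup>2 + p * q * (norm (z1 - z2))\<^sup>2 =
      (norm (p *\<^sub>R (z1 - y) + q *\<^sub>R (z2 - y)))\<^sup>2 + p * q * (norm ((z1 - y) - (z2 - y)))\<^sup>2" by presburger
    also have "\<dots> = (p * p + p * q) * (norm (z1 - y))\<^sup>2 + (q * q + p * q) * (norm (z2 - y))\<^sup>2"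
      unfolding power2_norm_eq_inner by (simp add: inner_add_left inner_add_right inner_diff_left inner_diff_right inner_commute algebra_simps)
    also have "p * p + p * q = p" using pq(1) by (metis distrib_left mult.right_neutral)
    also have "q * q + p * q = q" using pq(1) by (metis add.commute distrib_right mult.left_neutral)
    finally show ?thesis by simp
  qed
  have lp: "(l1 + l2) * p = l1" "(l1 + l2) * q = l2" unfolding p_def q_def using l by auto
  have "(c1 * exp (- l1 * (norm (z1 - y))\<^sup>2)) * (c2 * exp (- l2 * (norm (z2 - y))\<^sup>2)) =
     (c1 * c2 * exp (- (l1 + l2) * (p * q * (norm (z1 - z2))\<^sup>2))) * exp (- (l1 + l2) * (norm (z - y))\<^sup>2)" for y
  proof -
    have "- l1 * (norm (z1 - y))\<^sup>2 + - l2 * (norm (z2 - y))\<^sup>2 = - (l1 + l2) * (p * (norm (z1 - y))\<^sup>2 + q * (norm (z2 - y))\<^sup>2)"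
      unfolding minus_mult_left[symmetric] distrib_left mult.assoc[symmetric] lp by simp
    also have "\<dots> = - (l1 + l2) * (p * q * (norm (z1 - z2))\<^sup>2) + - (l1 + l2) * (norm (z - y))\<^sup>2"
      unfolding id by (simp only: distrib_left add.commute)
    finally have "exp (- l1 * (norm (z1 - y))\<^sup>2) * exp (- l2 * (norm (z2 - y))\<^sup>2) =
      exp (- (l1 + l2) * (p * q * (norm (z1 - z2))\<^sup>2)) * exp (- (l1 + l2) * (norm (z - y))\<^sup>2)"
      by (simp only: exp_add[symmetric])
    then show ?thesis by (simp only: mult_ac)
  qed
  note eq = this
  show ?thesis unfolding eq by (rule gaussian.gauss[OF _ zb]) (use l in simp)
qed

lemma gaussian_mult:
  assumes "gaussian \<delta> f" "gaussian \<delta> g"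
  shows "gaussian \<delta> (\<lambda>y. f y * g y)"
  using assms(1)
proof (induction rule: gaussian.induct)
  case (const c)
  show ?case using gaussian_cmult[OF assms(2)] .
next
  case (gauss l z c)
  show ?case
    using assms(2)
  proof (induction rule: gaussian.induct)
    case (const d)
    then show ?case using gaussian_cmult[OF gaussian.gauss[OF gauss, of c], of d] by (simp add: mult.commute)
  next
    case (gauss l' z' c')
    then show ?case using gaussian_product \<open>0 < l\<close> \<open>z \<in> ball 0 \<delta>\<close> by blast
  next
    case (add f g)
    then show ?case using gaussian.add[OF add.IH] by (simp add: distrib_left)
  qed
next
  case (add f g)
  then show ?case using gaussian.add[OF add.IH] by (simp add: distrib_right)
qed

lemma gaussian_continuous: "gaussian \<delta> f \<Longrightarrow> continuous_on S f"
  by (induction rule: gaussian.induct) (auto intro!: continuous_intros)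

text \<open>The density avoids the ball of radius \<open>\<delta>\<close>, so kernels singular at 0
  may be evaluated at z - y for z in the ball and y in the support of \<open>w\<close>.\<close>

locale annulus_density =
  fixes w :: "real ^ 'n \<Rightarrow> real" and \<delta> R W :: real
  assumes w_borel [measurable]: "w \<in> borel_measurable borel" and w_bound: "\<And>y. \<bar>w y\<bar> \<le> W"
    and w_in: "\<And>y. norm y < \<delta> \<Longrightarrow> w y = 0" and w_out: "\<And>y. R < norm y \<Longrightarrow> w y = 0"
    and \<delta>: "0 < \<delta>"
begin

definition K :: "(real ^ 'n) set" where "K = cball 0 R - ball 0 \<delta>"

lemma K_compact: "compact K"
  unfolding K_def by (intro compact_diff compact_cball open_ball)

lemma w_K: "y \<notin> K \<Longrightarrow> w y = 0"
  using w_in w_out by (auto simp: K_def not_less not_le)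

lemma integrable_mult_continuous:
  assumes "continuous_on K f" shows "integrable lborel (\<lambda>y. w y * f y)"
proof -
  have Km[measurable]: "K \<in> sets borel" using K_compact by (rule borel_compact)
  have "bounded (f ` K)"
    by (rule compact_imp_bounded[OF compact_continuous_image[OF assms K_compact]])
  then obtain B where B: "\<And>y. y \<in> K \<Longrightarrow> \<bar>f y\<bar> \<le> B" by (auto simp: bounded_iff)
  have m[measurable]: "(\<lambda>y. indicator K y *\<^sub>R f y) \<in> borel_measurable borel"
    by (rule borel_measurable_continuous_on_indicator[OF Km assms])
  have eq: "(\<lambda>y. w y * f y) = (\<lambda>y. w y * (indicator K y *\<^sub>R f y))"
    using w_K by (auto simp: fun_eq_iff indicator_def)
  have le: "\<bar>w y\<bar> * \<bar>f y\<bar> \<le> W * \<bar>B\<bar>" if "y \<in> K" for y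
    using w_bound[of y] B[OF that] by (intro mult_mono) auto
  have W0: "0 \<le> W" using w_bound[of 0] by linarith
  show ?thesis
    unfolding eq
  proof (rule integrable_bounded_support[OF _ _ compact_imp_bounded[OF K_compact]])
    show "(\<lambda>y. w y * (indicator K y *\<^sub>R f y)) \<in> borel_measurable borel" by measurable
    show "\<bar>w y * (indicator K y *\<^sub>R f y)\<bar> \<le> W * \<bar>B\<bar>" for y
      using le[of y] W0 by (cases "y \<in> K") (auto simp: abs_mult)
  qed simp
qed

lemma integrable_w: "integrable lborel w"
  using integrable_mult_continuous[of "\<lambda>y. 1"] by simp

lemma K_minus_ne: "y \<in> K \<Longrightarrow> z \<in> ball 0 \<delta> \<Longrightarrow> z - y \<noteq> 0"
  unfolding K_def by auto

lemma integrable_kernel: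
  assumes "continuous_on (- {0}) \<kappa>" "z \<in> ball 0 \<delta>"
  shows "integrable lborel (\<lambda>y. w y * \<kappa> (z - y))"
  by (intro integrable_mult_continuous continuous_on_compose2[OF assms(1)] continuous_intros)
     (use K_minus_ne[OF _ assms(2)] in auto)

text \<open>A function vanishing on an open ball has vanishing directional derivatives there; the
  work is in differentiating the potential under the integral.\<close>

lemma vanish_derivative:
  assumes zero: "\<And>z. z \<in> ball 0 \<delta> \<Longrightarrow> (LINT y|lborel. w y * \<kappa> (z - y)) = 0"
    and cont: "continuous_on (- {0}) \<kappa>" "continuous_on (- {0}) \<kappa>'"
    and deriv: "\<And>v. v \<noteq> 0 \<Longrightarrow> ((\<lambda>t. \<kappa> (v + t *\<^sub>R e)) has_real_derivative \<kappa>' v) (at 0)"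
    and e: "norm e = 1" and z: "z \<in> ball 0 \<delta>"
  shows "(LINT y|lborel. w y * \<kappa>' (z - y)) = 0"
proof -
  define r where "r = (\<delta> - norm z) / 2"
  have r: "r > 0" using z unfolding r_def by simp
  have zt: "norm (z + t *\<^sub>R e) \<le> \<delta> - r" "z + t *\<^sub>R e \<in> ball 0 \<delta>" if "\<bar>t - 0\<bar> < r" for t
  proof -
    have "norm (z + t *\<^sub>R e) \<le> norm z + \<bar>t\<bar>" using norm_triangle_ineq[of z "t *\<^sub>R e"] e by simp
    then show "norm (z + t *\<^sub>R e) \<le> \<delta> - r" using that unfolding r_def by (simp add: field_simps)
    then show "z + t *\<^sub>R e \<in> ball 0 \<delta>" using r by simp
  qed
  \<comment> \<open>Since |z + t e| \<le> \<open>\<delta> - r\<close> and \<delta> \<le> |y| \<le>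
    R, all arguments of the kernel stay in this compact set, which avoids 0.\<close>
  define A where "A = cball 0 (\<delta> + R) - ball (0 :: real ^ 'n) r"
  have "compact A" unfolding A_def by (intro compact_diff compact_cball open_ball)
  moreover have "continuous_on A \<kappa>'" by (rule continuous_on_subset[OF cont(2)]) (use r in \<open>auto simp: A_def\<close>)
  ultimately have "bounded (\<kappa>' ` A)" by (intro compact_imp_bounded compact_continuous_image)
  then obtain B where B: "\<And>v. v \<in> A \<Longrightarrow> \<bar>\<kappa>' v\<bar> \<le> B" by (auto simp: bounded_iff)
  have "((\<lambda>t. LINT y|lborel. w y * \<kappa> (z + t *\<^sub>R e - y)) has_real_derivative (LINT y|lborel. w y * \<kappa>' (z + 0 *\<^sub>R e - y))) (at 0)"
  proof (rule has_real_derivative_lebesgue_integral[OF r, where B = "\<lambda>y. \<bar>w y\<bar> * B"])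
    show "integrable lborel (\<lambda>y. \<bar>w y\<bar> * B)" using integrable_w by simp
    fix t assume t: "\<bar>t - 0\<bar> < r"
    show "integrable lborel (\<lambda>y. w y * \<kappa> (z + t *\<^sub>R e - y))"
      by (rule integrable_kernel[OF cont(1) zt(2)[OF t]])
    fix y
    show "((\<lambda>t. w y * \<kappa> (z + t *\<^sub>R e - y)) has_real_derivative w y * \<kappa>' (z + t *\<^sub>R e - y)) (at t)"
    proof (cases "y \<in> K")
      case True
      have "((\<lambda>h. \<kappa> ((z + t *\<^sub>R e - y) + h *\<^sub>R e)) has_real_derivative \<kappa>' (z + t *\<^sub>R e - y)) (at 0)"
        by (rule deriv[OF K_minus_ne[OF True zt(2)[OF t]]])
      then have "((\<lambda>h. \<kappa> (z + (t + h) *\<^sub>R e - y)) has_real_derivative \<kappa>' (z + t *\<^sub>R e - y)) (at 0)"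
        by (simp add: algebra_simps)
      then have "((\<lambda>h. \<kappa> (z + h *\<^sub>R e - y)) has_real_derivative \<kappa>' (z + t *\<^sub>R e - y)) (at (0 + t))"
        by (subst DERIV_shift) (simp add: add.commute)
      then show ?thesis by (intro DERIV_cmult) simp
    next
      case False then show ?thesis using w_K by simp
    qed
    show "\<bar>w y * \<kappa>' (z + t *\<^sub>R e - y)\<bar> \<le> \<bar>w y\<bar> * B"
    proof (cases "y \<in> K")
      case True
      then have y: "norm y \<le> R" "\<delta> \<le> norm y" by (auto simp: K_def)
      have "norm (z + t *\<^sub>R e - y) \<le> norm (z + t *\<^sub>R e) + norm y" by (rule norm_triangle_ineq4)
      moreover have "norm y - norm (z + t *\<^sub>R e) \<le> norm (z + t *\<^sub>R e - y)"
        using norm_triangle_ineq2[of y "z + t *\<^sub>R e"] by (simp add: norm_minus_commute)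
      ultimately have "z + t *\<^sub>R e - y \<in> A" using zt(1)[OF t] y r unfolding A_def by auto
      then show ?thesis unfolding abs_mult by (intro mult_left_mono B) auto
    next
      case False then show ?thesis using w_K by simp
    qed
  qed
  moreover have "((\<lambda>t. LINT y|lborel. w y * \<kappa> (z + t *\<^sub>R e - y)) has_real_derivative 0) (at 0)"
  proof (rule has_field_derivative_transform_within_open[where f = "\<lambda>t. 0" and S = "ball 0 r"])
    show "0 = (LINT y|lborel. w y * \<kappa> (z + t *\<^sub>R e - y))" if "t \<in> ball 0 r" for t
      using zero[OF zt(2)[of t]] that by simp
  qed (use r in auto)
  ultimately show ?thesis using DERIV_unique by fastforce
qed

text \<open>The kernel |v|^(-b), written through the inner product so that a power of a quadratic
  polynomial in t is differentiated.\<close>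

definition Q :: "real \<Rightarrow> real ^ 'n \<Rightarrow> real" where
  "Q b v = (v \<bullet> v) powr (- (b / 2))"

lemma Q_continuous: "continuous_on (- {0}) (Q b)"
  unfolding Q_def by (intro continuous_intros) auto

lemma Q_mult: "v \<noteq> 0 \<Longrightarrow> Q (b + 2) v * (v \<bullet> v) = Q b v"
proof -
  assume "v \<noteq> 0"
  then have "v \<bullet> v > 0" by simp
  then have "Q (b + 2) v * (v \<bullet> v) = (v \<bullet> v) powr (- ((b + 2) / 2)) * (v \<bullet> v) powr 1" unfolding Q_def by simp
  also have "\<dots> = Q b v" unfolding Q_def by (simp only: powr_add[symmetric]) (simp add: field_simps)
  finally show ?thesis .
qed

lemma Q_deriv:
  assumes "v \<noteq> 0"
  shows "((\<lambda>t. Q b (v + t *\<^sub>R axis i 1)) has_real_derivative - b * (Q (b + 2) v * v $ i)) (at 0)"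
proof -
  have p: "v \<bullet> v > 0" using assms by simp
  have "((\<lambda>t. (v + t *\<^sub>R axis i 1) \<bullet> (v + t *\<^sub>R axis i 1)) has_real_derivative 2 * v $ i) (at 0)"
  proof -
    have eq: "(v + t *\<^sub>R axis i 1) \<bullet> (v + t *\<^sub>R axis i 1) = v \<bullet> v + 2 * t * v $ i + t * t" for t
      by (simp add: inner_add_left inner_add_right inner_commute inner_axis inner_axis_axis algebra_simps)
    show ?thesis unfolding eq by (auto intro!: derivative_eq_intros)
  qed
  then have "((\<lambda>t. ((v + t *\<^sub>R axis i 1) \<bullet> (v + t *\<^sub>R axis i 1)) powr (- (b / 2))) has_real_derivative
     - (b / 2) * ((v + 0 *\<^sub>R axis i 1) \<bullet> (v + 0 *\<^sub>R axis i 1)) powr (- (b / 2) - of_nat 1) * (2 * v $ i)) (at 0)"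
    by (rule DERIV_fun_powr) (use p in auto)
  moreover have "- (b / 2) - of_nat 1 = - ((b + 2) / 2)" by (simp add: field_simps)
  ultimately show ?thesis unfolding Q_def by (simp add: mult_ac)
qed

lemma Q_mult_component_deriv:
  assumes "v \<noteq> 0"
  shows "((\<lambda>t. Q b (v + t *\<^sub>R axis i 1) * (v + t *\<^sub>R axis i 1) $ i) has_real_derivative
     Q b v - b * (Q (b + 2) v * (v $ i)\<^sup>2)) (at 0)"
proof -
  have "((\<lambda>t. (v + t *\<^sub>R axis i 1) $ i) has_real_derivative 1) (at 0)"
    by (auto intro!: derivative_eq_intros simp: axis_def)
  from DERIV_mult[OF Q_deriv[OF assms, of b i] this] show ?thesis
    by (simp add: power2_eq_square mult_ac)
qed

text \<open>The Laplacian of \<open>|v| powr -b\<close> is \<open>b (b + 2 - N) |v| powr -(b + 2)\<close>.\<close>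

lemma vanish_step:
  assumes zero: "\<And>z. z \<in> ball 0 \<delta> \<Longrightarrow> (LINT y|lborel. w y * Q b (z - y)) = 0"
    and b: "b > 0" "b + 2 \<noteq> real CARD('n)" and z: "z \<in> ball 0 \<delta>"
  shows "(LINT y|lborel. w y * Q (b + 2) (z - y)) = 0"
proof -
  \<comment> \<open>Up to the factor -b this is the second derivative of |v|^(-b) in the i-th
    coordinate direction; two first order steps lead to it.\<close>
  define \<kappa> where "\<kappa> i v = Q (b + 2) v - (b + 2) * (Q (b + 2 + 2) v * (v $ i)\<^sup>2)" for i v
  have \<kappa>c: "continuous_on (- {0}) (\<kappa> i)" for i
    unfolding \<kappa>_def by (intro continuous_intros Q_continuous)
  have c1: "continuous_on (- {0}) (\<lambda>v. Q c v * v $ i)" for c i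
    by (intro continuous_intros Q_continuous)
  have 1: "(LINT y|lborel. w y * (Q (b + 2) (z - y) * (z - y) $ i)) = 0" if z: "z \<in> ball 0 \<delta>" for z i
  proof -
    have "(LINT y|lborel. w y * (- b * (Q (b + 2) (z - y) * (z - y) $ i))) = 0"
      by (rule vanish_derivative[OF zero Q_continuous _ Q_deriv _ z])
         (auto intro!: continuous_intros c1)
    then have "- b * (LINT y|lborel. w y * (Q (b + 2) (z - y) * (z - y) $ i)) = 0"
      by (simp only: mult.left_commute[of _ "- b"] integral_mult_right_zero)
    then show ?thesis using b by simp
  qed
  have 2: "(LINT y|lborel. w y * \<kappa> i (z - y)) = 0" for i
    by (rule vanish_derivative[of "\<lambda>v. Q (b + 2) v * v $ i", OF 1 c1 \<kappa>c Q_mult_component_deriv[of _ "b + 2" i, folded \<kappa>_def] _ z])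
       auto
  have "0 = (\<Sum>i\<in>UNIV. (LINT y|lborel. w y * \<kappa> i (z - y)))" using 2 by simp
  also have "\<dots> = (LINT y|lborel. (\<Sum>i\<in>UNIV. w y * \<kappa> i (z - y)))"
    by (rule Bochner_Integration.integral_sum[symmetric]) (rule integrable_kernel[OF \<kappa>c z])
  also have "\<dots> = (LINT y|lborel. (real CARD('n) - (b + 2)) * (w y * Q (b + 2) (z - y)))"
  proof (rule Bochner_Integration.integral_cong[OF refl])
    fix y
    show "(\<Sum>i\<in>UNIV. w y * \<kappa> i (z - y)) = (real CARD('n) - (b + 2)) * (w y * Q (b + 2) (z - y))"
    proof (cases "y \<in> K")
      case True
      define v where "v = z - y"
      have v: "v \<noteq> 0" unfolding v_def by (rule K_minus_ne[OF True z])
      \<comment> \<open>Summation over the coordinates forms the Laplacian, in which |v|^2 lowers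
        the exponent b + 4 back to b + 2.\<close>
      have "(\<Sum>i\<in>UNIV. \<kappa> i v) = real CARD('n) * Q (b + 2) v - (b + 2) * (Q (b + 2 + 2) v * (\<Sum>i\<in>UNIV. (v $ i)\<^sup>2))"
        unfolding \<kappa>_def by (simp add: sum_subtractf sum_distrib_left)
      also have "(\<Sum>i\<in>UNIV. (v $ i)\<^sup>2) = v \<bullet> v" by (simp add: inner_vec_def power2_eq_square)
      finally have "(\<Sum>i\<in>UNIV. \<kappa> i v) = (real CARD('n) - (b + 2)) * Q (b + 2) v"
        unfolding Q_mult[OF v, of "b + 2"] by (simp add: left_diff_distrib)
      then show ?thesis unfolding v_def by (simp add: sum_distrib_left[symmetric])
    next
      case False then show ?thesis using w_K by simp
    qed
  qed
  also have "\<dots> = (real CARD('n) - (b + 2)) * (LINT y|lborel. w y * Q (b + 2) (z - y))"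
    by (rule integral_mult_right_zero)
  finally show ?thesis using b by simp
qed

text \<open>With r = |z - y|^(-2) and the weight |z - y|^(-a) absorbed into the density, all moments
  of r vanish. The one-variable Weierstrass theorem on the compact range of r then covers every
  continuous function of r. The condition a + 2 > N keeps each Laplacian step nondegenerate.\<close>

lemma vanish_gaussian:
  assumes zero: "\<And>z. z \<in> ball 0 \<delta> \<Longrightarrow> (LINT y|lborel. w y * Q a (z - y)) = 0"
    and a: "a > 0" "a + 2 > real CARD('n)" and z: "z \<in> ball 0 \<delta>"
  shows "(LINT y|lborel. w y * exp (- l * (norm (z - y))\<^sup>2)) = 0"
proof -
  have m: "(LINT y|lborel. w y * Q (a + 2 * real m) (z - y)) = 0" if "z \<in> ball 0 \<delta>" for m z
    using that
  proof (induction m arbitrary: z)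
    case 0 then show ?case using zero by simp
  next
    case (Suc m)
    have "(LINT y|lborel. w y * Q (a + 2 * real m + 2) (z - y)) = 0"
      by (rule vanish_step[OF Suc.IH _ _ Suc.prems]) (use a in auto)
    then show ?case by (simp add: algebra_simps)
  qed
  define r where "r y = 1 / ((z - y) \<bullet> (z - y))" for y
  have rpos: "r y > 0" if "y \<in> K" for y
    using K_minus_ne[OF that z] unfolding r_def by simp
  have rc: "continuous_on K r"
    unfolding r_def by (intro continuous_intros) (use K_minus_ne[OF _ z] in auto)
  have Qr: "Q b (z - y) = r y powr (b / 2)" if "y \<in> K" for b y
    using K_minus_ne[OF that z] unfolding r_def Q_def by (simp add: powr_minus powr_divide inverse_eq_divide)
  have Qc: "continuous_on K (\<lambda>y. Q b (z - y))" for b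
    by (intro continuous_on_compose2[OF Q_continuous] continuous_intros) (use K_minus_ne[OF _ z] in auto)
  define w' where "w' y = w y * Q a (z - y)" for y
  have w'c: "integrable lborel (\<lambda>y. w' y * f y)" if "continuous_on K f" for f
    using integrable_mult_continuous[of "\<lambda>y. Q a (z - y) * f y"] that Qc
    by (simp add: w'_def continuous_on_mult mult.assoc)
  have pow: "(LINT y|lborel. w' y * r y ^ m) = 0" for m
  proof -
    have "w' y * r y ^ m = w y * Q (a + 2 * real m) (z - y)" for y
    proof (cases "y \<in> K")
      case True
      have "r y ^ m = r y powr real m" using rpos[OF True] by (simp add: powr_realpow)
      then show ?thesis
        unfolding w'_def Qr[OF True] by (simp add: powr_add[symmetric] add_divide_distrib)
    next
      case False then show ?thesis using w_K by (simp add: w'_def)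
    qed
    then show ?thesis using m[OF z, of m] by simp
  qed
  \<comment> \<open>The power cancels the weight contained in \<open>w'\<close>, and exp(-l / r) is
    the Gaussian in |z - y|.\<close>
  define h where "h \<rho> = \<rho> powr (- (a / 2)) * exp (- l / \<rho>)" for \<rho> :: real
  have "(LINT y|lborel. w' y * h (r y)) = 0"
  proof (rule integral_zero_if_approximable[where K = K])
    show "integrable lborel w'" using w'c[of "\<lambda>y. 1"] by simp
    show "y \<notin> K \<Longrightarrow> w' y = 0" for y using w_K by (simp add: w'_def)
    have hc: "continuous_on {0<..} h" unfolding h_def by (intro continuous_intros) auto
    show "integrable lborel (\<lambda>y. w' y * h (r y))"
      by (intro w'c continuous_on_compose2[OF hc rc]) (use rpos in auto)
    fix e :: real assume e: "e > 0"
    have "compact (r ` K)" by (rule compact_continuous_image[OF rc K_compact])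
    moreover have "continuous_on (r ` K) h" by (rule continuous_on_subset[OF hc]) (use rpos in auto)
    ultimately obtain p where p: "real_polynomial_function p" "\<And>x. x \<in> r ` K \<Longrightarrow> \<bar>h x - p x\<bar> < e"
      using Stone_Weierstrass_real_polynomial_function[OF _ _ e] by metis
    obtain c n where c: "p = (\<lambda>x. \<Sum>i\<le>n. c i * x ^ i)"
      using p(1) by (auto simp: real_polynomial_function_iff_sum)
    have int: "integrable lborel (\<lambda>y. w' y * r y ^ i)" for i by (intro w'c continuous_intros rc)
    have "(\<lambda>y. w' y * p (r y)) = (\<lambda>y. \<Sum>i\<le>n. c i * (w' y * r y ^ i))"
      unfolding c by (auto simp: sum_distrib_left mult_ac fun_eq_iff)
    moreover have "integrable lborel (\<lambda>y. \<Sum>i\<le>n. c i * (w' y * r y ^ i))" using int by simp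
    moreover have "(LINT y|lborel. (\<Sum>i\<le>n. c i * (w' y * r y ^ i))) = 0"
      using int pow by (subst Bochner_Integration.integral_sum) auto
    ultimately have "integrable lborel (\<lambda>y. w' y * p (r y))" "(LINT y|lborel. w' y * p (r y)) = 0" by simp_all
    then show "\<exists>g. integrable lborel (\<lambda>y. w' y * g y) \<and> (LINT y|lborel. w' y * g y) = 0 \<and> (\<forall>y\<in>K. \<bar>h (r y) - g y\<bar> < e)"
      using p(2) by (intro exI[of _ "\<lambda>y. p (r y)"]) auto
  qed
  moreover have "w' y * h (r y) = w y * exp (- l * (norm (z - y))\<^sup>2)" for y
  proof (cases "y \<in> K")
    case True
    have "r y powr (a / 2) * r y powr (- (a / 2)) = 1"
      using rpos[OF True] by (simp add: powr_minus)
    moreover have "- l / r y = - l * (norm (z - y))\<^sup>2" unfolding r_def by (simp add: power2_norm_eq_inner)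
    ultimately show ?thesis unfolding w'_def h_def Qr[OF True] by (simp add: mult.assoc[symmetric] mult.assoc[of "w y"])
  next
    case False then show ?thesis using w_K by (simp add: w'_def)
  qed
  ultimately show ?thesis by simp
qed

text \<open>Gaussians centred in the ball form an algebra separating points, so on the compact
  support of \<open>w\<close> they approximate every continuous function uniformly.\<close>

lemma vanish_continuous:
  assumes zero: "\<And>z. z \<in> ball 0 \<delta> \<Longrightarrow> (LINT y|lborel. w y * Q a (z - y)) = 0"
    and a: "a > 0" "a + 2 > real CARD('n)" and \<psi>: "continuous_on UNIV \<psi>"
  shows "(LINT y|lborel. w y * \<psi> y) = 0"
proof (rule integral_zero_if_approximable[OF integrable_w w_K])
  show "integrable lborel (\<lambda>y. w y * \<psi> y)"
    by (intro integrable_mult_continuous continuous_on_subset[OF \<psi>]) auto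
  fix e :: real assume e: "e > 0"
  have g0: "(LINT y|lborel. w y * g y) = 0" if "gaussian \<delta> g" for g
    using that
  proof induction
    case (const c)
    \<comment> \<open>Constants are reached through exponent l = 0, which
      \<open>vanish_gaussian\<close> permits.\<close>
    have "(LINT y|lborel. w y * exp (- 0 * (norm (0 - y))\<^sup>2)) = 0"
      by (rule vanish_gaussian[OF zero a]) (use \<delta> in auto)
    then show ?case by simp
  next
    case (gauss l z c)
    have "(LINT y|lborel. c * (w y * exp (- l * (norm (z - y))\<^sup>2))) = 0"
      using vanish_gaussian[OF zero a gauss(2), of l] by (simp only: integral_mult_right_zero mult_zero_right)
    then show ?case by (simp only: mult.left_commute)
  next
    case (add f g)
    have "integrable lborel (\<lambda>y. w y * f y)" "integrable lborel (\<lambda>y. w y * g y)"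
      using add.hyps by (auto intro: integrable_mult_continuous gaussian_continuous)
    then show ?case using add.IH by (simp add: distrib_left)
  qed
  have "\<exists>g. gaussian \<delta> g \<and> (\<forall>x\<in>K. \<bar>\<psi> x - g x\<bar> < e)"
  proof (rule Stone_Weierstrass_HOL[OF K_compact])
    show "gaussian \<delta> (\<lambda>x. c)" for c by (rule gaussian.const)
    show "continuous_on K f" if "gaussian \<delta> f" for f using that by (rule gaussian_continuous)
    show "gaussian \<delta> (\<lambda>x. f x + g x)" if "gaussian \<delta> f \<and> gaussian \<delta> g" for f g
      using that gaussian.add by blast
    show "gaussian \<delta> (\<lambda>x. f x * g x)" if "gaussian \<delta> f \<and> gaussian \<delta> g" for f g
      using that gaussian_mult by blast
    show "continuous_on K \<psi>" by (rule continuous_on_subset[OF \<psi>]) auto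
    fix x y assume xy: "x \<in> K \<and> y \<in> K \<and> x \<noteq> y"
    have *: "\<exists>f. gaussian \<delta> f \<and> f x \<noteq> f y" if "z \<in> ball 0 \<delta>" "(norm (z - x))\<^sup>2 \<noteq> (norm (z - y))\<^sup>2" for z
      using gaussian.gauss[of 1 z \<delta> 1] that by (intro exI[of _ "\<lambda>y. 1 * exp (- 1 * (norm (z - y))\<^sup>2)"]) auto
    show "\<exists>f. gaussian \<delta> f \<and> f x \<noteq> f y"
    proof (cases "(norm (0 - x))\<^sup>2 = (norm (0 - y))\<^sup>2")
      case False then show ?thesis using *[of 0] \<delta> by simp
    next
      case True
      \<comment> \<open>A Gaussian at the origin cannot separate points of equal norm. Moving the
        centre by \<delta>/2 in the direction x - y stays in the ball and makes the distances
        differ.\<close>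
      define t where "t = \<delta> / (2 * norm (x - y))"
      define z where "z = t *\<^sub>R (x - y)"
      have t: "t > 0" unfolding t_def using \<delta> xy by simp
      have "norm z = \<delta> / 2" unfolding z_def t_def using \<delta> xy by simp
      then have zb: "z \<in> ball 0 \<delta>" using \<delta> by simp
      have "(norm (z - x))\<^sup>2 - (norm (z - y))\<^sup>2 = (norm x)\<^sup>2 - (norm y)\<^sup>2 - 2 * (z \<bullet> (x - y))"
        unfolding power2_norm_eq_inner by (simp add: inner_diff_left inner_diff_right inner_commute)
      also have "\<dots> = - 2 * t * (norm (x - y))\<^sup>2"
        using True unfolding z_def by (simp add: power2_norm_eq_inner)
      also have "\<dots> \<noteq> 0" using t xy by simp
      finally show ?thesis using *[OF zb] by simp
    qed
  qed (rule e)
  then show "\<exists>g. integrable lborel (\<lambda>y. w y * g y) \<and> (LINT y|lborel. w y * g y) = 0 \<and> (\<forall>y\<in>K. \<bar>\<psi> y - g y\<bar> < e)"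
    using g0 by (auto intro: integrable_mult_continuous gaussian_continuous)
qed

end

section \<open>Barriers for small times\<close>

lemma C11_boundary_graph:
  assumes "C11_boundary \<Omega>" "p \<in> frontier \<Omega>"
  obtains r e g where "r > 0" "norm e = 1" "g differentiable_on UNIV"
    "\<And>x. x \<in> ball p r \<Longrightarrow> x \<in> \<Omega> \<longleftrightarrow> g (x - (x \<bullet> e) *\<^sub>R e) < x \<bullet> e"
proof -
  obtain r e g where *: "r > 0" "norm e = 1" "C11_function g"
    "\<Omega> \<inter> ball p r = {x \<in> ball p r. g (x - (x \<bullet> e) *\<^sub>R e) < x \<bullet> e}"
    using assms unfolding C11_boundary_def by blast
  have "g differentiable_on UNIV"
    using *(3) unfolding C11_function_def differentiable_on_def differentiable_def by auto
  then show thesis using that * by blast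
qed

text \<open>Locally the frontier lies in a graph over a hyperplane, the image of a null set under a
  differentiable map between spaces of equal dimension.\<close>

lemma negligible_frontier_C11:
  fixes \<Omega> :: "(real ^ 'n) set"
  assumes C: "C11_boundary \<Omega>" and "open \<Omega>"
  shows "negligible (frontier \<Omega>)"
proof (rule iffD2[OF locally_negligible_alt], rule ballI)
  fix p assume p: "p \<in> frontier \<Omega>"
  obtain r e g where r: "r > 0" and e: "norm e = 1" and g: "g differentiable_on UNIV"
    and graph: "\<And>x. x \<in> ball p r \<Longrightarrow> x \<in> \<Omega> \<longleftrightarrow> g (x - (x \<bullet> e) *\<^sub>R e) < x \<bullet> e"
    using C11_boundary_graph[OF C p] by metis
  have gc: "continuous_on UNIV g" using g by (rule differentiable_imp_continuous_on)
  define H where "H = {x. e \<bullet> x = 0}"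
  define F where "F x = x + g x *\<^sub>R e" for x
  have "negligible (F ` H)"
  proof (rule negligible_differentiable_image_negligible)
    show "negligible H" unfolding H_def using e by (intro negligible_hyperplane) auto
    show "F differentiable_on H"
      unfolding F_def by (intro derivative_intros differentiable_on_subset[OF g]) auto
  qed simp
  moreover have "frontier \<Omega> \<inter> ball p r \<subseteq> F ` H"
  proof
    fix x assume x: "x \<in> frontier \<Omega> \<inter> ball p r"
    define P where "P = x - (x \<bullet> e) *\<^sub>R e"
    have nx: "x \<notin> \<Omega>" using x \<open>open \<Omega>\<close> by (auto simp: frontier_def interior_open)
    \<comment> \<open>Being strictly below the graph is an open condition and excludes membership in
      \<Omega>, so such a point is not in the closure; a point strictly above belongs to \<Omega>.
      Frontier points are thus on the graph.\<close>
    have "\<not> x \<bullet> e < g P"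
    proof
      assume "x \<bullet> e < g P"
      define S where "S = ball p r \<inter> {y. y \<bullet> e < g (y - (y \<bullet> e) *\<^sub>R e)}"
      have "open {y. y \<bullet> e < g (y - (y \<bullet> e) *\<^sub>R e)}"
        by (intro open_Collect_less continuous_intros continuous_on_compose2[OF gc]) auto
      then have "open S" unfolding S_def by (intro open_Int open_ball)
      moreover have "x \<in> S" using x \<open>x \<bullet> e < g P\<close> unfolding S_def P_def by simp
      moreover have "S \<inter> \<Omega> = {}" unfolding S_def using graph by fastforce
      ultimately have "x \<notin> closure \<Omega>" by (meson closure_iff_nhds_not_empty disjoint_iff open_Int_closure_eq_empty)
      then show False using x by (simp add: frontier_def)
    qed
    then have "x \<bullet> e = g P" using graph[of x] nx x unfolding P_def by auto
    then have "x = F P" unfolding F_def P_def by simp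
    moreover have "P \<in> H"
      unfolding H_def P_def using e by (simp add: inner_diff_right inner_commute norm_eq_1)
    ultimately show "x \<in> F ` H" by blast
  qed
  ultimately have "negligible (frontier \<Omega> \<inter> ball p r)" by (rule negligible_subset)
  then show "\<exists>U. openin (top_of_set (frontier \<Omega>)) U \<and> p \<in> U \<and> negligible U"
    using p r by (intro exI[of _ "frontier \<Omega> \<inter> ball p r"]) (auto intro: openin_open_Int)
qed

text \<open>If -x is outside the closure, the condition is already open near x. If -x is a frontier
  point, moving x a little along the vertical direction \<open>e\<close> moves its reflection
  strictly below the graph, and being strictly below is open.\<close>

lemma open_reflected_gap:
  fixes \<Omega> :: "(real ^ 'n) set"
  assumes C: "C11_boundary \<Omega>" and \<Omega>: "open \<Omega>" and x: "x \<in> \<Omega>" "- x \<notin> \<Omega>"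
  obtains V where "open V" "V \<noteq> {}" "V \<subseteq> \<Omega>" "\<And>y. y \<in> V \<Longrightarrow> - y \<notin> \<Omega>"
proof (cases "- x \<in> closure \<Omega>")
  case False
  have "continuous_on UNIV (uminus :: real ^ 'n \<Rightarrow> real ^ 'n)" by (intro continuous_intros)
  then have "open (uminus -` (- closure \<Omega>))" by (intro open_vimage) auto
  then show thesis
    using that[of "\<Omega> \<inter> uminus -` (- closure \<Omega>)"] \<Omega> x False closure_subset[of \<Omega>] by auto
next
  case True
  then have "- x \<in> frontier \<Omega>" using x \<Omega> by (simp add: frontier_def interior_open)
  then obtain r e g where r: "r > 0" and e: "norm e = 1" and g: "g differentiable_on UNIV"
    and graph: "\<And>y. y \<in> ball (- x) r \<Longrightarrow> y \<in> \<Omega> \<longleftrightarrow> g (y - (y \<bullet> e) *\<^sub>R e) < y \<bullet> e"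
    using C11_boundary_graph[OF C] by metis
  have gc: "continuous_on UNIV g" using g by (rule differentiable_imp_continuous_on)
  define V where "V = \<Omega> \<inter> {y. - y \<in> ball (- x) r} \<inter> {y. - y \<bullet> e < g (- y - (- y \<bullet> e) *\<^sub>R e)}"
  have "open {y. - y \<bullet> e < g (- y - (- y \<bullet> e) *\<^sub>R e)}"
    by (intro open_Collect_less continuous_intros continuous_on_compose2[OF gc]) auto
  moreover have "{y. - y \<in> ball (- x) r} = ball x r" by (auto simp: dist_norm norm_minus_commute)
  ultimately have Vo: "open V" unfolding V_def using \<Omega> by (intro open_Int) auto
  obtain d where d: "d > 0" "ball x d \<subseteq> \<Omega>" using \<Omega> x(1) openE by blast
  \<comment> \<open>Small enough for x + t e to stay in \<Omega> and for its reflection to stay in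
    the ball where the graph describes \<Omega>.\<close>
  define t where "t = min r d / 2"
  have t: "t > 0" "t < r" "t < d" unfolding t_def using r d by auto
  have ee: "e \<bullet> e = 1" using e by (simp add: norm_eq_1)
  have "x + t *\<^sub>R e \<in> V"
  proof -
    have "x + t *\<^sub>R e \<in> \<Omega>" using d(2) t e by (auto simp: dist_norm)
    moreover have "- (x + t *\<^sub>R e) \<in> ball (- x) r" using t e by (simp add: dist_norm)
    moreover have "- (x + t *\<^sub>R e) \<bullet> e < g (- (x + t *\<^sub>R e) - (- (x + t *\<^sub>R e) \<bullet> e) *\<^sub>R e)"
    proof -
      have 1: "- (x + t *\<^sub>R e) - (- (x + t *\<^sub>R e) \<bullet> e) *\<^sub>R e = - x - (- x \<bullet> e) *\<^sub>R e"
        using ee by (simp add: inner_add_left inner_diff_left algebra_simps)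
      have 2: "- (x + t *\<^sub>R e) \<bullet> e < - x \<bullet> e" using ee t by (simp add: inner_add_left inner_diff_left)
      have 3: "\<not> g (- x - (- x \<bullet> e) *\<^sub>R e) < - x \<bullet> e" using graph[of "- x"] r x(2) by simp
      show ?thesis unfolding 1 using 2 3 by linarith
    qed
    ultimately show ?thesis unfolding V_def by blast
  qed
  moreover have "- y \<notin> \<Omega>" if "y \<in> V" for y
    using graph[of "- y"] that unfolding V_def by auto
  ultimately show thesis using that[OF Vo] unfolding V_def by blast
qed

lemma integrable_indicator_kernel:
  fixes f :: "real ^ 'n \<Rightarrow> real"
  assumes s: "0 < s" "s < 1" and [measurable]: "f \<in> borel_measurable borel"
    and f: "\<And>x. \<bar>f x\<bar> \<le> C" and r: "r > 0" and z: "\<And>x. norm x < r \<Longrightarrow> f x = 0"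
  shows "integrable lborel (\<lambda>h. f h / kern s h)"
proof (rule Bochner_Integration.integrable_bound)
  show "integrable lborel (\<lambda>h::real^'n. C / min 1 (r\<^sup>2) * (min 1 ((norm h)\<^sup>2) / kern s h))"
    by (intro integrable_mult_right integrable_min_kernel s)
  show "AE h in lborel. norm (f h / kern s h)
     \<le> norm (C / min 1 (r\<^sup>2) * (min 1 ((norm h)\<^sup>2) / kern s h))"
  proof (rule AE_I2)
    fix h :: "real^'n"
    have C0: "C \<ge> 0" using f[of 0] by linarith
    have m: "min 1 (r\<^sup>2) > 0" using r by simp
    have "\<bar>f h\<bar> \<le> C / min 1 (r\<^sup>2) * min 1 ((norm h)\<^sup>2)"
    proof (cases "norm h < r")
      case True then show ?thesis using z C0 m by simp
    next
      case False
      then have "r\<^sup>2 \<le> (norm h)\<^sup>2" using r by (intro power_mono) auto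
      then have "min 1 (r\<^sup>2) \<le> min 1 ((norm h)\<^sup>2)" by auto
      then have "C * min 1 (r\<^sup>2) \<le> C * min 1 ((norm h)\<^sup>2)" using C0 by (intro mult_left_mono)
      then have "C \<le> C / min 1 (r\<^sup>2) * min 1 ((norm h)\<^sup>2)" using m by (simp add: pos_le_divide_eq)
      then show ?thesis using f[of h] by linarith
    qed
    then have "\<bar>f h\<bar> / kern s h \<le>
       C / min 1 (r\<^sup>2) * min 1 ((norm h)\<^sup>2) / kern s h"
      by (intro divide_right_mono) auto
    then show "norm (f h / kern s h)
     \<le> norm (C / min 1 (r\<^sup>2) * (min 1 ((norm h)\<^sup>2) / kern s h))"
      using C0 m by (simp add: abs_mult)
  qed
qed measurable

text \<open>Oddness is assumed only near 0, where g(h) and g(-h) cancel and the singularity with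
  them. Away from 0 the two translates contribute equally, which gives the factor -2.\<close>

lemma frac_lap_at_odd_point:
  fixes g :: "real ^ 'n \<Rightarrow> real"
  assumes s: "0 < s" "s < 1" and g: "bdd_C11 g" and r: "r > 0"
    and odd: "\<And>x. norm x < r \<Longrightarrow> g (- x) = - g x"
  shows "frac_lap s g 0 =
    - 2 * (LINT h|lborel. indicator (- ball 0 r) h * g h / kern s h)"
proof -
  obtain C where C: "\<And>x. \<bar>g x\<bar> \<le> C" using g by (rule bdd_C11E) blast
  have [measurable]: "g \<in> borel_measurable borel" using g by (rule bdd_C11_borel)
  let ?f = "\<lambda>h. indicator (- ball 0 r) h * g h / kern s h"
  have i: "integrable lborel ?f"
    by (rule integrable_indicator_kernel[OF s _ _ r, of _ C])
       (use C order_trans[OF abs_ge_zero C] in \<open>auto simp: indicator_def\<close>)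
  have g0: "g 0 = 0" using odd[of 0] r by simp
  have "frac_lap s g 0 = (LINT h|lborel. - ?f h - ?f (- h))"
    unfolding frac_lap_def
  proof (rule Bochner_Integration.integral_cong[OF refl])
    fix h :: "real^'n"
    show "(2 * g 0 - g (0 + h) - g (0 - h)) / kern s h = - ?f h - ?f (- h)"
      using odd[of h] g0 by (auto simp: indicator_def diff_divide_distrib)
  qed
  also have "\<dots> = - (LINT h|lborel. ?f h) - (LINT h|lborel. ?f (- h))"
    using i integrable_lborel_uminus[OF i] by simp
  also have "(LINT h|lborel. ?f (- h)) = (LINT h|lborel. ?f h)"
    by (rule integral_lborel_uminus)
  finally show ?thesis by simp
qed

section \<open>Sign information at the origin from u(0, t) = 0\<close>

context
  fixes s \<delta> :: real and \<Omega> :: "(real ^ 'n) set" and u0 u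
  assumes s: "0 < s" "s < 1" and \<Omega>: "open \<Omega>" "bounded \<Omega>"
    and \<delta>: "0 < \<delta>" "ball 0 \<delta> \<subseteq> \<Omega>"
    and sol: "frac_heat_solution s \<Omega> u0 u"
    and u0: "smooth_on UNIV u0" "\<And>x. \<delta> \<le> norm x \<Longrightarrow> u0 x = 0" "\<And>x. u0 (- x) = - u0 x"
    and zero: "\<And>t. t > 0 \<Longrightarrow> u 0 t = 0"
begin

text \<open>For small times \<open>u0 - t g + t\<^sup>2 k\<close> with \<open>2 k > (-\<Delta>)\<^sup>s g\<close> is a supersolution, where \<open>k\<close> may be
  chosen with \<open>2 k 0\<close> arbitrarily close to \<open>(-\<Delta>)\<^sup>s g 0\<close>; at the origin it reduces to \<open>t\<^sup>2 k 0\<close>.\<close>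

lemma frac_lap_minorant_nonneg:
  assumes g: "bdd_C11 g" and R: "\<And>x. R < norm x \<Longrightarrow> g x = 0" and g0: "g 0 = 0"
    and le: "\<And>x. x \<in> \<Omega> \<Longrightarrow> g x \<le> frac_const TYPE('n) s / 2 * frac_lap s u0 x"
    and out: "\<And>x. x \<notin> \<Omega> \<Longrightarrow> g x \<le> 0"
  shows "0 \<le> frac_lap s g 0"
proof -
  define \<mu> where "\<mu> = frac_const TYPE('n) s / 2"
  have \<mu>: "\<mu> > 0" unfolding \<mu>_def using frac_const_pos[OF s] by simp
  have bu0: "bdd_C11 u0" by (rule smooth_bdd_C11[OF u0(1), of \<delta>]) (use u0(2) in auto)
  define L where "L x = \<mu> * frac_lap s g x" for x
  obtain M0 where M0: "\<And>x. \<bar>frac_lap s g x\<bar> \<le> M0" using frac_lap_bounded[OF s g] by blast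
  define M where "M = \<mu> * M0"
  have M: "\<bar>L x\<bar> \<le> M" for x
    unfolding L_def M_def abs_mult using \<mu> M0 by (simp add: mult_left_mono)
  have M_nn: "0 \<le> M" using M[of 0] by linarith
  have Lc: "isCont L 0"
    unfolding L_def using frac_lap_continuous[OF s g] by (intro continuous_intros) (simp add: continuous_on_eq_continuous_at)
  \<comment> \<open>A margin \<kappa> is built into the barrier and sent to 0 at the end.\<close>
  have main: "0 \<le> L 0 / 2 + 2 * \<kappa>" if \<kappa>: "\<kappa> > 0" for \<kappa>
  proof -
    obtain r1 where r1: "r1 > 0" "\<And>x. norm x < r1 \<Longrightarrow> \<bar>L x - L 0\<bar> < \<kappa>"
      using Lc \<kappa> unfolding continuous_at_eps_delta by (auto simp: dist_norm)
    define r where "r = min r1 \<delta>"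
    have r: "r > 0" "r \<le> r1" "r \<le> \<delta>" unfolding r_def using r1 \<delta> by auto
    define \<beta> :: "real ^ 'n \<Rightarrow> real" where "\<beta> = bump r 0"
    have \<beta>: "0 \<le> \<beta> x" "\<beta> x \<le> 1" "\<beta> 0 = 1" "r \<le> norm x \<Longrightarrow> \<beta> x = 0" for x
      unfolding \<beta>_def using bump_nonneg[OF r(1)] bump_le_1[OF r(1)] bump_center[OF r(1)] bump_outside[OF r(1), of x 0] by auto
    \<comment> \<open>\<open>K + q\<close> equals L(0)/2 + 2\<kappa> at the origin and is larger by
      \<open>M\<close> outside the ball of radius \<open>r\<close>. Twice it exceeds
      \<open>L\<close> by 3\<kappa> everywhere: near 0 by continuity of \<open>L\<close>, elsewhere
      because |L| \<le> M.\<close>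
    define K where "K = L 0 / 2 + 2 * \<kappa> + M"
    define q where "q x = - M * \<beta> x" for x
    have q: "bdd_C11 q" unfolding q_def[abs_def] \<beta>_def by (intro bdd_C11_cmult bump_bdd_C11 r)
    obtain B0 where B0: "\<And>x. \<bar>frac_lap s q x\<bar> \<le> B0" using frac_lap_bounded[OF s q] by blast
    define B where "B = \<mu> * B0"
    have B: "\<bar>\<mu> * frac_lap s q x\<bar> \<le> B" for x
      unfolding B_def abs_mult using \<mu> B0 by (simp add: mult_left_mono)
    have B_nn: "0 \<le> B" using B[of 0] by linarith
    \<comment> \<open>With T B \<le> \<kappa> the fractional Laplacian of \<open>q\<close>, which
      enters the supersolution inequality with one more power of t, is absorbed by the
      margin.\<close>
    define T where "T = \<kappa> / (B + 1)"
    have T: "T > 0" "T * B \<le> \<kappa>" unfolding T_def using B_nn \<kappa> by (auto simp: field_simps)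
    have 2: "3 * \<kappa> \<le> 2 * (K + q x) - L x" for x
    proof (cases "norm x < r")
      case True
      have "M * \<beta> x \<le> M * 1" using \<beta>(2)[of x] M_nn by (intro mult_left_mono) auto
      then show ?thesis using r1(2)[of x] True r unfolding K_def q_def by (simp add: abs_less_iff)
    next
      case False
      then show ?thesis using \<beta>(4)[of x] M[of x] M[of 0] \<kappa> unfolding K_def q_def by (simp add: abs_le_iff)
    qed
    have "u 0 T \<le> u0 0 - T * g 0 + T\<^sup>2 * (K + q 0)"
    proof (rule heat_solution_le_barrier[OF s \<Omega> sol bu0 T(1) _ g q, of 0 "max R \<delta>"])
      show "0 \<in> \<Omega>" using \<delta> by auto
      show "u0 x = 0 \<and> g x = 0 \<and> q x = 0" if "x \<notin> cball 0 (max R \<delta>)" for x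
        using that R u0(2)[of x] \<beta>(4)[of x] r unfolding q_def by auto
      show "0 \<le> - g x + 2 * t * (K + q x) + frac_const TYPE('n) s / 2 *
         (frac_lap s u0 x - t * frac_lap s g x + t\<^sup>2 * frac_lap s q x)"
        if t: "0 \<le> t" "t \<le> T" and x: "x \<in> \<Omega>" for t x
      proof -
        have "\<bar>t * (\<mu> * frac_lap s q x)\<bar> \<le> T * B"
          unfolding abs_mult[of t] using t B[of x] by (intro mult_mono) auto
        \<comment> \<open>The supersolution inequality splits into the order t^0 part, nonnegative
          because \<open>g\<close> is a minorant, and t times this bracket.\<close>
        then have "0 \<le> 2 * (K + q x) - L x + t * (\<mu> * frac_lap s q x)"
          using 2[of x] T \<kappa> by (simp add: abs_le_iff)
        then have "0 \<le> t * (2 * (K + q x) - L x + t * (\<mu> * frac_lap s q x))" using t by simp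
        moreover have "0 \<le> \<mu> * frac_lap s u0 x - g x" using le[OF x] unfolding \<mu>_def by simp
        ultimately have "0 \<le> (\<mu> * frac_lap s u0 x - g x) + t * (2 * (K + q x) - L x + t * (\<mu> * frac_lap s q x))"
          by (rule add_nonneg_nonneg[rotated])
        also have "\<dots> = - g x + 2 * t * (K + q x) + \<mu> *
         (frac_lap s u0 x - t * frac_lap s g x + t\<^sup>2 * frac_lap s q x)"
          unfolding L_def by (simp add: algebra_simps power2_eq_square)
        finally show ?thesis unfolding \<mu>_def .
      qed
      show "0 \<le> u0 x - t * g x + t\<^sup>2 * (K + q x)" if t: "0 \<le> t" "t \<le> T" and x: "x \<notin> \<Omega>" for t x
      proof -
        have n: "\<delta> \<le> norm x" using x \<delta> by force
        have kq: "0 \<le> K + q x" using \<beta>(4)[of x] n r M[of 0] \<kappa> M_nn unfolding K_def q_def by (simp add: abs_le_iff)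
        have "0 \<le> t\<^sup>2 * (K + q x)" by (intro mult_nonneg_nonneg kq) simp
        moreover have "t * g x \<le> 0" using out[OF x] t by (simp add: mult_nonneg_nonpos)
        ultimately show ?thesis using u0(2)[OF n] by linarith
      qed
    qed
    moreover have "u0 0 = 0" using u0(3)[of 0] by simp
    moreover have "u 0 T = 0" by (rule zero[OF T(1)])
    moreover have "K + q 0 = L 0 / 2 + 2 * \<kappa>" unfolding K_def q_def using \<beta>(3) by simp
    ultimately show ?thesis using g0 T(1) by (simp add: zero_le_mult_iff)
  qed
  have "0 \<le> L 0"
  proof (rule ccontr)
    assume "\<not> 0 \<le> L 0"
    then show False using main[of "- L 0 / 8"] by simp
  qed
  then show ?thesis unfolding L_def using \<mu> by (simp add: zero_le_mult_iff)
qed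

text \<open>Every minorant has a nonnegative \<open>frac_lap\<close> at 0, and the factor -2 at an
  odd point turns this into a nonpositive truncated integral. The minorants converge to the cut-off
  function off the frontier and are uniformly bounded, so the sign passes to the limit.\<close>

lemma truncated_integral_nonpos:
  assumes fr: "negligible (frontier \<Omega>)"
  shows "(LINT h|lborel. indicator (- ball 0 (\<delta> / 2)) h * (indicator \<Omega> h * frac_lap s u0 h) /
    kern s h) \<le> 0"
proof -
  define \<mu> where "\<mu> = frac_const TYPE('n) s / 2"
  have \<mu>: "\<mu> > 0" unfolding \<mu>_def using frac_const_pos[OF s] by simp
  define f where "f x = \<mu> * frac_lap s u0 x" for x
  have "bdd_C11 (frac_lap s u0)" by (rule smooth_frac_lap_bdd_C11[OF u0(1) _ s, of \<delta>]) (use u0(2) in auto)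
  then have f: "bdd_C11 f" unfolding f_def[abs_def] by (rule bdd_C11_cmult)
  then have [measurable]: "f \<in> borel_measurable borel" by (rule bdd_C11_borel)
  obtain M where M: "\<And>x. \<bar>f x\<bar> \<le> M" "M \<ge> 0" using f by (rule bdd_C11E) blast
  have f_odd: "f (- x) = - f x" for x unfolding f_def using frac_lap_odd[of u0 s] u0(3) by simp
  have [measurable]: "\<Omega> \<in> sets borel" using \<Omega> by simp
  obtain R0 where R0: "\<Omega> \<subseteq> cball 0 R0" using \<Omega>(2) by (auto simp: bounded_iff subset_iff)
  have "\<Omega> \<noteq> UNIV" using \<Omega>(2) not_bounded_UNIV by metis
  then have ne: "- \<Omega> \<noteq> {}" by auto
  have ne': "closure \<Omega> \<noteq> {}" using \<delta> by force
  \<comment> \<open>These compact sets exhaust \<Omega>. The ball of radius \<delta>/2 is added so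
    that every minorant agrees with the odd function \<open>f\<close> near the origin.\<close>
  define Kn where "Kn n = {x. 1 / (real n + 1) \<le> infdist x (- \<Omega>)} \<union> cball 0 (\<delta> / 2)" for n
  define Vn where "Vn n = {x. infdist x (closure \<Omega>) < 1 / (real n + 1)}" for n
  have KO: "Kn n \<subseteq> \<Omega>" for n
  proof
    fix x assume "x \<in> Kn n"
    then consider "1 / (real n + 1) \<le> infdist x (- \<Omega>)" | "x \<in> cball 0 (\<delta> / 2)" unfolding Kn_def by blast
    then show "x \<in> \<Omega>"
    proof cases
      case 1
      then have "infdist x (- \<Omega>) \<noteq> 0" by (metis add_nonneg_pos less_le_not_le of_nat_0_le_iff zero_less_divide_1_iff zero_less_one)
      then show ?thesis using infdist_zero[of x "- \<Omega>"] by blast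
    next
      case 2 then show ?thesis using \<delta> by (auto intro!: subsetD[OF \<delta>(2)])
    qed
  qed
  have Kc: "compact (Kn n)" for n
  proof -
    have "closed (Kn n)" unfolding Kn_def
      by (intro closed_Un closed_Collect_le continuous_intros) auto
    moreover have "bounded (Kn n)" using \<Omega>(2) KO by (rule bounded_subset)
    ultimately show ?thesis by (simp add: compact_eq_bounded_closed)
  qed
  have Vo: "open (Vn n)" for n unfolding Vn_def by (intro open_Collect_less continuous_intros)
  have cO: "compact (closure \<Omega>)" using \<Omega>(2) by simp
  have OV: "closure \<Omega> \<subseteq> Vn n" for n unfolding Vn_def by auto
  have "\<exists>\<eta>. bdd_C11 \<eta> \<and> (\<forall>x. 0 \<le> \<eta> x \<and> \<eta> x \<le> 1 \<and> (x \<in> Kn n \<longrightarrow> \<eta> x = 1) \<and> (x \<notin> \<Omega> \<longrightarrow> \<eta> x = 0))" for n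
    using bdd_C11_cutoff[OF Kc \<Omega>(1) KO, of n] by metis
  then obtain \<eta> where \<eta>: "\<And>n. bdd_C11 (\<eta> n)" "\<And>n x. 0 \<le> \<eta> n x" "\<And>n x. \<eta> n x \<le> 1"
    "\<And>n x. x \<in> Kn n \<Longrightarrow> \<eta> n x = 1" "\<And>n x. x \<notin> \<Omega> \<Longrightarrow> \<eta> n x = 0" by metis
  have "\<exists>\<theta>. bdd_C11 \<theta> \<and> (\<forall>x. 0 \<le> \<theta> x \<and> \<theta> x \<le> 1 \<and> (x \<in> closure \<Omega> \<longrightarrow> \<theta> x = 1) \<and> (x \<notin> Vn n \<longrightarrow> \<theta> x = 0))" for n
    using bdd_C11_cutoff[OF cO Vo OV, of n] by metis
  then obtain \<theta> where \<theta>: "\<And>n. bdd_C11 (\<theta> n)" "\<And>n x. 0 \<le> \<theta> n x" "\<And>n x. \<theta> n x \<le> 1"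
    "\<And>n x. x \<in> closure \<Omega> \<Longrightarrow> \<theta> n x = 1" "\<And>n x. x \<notin> Vn n \<Longrightarrow> \<theta> n x = 0" by metis
  \<comment> \<open>On the closure of \<Omega> this is a convex combination of \<open>f\<close> and
    its lower bound -M; outside \<Omega> it equals -M \<theta>, which is nonpositive and cut off
    within distance 1 / (n + 1).\<close>
  define g where "g n x = \<eta> n x * f x - M * (\<theta> n x - \<eta> n x)" for n x
  have g: "bdd_C11 (g n)" for n
    unfolding g_def[abs_def] by (intro bdd_C11_diff bdd_C11_mult bdd_C11_cmult \<eta> \<theta> f)
  then have [measurable]: "g n \<in> borel_measurable borel" for n by (rule bdd_C11_borel)
  have gb: "\<bar>g n x\<bar> \<le> 2 * M" for n x
  proof -
    have "\<bar>\<eta> n x * f x\<bar> \<le> 1 * M" unfolding abs_mult using \<eta>(2,3)[of n x] M by (intro mult_mono) auto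
    moreover have "\<bar>M * (\<theta> n x - \<eta> n x)\<bar> \<le> M * 1"
      unfolding abs_mult using \<eta>(2,3)[of n x] \<theta>(2,3)[of n x] M by (intro mult_mono) auto
    ultimately show ?thesis unfolding g_def by linarith
  qed
  have gsmall: "g n x = f x" if "norm x < \<delta> / 2" for n x
  proof -
    have "x \<in> Kn n" using that unfolding Kn_def by simp
    moreover then have "x \<in> closure \<Omega>" using KO closure_subset by blast
    ultimately show ?thesis unfolding g_def using \<eta>(4) \<theta>(4) by simp
  qed
  have le0: "(LINT h|lborel. indicator (- ball 0 (\<delta> / 2)) h * g n h / kern s h) \<le> 0" for n
  proof -
    have "0 \<le> frac_lap s (g n) 0"
    proof (rule frac_lap_minorant_nonneg[OF g, of "R0 + 1"])
      show "g n x = 0" if x: "R0 + 1 < norm x" for x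
      proof -
        have "x \<notin> Vn n"
        proof
          assume "x \<in> Vn n"
          then have "infdist x (closure \<Omega>) < 1"
            unfolding Vn_def by (auto intro: less_le_trans simp: divide_le_eq)
          obtain y where y: "y \<in> closure \<Omega>" "infdist x (closure \<Omega>) = dist x y"
            using infdist_attains_inf[OF closed_closure ne'] by metis
          have "closure \<Omega> \<subseteq> cball 0 R0" using R0 by (simp add: closure_minimal)
          then have "norm y \<le> R0" using y(1) by auto
          moreover have "norm x \<le> norm y + dist x y" using norm_triangle_ineq2[of x y] by (simp add: dist_norm)
          ultimately show False using y(2) \<open>infdist x (closure \<Omega>) < 1\<close> x by linarith
        qed
        moreover have "x \<notin> \<Omega>" using x R0 by force
        ultimately show ?thesis unfolding g_def using \<eta>(5) \<theta>(5) by simp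
      qed
      show "g n 0 = 0" using gsmall[of 0 n] \<delta> f_odd[of 0] by simp
      show "g n x \<le> frac_const TYPE('n) s / 2 * frac_lap s u0 x" if x: "x \<in> \<Omega>" for x
      proof -
        \<comment> \<open>Where \<theta> = 1 this product is exactly f - g.\<close>
        have "0 \<le> (1 - \<eta> n x) * (f x + M)"
          using \<eta>(3)[of n x] M(1)[of x] by (intro mult_nonneg_nonneg) (auto simp: abs_le_iff)
        moreover have "\<theta> n x = 1" using x closure_subset \<theta>(4) by blast
        ultimately have "g n x \<le> f x" unfolding g_def by (simp add: algebra_simps)
        then show ?thesis unfolding f_def \<mu>_def .
      qed
      show "g n x \<le> 0" if x: "x \<notin> \<Omega>" for x
        unfolding g_def using \<eta>(5)[OF x] \<theta>(2)[of n x] M(2) by simp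
    qed
    also have "frac_lap s (g n) 0 = - 2 * (LINT h|lborel. indicator (- ball 0 (\<delta> / 2)) h * g n h / kern s h)"
      by (rule frac_lap_at_odd_point[OF s g]) (use \<delta> gsmall f_odd in auto)
    finally show ?thesis by simp
  qed
  have inv0: "(\<lambda>n. 1 / (real n + 1)) \<longlonglongrightarrow> 0"
    using LIMSEQ_inverse_real_of_nat by (simp add: inverse_eq_divide add.commute)
  have frae: "AE h in lborel. h \<notin> frontier \<Omega>"
  proof -
    have "frontier \<Omega> \<in> null_sets lborel"
      using fr by (auto simp: negligible_iff_null_sets null_sets_completion_iff)
    then show ?thesis by (rule AE_not_in)
  qed
  \<comment> \<open>Off the frontier the sequence is eventually constant: a point of \<Omega> ends
    up in \<open>Kn n\<close>, a point outside the closure ends up outside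
    \<open>Vn n\<close>.\<close>
  have ev: "\<forall>\<^sub>F n in sequentially. g n h = indicator \<Omega> h * f h" if h: "h \<notin> frontier \<Omega>" for h
  proof (cases "h \<in> \<Omega>")
    case True
    have "infdist h (- \<Omega>) \<noteq> 0"
      using in_closed_iff_infdist_zero[of "- \<Omega>" h] \<Omega>(1) ne True by auto
    then have "infdist h (- \<Omega>) > 0" by (simp add: infdist_nonneg order_less_le)
    then have "\<forall>\<^sub>F n in sequentially. 1 / (real n + 1) < infdist h (- \<Omega>)"
      by (rule order_tendstoD(2)[OF inv0])
    then show ?thesis
    proof eventually_elim
      case (elim n)
      then have "h \<in> Kn n" unfolding Kn_def by simp
      moreover have "h \<in> closure \<Omega>" using True closure_subset by blast
      ultimately show ?case unfolding g_def using \<eta>(4) \<theta>(4) True by simp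
    qed
  next
    case False
    then have "h \<notin> closure \<Omega>" using h \<Omega>(1) by (auto simp: frontier_def interior_open)
    then have "infdist h (closure \<Omega>) \<noteq> 0"
      using in_closed_iff_infdist_zero[of "closure \<Omega>" h] ne' by auto
    then have "infdist h (closure \<Omega>) > 0" by (simp add: infdist_nonneg order_less_le)
    then have "\<forall>\<^sub>F n in sequentially. 1 / (real n + 1) < infdist h (closure \<Omega>)"
      by (rule order_tendstoD(2)[OF inv0])
    then show ?thesis
    proof eventually_elim
      case (elim n)
      then have "h \<notin> Vn n" unfolding Vn_def by simp
      then show ?case unfolding g_def using \<eta>(5) \<theta>(5) False by simp
    qed
  qed
  have lim: "(\<lambda>n. LINT h|lborel. indicator (- ball 0 (\<delta> / 2)) h * g n h / kern s h)
     \<longlonglongrightarrow> (LINT h|lborel. indicator (- ball 0 (\<delta> / 2)) h * (indicator \<Omega> h * f h) / kern s h)"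
  proof (rule integral_dominated_convergence)
    show "integrable lborel (\<lambda>h::real^'n. (2 * M * indicator (- ball 0 (\<delta> / 2)) h) / kern s h)"
      by (rule integrable_indicator_kernel[OF s, of _ "2 * M" "\<delta> / 2"]) (use \<delta> M(2) in \<open>auto simp: indicator_def\<close>)
    show "AE h in lborel. (\<lambda>n. indicator (- ball 0 (\<delta> / 2)) h * g n h / kern s h)
       \<longlonglongrightarrow> indicator (- ball 0 (\<delta> / 2)) h * (indicator \<Omega> h * f h) / kern s h"
      using frae
    proof eventually_elim
      case (elim h)
      show ?case
        by (rule tendsto_eventually) (use ev[OF elim] in \<open>auto elim!: eventually_mono\<close>)
    qed
    show "AE h in lborel. norm (indicator (- ball 0 (\<delta> / 2)) h * g n h / kern s h)
       \<le> 2 * M * indicator (- ball 0 (\<delta> / 2)) h / kern s h" for n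
      using gb by (intro AE_I2) (auto simp: indicator_def abs_divide intro!: divide_right_mono)
  qed measurable
  have "(LINT h|lborel. indicator (- ball 0 (\<delta> / 2)) h * (indicator \<Omega> h * f h) / kern s h) \<le> 0"
    by (rule LIMSEQ_le_const2[OF lim]) (use le0 in auto)
  also have "(\<lambda>h. indicator (- ball 0 (\<delta> / 2)) h * (indicator \<Omega> h * f h) / kern s h) =
    (\<lambda>h. \<mu> * (indicator (- ball 0 (\<delta> / 2)) h * (indicator \<Omega> h * frac_lap s u0 h) / kern s h))"
    unfolding f_def by (simp add: mult_ac)
  finally show ?thesis using \<mu> by (simp only: integral_mult_right_zero) (simp add: mult_le_0_iff)
qed

end

section \<open>Odd initial data and conclusion\<close>

lemma Ck_on_lincomb:
  fixes f g :: "real ^ 'n \<Rightarrow> real"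
  assumes "Ck_on k UNIV f" "Ck_on k UNIV g"
  shows "Ck_on k UNIV (\<lambda>x. c * f x + d * g x)"
  using assms
proof (induction k arbitrary: f g)
  case 0 then show ?case by (auto intro!: continuous_intros)
next
  case (Suc k)
  have df: "(f has_derivative frechet_derivative f (at x)) (at x)" "(g has_derivative frechet_derivative g (at x)) (at x)" for x
    using Suc.prems by (auto simp: frechet_derivative_works[symmetric])
  have d: "((\<lambda>x. c * f x + d * g x) has_derivative
     (\<lambda>v. c * frechet_derivative f (at x) v + d * frechet_derivative g (at x) v)) (at x)" for x
    by (intro has_derivative_add has_derivative_mult_right df)
  have "frechet_derivative (\<lambda>x. c * f x + d * g x) (at x) =
     (\<lambda>v. c * frechet_derivative f (at x) v + d * frechet_derivative g (at x) v)" for x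
    using frechet_derivative_at[OF d[of x]] by simp
  then show ?case
    using Suc.IH Suc.prems differentiableI[OF d] by simp
qed

lemma smooth_on_lincomb:
  "smooth_on UNIV f \<Longrightarrow> smooth_on UNIV g \<Longrightarrow> smooth_on UNIV (\<lambda>x. c * f x + d * g x)"
  unfolding smooth_on_def using Ck_on_lincomb by blast

text \<open>Oddness is prescribed only on the ball, but the support lies inside it, so it extends to
  the whole space.\<close>

lemma odd_dataE:
  fixes u0 :: "real ^ 'n \<Rightarrow> real"
  assumes "u0 \<in> odd_data \<Omega> \<delta>"
  obtains "smooth_on UNIV u0" "\<And>x. \<delta> \<le> norm x \<Longrightarrow> u0 x = 0" "\<And>x. u0 (- x) = - u0 x"
proof
  show "smooth_on UNIV u0" using assms unfolding odd_data_def test_functions_def by blast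
  show z: "u0 x = 0" if "\<delta> \<le> norm x" for x
  proof (rule ccontr)
    assume "u0 x \<noteq> 0"
    then have "x \<in> supp u0" unfolding supp_def using closure_subset by fastforce
    moreover have "supp u0 \<subseteq> ball 0 \<delta>" using assms unfolding odd_data_def by blast
    ultimately show False using that by auto
  qed
  show "u0 (- x) = - u0 x" for x
  proof (cases "norm x < \<delta>")
    case True
    then have "x \<in> ball 0 \<delta>" by simp
    then have "u0 x = - u0 (- x)" using assms unfolding odd_data_def by blast
    then show ?thesis by linarith
  next
    case False then show ?thesis using z[of x] z[of "- x"] by simp
  qed
qed

lemma odd_data_uminus:
  assumes "u0 \<in> odd_data \<Omega> \<delta>"
  shows "(\<lambda>x. - u0 x) \<in> odd_data \<Omega> \<delta>"
proof -
  have "smooth_on UNIV u0" using assms unfolding odd_data_def test_functions_def by blast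
  from smooth_on_lincomb[OF this this, of "- 1" 0] have "smooth_on UNIV (\<lambda>x. - u0 x)" by simp
  moreover have "supp (\<lambda>x. - u0 x) = supp u0" unfolding supp_def by simp
  moreover have "- u0 x = - (- u0 (- x))" if "x \<in> ball 0 \<delta>" for x
  proof -
    have "u0 x = - u0 (- x)" using assms that unfolding odd_data_def by blast
    then show ?thesis by linarith
  qed
  moreover have "compact (supp u0)" "supp u0 \<subseteq> \<Omega>" "supp u0 \<subseteq> ball 0 \<delta>"
    using assms unfolding odd_data_def test_functions_def by blast+
  ultimately show ?thesis unfolding odd_data_def test_functions_def mem_Collect_eq by metis
qed

text \<open>Antisymmetrised bumps are the only initial data needed to reach every point of the
  ball.\<close>

lemma bump_odd_data:
  fixes z :: "real ^ 'n"
  assumes r: "r > 0" "norm z + r < \<delta>" and \<Omega>: "ball 0 \<delta> \<subseteq> \<Omega>"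
  shows "(\<lambda>x. bump r z x - bump r (- z) x) \<in> odd_data \<Omega> \<delta>"
    and "\<And>x. norm z + r < norm x \<Longrightarrow> bump r z x - bump r (- z) x = 0"
proof -
  let ?f = "\<lambda>x. bump r z x - bump r (- z) x"
  show out: "?f x = 0" if "norm z + r < norm x" for x
  proof -
    have "r \<le> norm (x - z)" "r \<le> norm (x - - z)"
      using that norm_triangle_ineq2[of x z] norm_triangle_ineq2[of x "- z"] by auto
    then show ?thesis using bump_outside[OF r(1), of x z] bump_outside[OF r(1), of x "- z"] by simp
  qed
  have "smooth_on UNIV ?f"
    using smooth_on_lincomb[OF bump_smooth bump_smooth, of 1 r z "- 1" r "- z"] by simp
  moreover have sub: "supp ?f \<subseteq> cball 0 (norm z + r)"
    unfolding supp_def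
  proof (rule closure_minimal)
    show "{x. ?f x \<noteq> 0} \<subseteq> cball 0 (norm z + r)" using out by force
  qed simp
  moreover have "compact (supp ?f)"
    using bounded_subset[OF bounded_cball sub] by (simp add: compact_eq_bounded_closed supp_def)
  moreover have "cball 0 (norm z + r) \<subseteq> ball 0 \<delta>" using r by auto
  ultimately show "?f \<in> odd_data \<Omega> \<delta>"
    using \<Omega> by (auto simp: odd_data_def test_functions_def bump_uminus)
qed

text \<open>At such a point \<open>u0\<close> is 0 in a neighbourhood, so both halves of the
  symmetrised integral converge separately and agree after reflection.\<close>

lemma frac_lap_outside_support:
  fixes u0 :: "real ^ 'n \<Rightarrow> real"
  assumes s: "0 < s" "s < 1" and u0: "bdd_C11 u0" "\<And>x. \<rho> < norm x \<Longrightarrow> u0 x = 0" and y: "\<rho> < norm y"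
  shows "frac_lap s u0 y = - 2 * (LINT z|lborel. u0 z / kern s (z - y))"
proof -
  let ?N = "\<lambda>h::real^'n. kern s h"
  obtain C where C: "\<And>x. \<bar>u0 x\<bar> \<le> C" using u0(1) by (rule bdd_C11E) blast
  have [measurable]: "u0 \<in> borel_measurable borel" using u0(1) by (rule bdd_C11_borel)
  have i: "integrable lborel (\<lambda>h. u0 (y + h) / ?N h)"
  proof (rule integrable_indicator_kernel[OF s])
    show "u0 (y + h) = 0" if "norm h < norm y - \<rho>" for h
      using that norm_triangle_ineq2[of y "- h"] by (intro u0(2)) simp
  qed (use C y in auto)
  have "frac_lap s u0 y = (LINT h|lborel. - (u0 (y + h) / ?N h) - u0 (y + - h) / ?N (- h))"
    unfolding frac_lap_def using u0(2)[OF y] by (simp add: diff_divide_distrib)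
  also have "\<dots> = - (LINT h|lborel. u0 (y + h) / ?N h) - (LINT h|lborel. u0 (y + - h) / ?N (- h))"
    using i integrable_lborel_uminus[OF i] by simp
  also have "(LINT h|lborel. u0 (y + - h) / ?N (- h)) = (LINT h|lborel. u0 (y + h) / ?N h)"
    by (rule integral_lborel_uminus)
  also have "(LINT h|lborel. u0 (y + h) / ?N h) = (LINT z|lborel. u0 z / ?N (z - y))"
    using integral_lborel_shift[of "\<lambda>z. u0 z / ?N (z - y)" y] by simp
  finally show ?thesis by simp
qed

lemma (in annulus_density) potential_continuous:
  assumes \<kappa>: "continuous_on (- {0}) \<kappa>"
  shows "continuous_on (ball 0 \<delta>) (\<lambda>z. LINT y|lborel. w y * \<kappa> (z - y))"
proof (rule continuous_at_imp_continuous_on, rule ballI)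
  fix z :: "real ^ 'n" assume z: "z \<in> ball 0 \<delta>"
  define r where "r = (\<delta> - norm z) / 2"
  have r: "r > 0" using z unfolding r_def by simp
  define A where "A = cball 0 (\<delta> + R) - ball (0 :: real ^ 'n) r"
  have "compact A" unfolding A_def by (intro compact_diff compact_cball open_ball)
  moreover have "continuous_on A \<kappa>" by (rule continuous_on_subset[OF \<kappa>]) (use r in \<open>auto simp: A_def\<close>)
  ultimately have "bounded (\<kappa> ` A)" by (intro compact_imp_bounded compact_continuous_image)
  then obtain B where B: "\<And>v. v \<in> A \<Longrightarrow> \<bar>\<kappa> v\<bar> \<le> B" by (auto simp: bounded_iff)
  show "isCont (\<lambda>z. LINT y|lborel. w y * \<kappa> (z - y)) z"
    unfolding continuous_at_sequentially comp_def
  proof (intro allI impI)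
    fix X :: "nat \<Rightarrow> real ^ 'n" assume X: "X \<longlonglongrightarrow> z"
    have "\<forall>\<^sub>F n in sequentially. dist (X n) z < r" by (rule tendstoD[OF X r])
    then obtain n0 where n0: "\<And>n. n \<ge> n0 \<Longrightarrow> dist (X n) z < r" by (auto simp: eventually_sequentially)
    define Y where "Y n = X (n + n0)" for n
    have Y: "norm (Y n) < \<delta> - r" for n
      using n0[of "n + n0"] norm_triangle_ineq2[of "Y n" z] unfolding Y_def r_def by (simp add: dist_norm field_simps)
    have Yz: "Y \<longlonglongrightarrow> z" unfolding Y_def by (rule LIMSEQ_ignore_initial_segment[OF X])
    have "(\<lambda>n. LINT y|lborel. w y * \<kappa> (Y n - y)) \<longlonglongrightarrow> (LINT y|lborel. w y * \<kappa> (z - y))"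
    proof (rule integral_dominated_convergence[where w = "\<lambda>y. \<bar>w y\<bar> * B"])
      show "integrable lborel (\<lambda>y. \<bar>w y\<bar> * B)" using integrable_w by simp
      show "(\<lambda>y. w y * \<kappa> (Y n - y)) \<in> borel_measurable lborel" for n
        by (rule borel_measurable_integrable, rule integrable_kernel[OF \<kappa>]) (use Y[of n] r in simp)
      show "(\<lambda>y. w y * \<kappa> (z - y)) \<in> borel_measurable lborel"
        by (rule borel_measurable_integrable, rule integrable_kernel[OF \<kappa> z])
      have "(\<lambda>n. w y * \<kappa> (Y n - y)) \<longlonglongrightarrow> w y * \<kappa> (z - y)" for y
      proof (cases "y \<in> K")
        case True
        have "isCont \<kappa> (z - y)"
          using \<kappa> K_minus_ne[OF True z] by (simp add: continuous_on_eq_continuous_at open_Compl)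
        then show ?thesis by (intro tendsto_intros isCont_tendsto_compose[of _ \<kappa>] Yz)
      next
        case False then show ?thesis using w_K by simp
      qed
      then show "AE y in lborel. (\<lambda>n. w y * \<kappa> (Y n - y)) \<longlonglongrightarrow> w y * \<kappa> (z - y)" by simp
      show "AE y in lborel. norm (w y * \<kappa> (Y n - y)) \<le> \<bar>w y\<bar> * B" for n
      proof (rule AE_I2)
        fix y
        show "norm (w y * \<kappa> (Y n - y)) \<le> \<bar>w y\<bar> * B"
        proof (cases "y \<in> K")
          case True
          then have y: "norm y \<le> R" "\<delta> \<le> norm y" by (auto simp: K_def)
          have "norm (Y n - y) \<le> norm (Y n) + norm y" by (rule norm_triangle_ineq4)
          moreover have "norm y - norm (Y n) \<le> norm (Y n - y)"
            using norm_triangle_ineq2[of y "Y n"] by (simp add: norm_minus_commute)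
          ultimately have "Y n - y \<in> A" using Y[of n] y r unfolding A_def by auto
          then show ?thesis unfolding real_norm_def abs_mult by (intro mult_left_mono B) auto
        next
          case False then show ?thesis using w_K by simp
        qed
      qed
    qed
    then show "(\<lambda>n. LINT y|lborel. w y * \<kappa> (X n - y)) \<longlonglongrightarrow> (LINT y|lborel. w y * \<kappa> (z - y))"
      unfolding Y_def by (rule LIMSEQ_offset)
  qed
qed

text \<open>The fundamental lemma of the calculus of variations for odd functions: the two halves of
  an antisymmetrised bump contribute equally against an odd \<open>F\<close>, so the test reduces to
  a single nonnegative bump. Oddness also reduces negative values of \<open>F\<close> to positive
  ones.\<close>

lemma odd_eq_0_if_annihilates_odd_bumps:
  fixes F :: "real ^ 'n \<Rightarrow> real"
  assumes cont: "continuous_on (ball 0 \<delta>) F" and odd: "\<And>z. F (- z) = - F z"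
    and zero: "\<And>r z. r > 0 \<Longrightarrow> norm z + r < \<delta> \<Longrightarrow>
      (LINT x|lborel. (bump r z x - bump r (- z) x) * F x) = 0"
    and z: "z \<in> ball 0 \<delta>"
  shows "F z = 0"
proof -
  have "\<not> 0 < F z" if z: "z \<in> ball 0 \<delta>" for z
  proof
    assume F: "0 < F z"
    have "isCont F z" using cont z by (simp add: continuous_on_eq_continuous_at)
    then obtain d where d: "d > 0" "\<And>x. dist x z < d \<Longrightarrow> dist (F x) (F z) < F z"
      using F unfolding continuous_at_eps_delta by blast
    \<comment> \<open>Small enough for \<open>F\<close> to be positive on the support of the bump
      and for that support to lie inside the ball.\<close>
    define r where "r = min d ((\<delta> - norm z) / 2)"
    have r: "r > 0" "norm z + r < \<delta>" "r \<le> d"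
      using d z unfolding r_def by (auto simp: min_def field_simps)
    have Fp: "0 < F x" if "norm (x - z) < r" for x
      using d(2)[of x] that r by (simp add: dist_norm abs_if split: if_splits)
    have Fb: "\<bar>F x\<bar> \<le> 2 * F z" if "norm (x - z) < r" for x
      using d(2)[of x] that r F by (simp add: dist_norm abs_if split: if_splits)
    define b where "b = bump r z"
    have b0: "0 \<le> b x" for x unfolding b_def by (rule bump_nonneg[OF r(1)])
    have bz: "b x = 0" if "r \<le> norm (x - z)" for x unfolding b_def by (rule bump_outside[OF r(1) that])
    have [measurable]: "b \<in> borel_measurable borel" unfolding b_def by (rule bdd_C11_borel[OF bump_bdd_C11[OF r(1)]])
    have bF: "0 \<le> b x * F x" for x
      using b0[of x] bz[of x] Fp[of x] by (cases "norm (x - z) < r") auto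
    have bFm: "(\<lambda>x. b x * F x) \<in> borel_measurable borel"
    proof -
      have "(\<lambda>x. indicator (ball 0 \<delta>) x *\<^sub>R F x) \<in> borel_measurable borel"
        by (rule borel_measurable_continuous_on_indicator[OF _ cont]) auto
      then have "(\<lambda>x. b x * (indicator (ball 0 \<delta>) x *\<^sub>R F x)) \<in> borel_measurable borel" by measurable
      also have "(\<lambda>x. b x * (indicator (ball 0 \<delta>) x *\<^sub>R F x)) = (\<lambda>x. b x * F x)"
      proof
        fix x
        have "b x = 0" if "\<delta> \<le> norm x"
          using that r norm_triangle_ineq2[of x z] by (intro bz) linarith
        then show "b x * (indicator (ball 0 \<delta>) x *\<^sub>R F x) = b x * F x"
          by (cases "\<delta> \<le> norm x") auto
      qed
      finally show ?thesis .
    qed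
    have bi: "integrable lborel (\<lambda>x. b x * F x)"
    proof (rule integrable_bounded_support[OF bFm _ bounded_ball])
      show "b x * F x = 0" if "x \<notin> ball z r" for x
        using bz[of x] that by (simp add: dist_norm norm_minus_commute)
      show "\<bar>b x * F x\<bar> \<le> 2 * F z" for x
      proof (cases "norm (x - z) < r")
        case True
        have "\<bar>b x\<bar> * \<bar>F x\<bar> \<le> 1 * (2 * F z)"
          using bump_le_1[OF r(1), of z x] b0[of x] Fb[OF True] unfolding b_def[symmetric] by (intro mult_mono) auto
        then show ?thesis by (simp add: abs_mult)
      next
        case False then show ?thesis using bz[of x] F by simp
      qed
    qed
    have eq: "(bump r z x - bump r (- z) x) * F x = b x * F x + b (- x) * F (- x)" for x
      unfolding b_def bump_uminus odd by (simp add: left_diff_distrib)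
    have "0 = (LINT x|lborel. b x * F x + b (- x) * F (- x))"
      using zero[OF r(1,2)] unfolding eq by simp
    also have "\<dots> = (LINT x|lborel. b x * F x) + (LINT x|lborel. b (- x) * F (- x))"
      using bi integrable_lborel_uminus[OF bi] by (intro Bochner_Integration.integral_add)
    also have "(LINT x|lborel. b (- x) * F (- x)) = (LINT x|lborel. b x * F x)"
      by (rule integral_lborel_uminus)
    finally have "(LINT x|lborel. b x * F x) = 0" by simp
    then have "AE x in lborel. b x * F x = 0"
      using integral_nonneg_eq_0_iff_AE[OF bi] bF by simp
    then have "AE x in lborel. x \<in> ball z r \<longrightarrow> b x \<le> 0"
    proof eventually_elim
      case (elim x)
      show ?case using elim Fp[of x] by (auto simp: dist_norm norm_minus_commute)
    qed
    then have "b z \<le> 0"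
      by (rule nonpos_if_AE_nonpos)
         (use r in \<open>auto simp: b_def intro: continuous_on_subset[OF bdd_C11_continuous[OF bump_bdd_C11]]\<close>)
    then show False unfolding b_def using bump_center[OF r(1), of z] by simp
  qed
  from this[OF z] this[of "- z"] z show ?thesis by (simp add: odd)
qed

text \<open>Argued by contradiction: on the open set \<open>V\<close> of points of \<Omega> with
  reflection outside \<Omega> the odd density is strictly positive, and a continuous weight positive
  exactly on \<open>V\<close> detects this.\<close>

lemma not_vanishing_if_not_centrosymmetric:
  fixes \<Omega> :: "(real ^ 'n) set"
    and u :: "(real ^ 'n \<Rightarrow> real) \<Rightarrow> real ^ 'n \<Rightarrow> real \<Rightarrow> real"
  assumes s: "0 < s" "s < 1" and \<Omega>: "open \<Omega>" "bounded \<Omega>" "C11_boundary \<Omega>"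
    and ball: "0 < \<delta>" "ball 0 \<delta> \<subseteq> \<Omega>"
    and sol: "\<And>u0. u0 \<in> odd_data \<Omega> \<delta> \<Longrightarrow> frac_heat_solution s \<Omega> u0 (u u0)"
    and zero: "\<And>u0 t. u0 \<in> odd_data \<Omega> \<delta> \<Longrightarrow> t > 0 \<Longrightarrow> u u0 0 t = 0"
  shows "centrosymmetric \<Omega>"
  unfolding centrosymmetric_def
proof (rule allI, rule impI, rule ccontr)
  fix x assume "x \<in> \<Omega>" "- x \<notin> \<Omega>"
  then obtain V where V: "open V" "V \<noteq> {}" "V \<subseteq> \<Omega>" and VO: "\<And>y. y \<in> V \<Longrightarrow> - y \<notin> \<Omega>"
    using open_reflected_gap[OF \<Omega>(3,1)] by metis
  define a where "a = real CARD('n) + 2 * s"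
  define k where "k v = 1 / norm v powr a" for v :: "real ^ 'n"
  have k_nn: "k v \<ge> 0" and k_minus: "k (- v) = k v" for v unfolding k_def by auto
  have [measurable]: "k \<in> borel_measurable borel" unfolding k_def by measurable
  have [measurable]: "\<Omega> \<in> sets borel" using \<Omega> by simp
  \<comment> \<open>The weight of \<open>truncated_integral_nonpos\<close>; cutting out the ball of
    radius \<delta>/2 makes it bounded.\<close>
  define m where "m y = indicator (- ball 0 (\<delta> / 2)) y * indicator \<Omega> y * k y" for y
  have [measurable]: "m \<in> borel_measurable borel" unfolding m_def by measurable
  have m_nn: "m y \<ge> 0" for y unfolding m_def using k_nn by simp
  define W where "W = (\<delta> / 2) powr (- a)"
  have m_le: "m y \<le> W" for y
  proof (cases "norm y < \<delta> / 2")
    case True then show ?thesis unfolding m_def W_def by simp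
  next
    case False
    then have "norm y powr (- a) \<le> (\<delta> / 2) powr (- a)"
      using ball s unfolding a_def by (intro powr_mono2') auto
    then have "k y \<le> W" unfolding k_def W_def by (simp add: powr_minus inverse_eq_divide)
    then show ?thesis unfolding m_def using k_nn[of y] by (auto simp: indicator_def W_def)
  qed
  have mi: "integrable lborel m"
    by (rule integrable_bounded_support[OF _ _ \<Omega>(2), of _ W]) (use m_le m_nn in \<open>auto simp: m_def\<close>)
  have int0: "(LINT y|lborel. m y * frac_lap s u0 y) = 0" if A: "u0 \<in> odd_data \<Omega> \<delta>" for u0
  proof -
    \<comment> \<open>Only an upper bound is available for each datum; the reverse inequality comes
      from the negated datum.\<close>
    have le: "(LINT y|lborel. m y * frac_lap s v y) \<le> 0" if v: "v \<in> odd_data \<Omega> \<delta>" for v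
    proof -
      have "(LINT y|lborel. indicator (- ball 0 (\<delta> / 2)) y * (indicator \<Omega> y * frac_lap s v y) /
          kern s y) \<le> 0"
        by (rule odd_dataE[OF v], rule truncated_integral_nonpos[OF s \<Omega>(1,2) ball sol[OF v]])
           (use zero[OF v] negligible_frontier_C11[OF \<Omega>(3,1)] in auto)
      then show ?thesis unfolding m_def k_def a_def by (simp add: mult.assoc)
    qed
    have "(LINT y|lborel. m y * frac_lap s (\<lambda>x. - u0 x) y) = - (LINT y|lborel. m y * frac_lap s u0 y)"
      using frac_lap_cmult[of s "- 1" u0] by simp
    then show ?thesis using le[OF A] le[OF odd_data_uminus[OF A]] by simp
  qed
  \<comment> \<open>The fractional Laplacian of odd data is odd, so against it the integral of
    \<open>w\<close> is twice that of \<open>m\<close>, which vanishes.\<close>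
  define w where "w y = m y - m (- y)" for y
  have w_odd: "w (- y) = - w y" for y unfolding w_def by simp
  obtain R where R: "\<And>y. y \<in> \<Omega> \<Longrightarrow> norm y \<le> R" using \<Omega>(2) by (auto simp: bounded_iff)
  interpret annulus_density w \<delta> R W
  proof
    show "w \<in> borel_measurable borel" unfolding w_def by measurable
    show "\<bar>w y\<bar> \<le> W" for y
      using m_nn[of y] m_nn[of "- y"] m_le[of y] m_le[of "- y"] unfolding w_def by (simp add: abs_le_iff)
    \<comment> \<open>Although \<open>m\<close> is cut off at radius \<delta>/2 only,
      \<open>w\<close> vanishes on the whole ball: there y and -y both lie in \<Omega> and the two
      terms cancel.\<close>
    show "w y = 0" if "norm y < \<delta>" for y
    proof -
      have "y \<in> \<Omega>" "- y \<in> \<Omega>" using that ball(2) by auto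
      then show ?thesis unfolding w_def m_def by (simp add: k_minus indicator_def)
    qed
    show "w y = 0" if "R < norm y" for y
      using R[of y] R[of "- y"] that unfolding w_def m_def by (auto simp: indicator_def)
  qed (rule ball)
  have Qk: "Q a v = k v" for v
  proof -
    have "(v \<bullet> v) powr (- (a / 2)) = (norm v powr 2) powr (- (a / 2))"
      by (cases "v = 0") (simp_all add: powr_numeral power2_norm_eq_inner)
    also have "\<dots> = norm v powr (- a)" by (simp only: powr_powr) simp
    finally show ?thesis unfolding Q_def k_def by (simp add: powr_minus inverse_eq_divide)
  qed
  define F where "F z = (LINT y|lborel. w y * k (z - y))" for z
  have F_odd: "F (- z) = - F z" for z
  proof -
    have "F (- z) = (LINT y|lborel. w (- y) * k (- z - - y))"
      unfolding F_def by (rule integral_lborel_uminus[symmetric])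
    also have "\<dots> = (LINT y|lborel. - (w y * k (z - y)))"
      using k_minus[of "z - _"] by (simp add: w_odd)
    finally show ?thesis unfolding F_def by simp
  qed
  have F_cont: "continuous_on (ball 0 \<delta>) F"
    using potential_continuous[OF Q_continuous[of a]] unfolding F_def Qk .
  have F0: "F z = 0" if "z \<in> ball 0 \<delta>" for z
  proof (rule odd_eq_0_if_annihilates_odd_bumps[OF F_cont F_odd _ that])
    fix r :: real and z :: "real ^ 'n" assume r: "r > 0" "norm z + r < \<delta>"
    define u0 where "u0 x = bump r z x - bump r (- z) x" for x
    have A: "u0 \<in> odd_data \<Omega> \<delta>" unfolding u0_def using bump_odd_data(1)[OF r ball(2)] .
    define \<rho> where "\<rho> = norm z + r"
    have u0z: "u0 x = 0" if "\<rho> < norm x" for x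
      using bump_odd_data(2)[OF r ball(2)] that unfolding u0_def \<rho>_def by simp
    have b: "bdd_C11 u0" unfolding u0_def[abs_def] by (intro bdd_C11_diff bump_bdd_C11 r)
    have [measurable]: "u0 \<in> borel_measurable borel" by (rule bdd_C11_borel[OF b])
    obtain C where C: "\<And>x. \<bar>u0 x\<bar> \<le> C" using b by (rule bdd_C11E) blast
    have u0i: "integrable lborel u0"
      by (rule integrable_bounded_support[OF _ C bounded_cball[of 0 \<rho>]]) (use u0z in auto)
    have wf: "w y * frac_lap s u0 y = - 2 * (LINT z|lborel. w y * (u0 z * k (z - y)))" for y
    proof (cases "norm y < \<delta>")
      case True then show ?thesis using w_in by simp
    next
      case False
      then have "frac_lap s u0 y = - 2 * (LINT z|lborel. u0 z * k (z - y))"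
        using frac_lap_outside_support[OF s b u0z, of \<rho> y] r unfolding \<rho>_def k_def a_def by simp
      then show ?thesis by simp
    qed
    \<comment> \<open>On the supports the kernel is bounded: |y| \<ge> \<delta> for \<open>w\<close>
      and |z| \<le> \<rho> < \<delta> for \<open>u0\<close>, so the distance is at least \<delta> -
      \<rho>.\<close>
    have pi: "integrable (lborel \<Otimes>\<^sub>M lborel) (\<lambda>(y, z). w y * (u0 z * k (z - y)))"
    proof (rule Bochner_Integration.integrable_bound)
      show "integrable (lborel \<Otimes>\<^sub>M lborel) (\<lambda>(y, z). (\<bar>w y\<bar> * (\<delta> - \<rho>) powr (- a)) * \<bar>u0 z\<bar>)"
        by (intro integrable_lborel_pair_mult integrable_mult_left integrable_abs integrable_w u0i)
      show "AE p in lborel \<Otimes>\<^sub>M lborel. norm (case p of (y, z) \<Rightarrow> w y * (u0 z * k (z - y)))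
         \<le> norm (case p of (y, z) \<Rightarrow> (\<bar>w y\<bar> * (\<delta> - \<rho>) powr (- a)) * \<bar>u0 z\<bar>)"
      proof (rule AE_I2, clarify)
        fix y z :: "real ^ 'n"
        show "norm (w y * (u0 z * k (z - y))) \<le> norm ((\<bar>w y\<bar> * (\<delta> - \<rho>) powr (- a)) * \<bar>u0 z\<bar>)"
        proof (cases "norm y < \<delta> \<or> \<rho> < norm z")
          case True then show ?thesis using w_in u0z by auto
        next
          case False
          have "\<delta> - \<rho> \<le> norm (z - y)" using False norm_triangle_ineq2[of y z] by (simp add: norm_minus_commute)
          then have "norm (z - y) powr (- a) \<le> (\<delta> - \<rho>) powr (- a)"
            using r s unfolding \<rho>_def a_def by (intro powr_mono2') auto
          then have "k (z - y) \<le> (\<delta> - \<rho>) powr (- a)" unfolding k_def by (simp add: powr_minus inverse_eq_divide)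
          then have "(\<bar>w y\<bar> * \<bar>u0 z\<bar>) * k (z - y) \<le> (\<bar>w y\<bar> * \<bar>u0 z\<bar>) * (\<delta> - \<rho>) powr (- a)"
            by (intro mult_left_mono) auto
          then show ?thesis using k_nn by (simp add: abs_mult mult_ac)
        qed
      qed
    qed measurable
    have "0 = (LINT y|lborel. w y * frac_lap s u0 y)"
    proof -
      have fo: "frac_lap s u0 (- y) = - frac_lap s u0 y" for y
        by (rule frac_lap_odd) (simp add: u0_def bump_uminus)
      have i1: "integrable lborel (\<lambda>y. m y * frac_lap s u0 y)"
        by (rule integrable_mult_frac_lap[OF s b mi])
      have e: "w y * frac_lap s u0 y = m y * frac_lap s u0 y + m (- y) * frac_lap s u0 (- y)" for y
        unfolding fo w_def by (simp add: left_diff_distrib)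
      have "(LINT y|lborel. w y * frac_lap s u0 y) =
          (LINT y|lborel. m y * frac_lap s u0 y) + (LINT y|lborel. m (- y) * frac_lap s u0 (- y))"
        unfolding e by (rule Bochner_Integration.integral_add[OF i1 integrable_lborel_uminus[OF i1]])
      also have "(LINT y|lborel. m (- y) * frac_lap s u0 (- y)) = (LINT y|lborel. m y * frac_lap s u0 y)"
        by (rule integral_lborel_uminus)
      finally show ?thesis using int0[OF A] by simp
    qed
    also have "\<dots> = - 2 * (LINT y|lborel. LINT z|lborel. w y * (u0 z * k (z - y)))"
      unfolding wf by (rule integral_mult_right_zero)
    also have "(LINT y|lborel. LINT z|lborel. w y * (u0 z * k (z - y))) =
        (LINT z|lborel. LINT y|lborel. w y * (u0 z * k (z - y)))"
      using lborel_pair.Fubini_integral[OF pi] by simp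
    also have "(\<lambda>z. LINT y|lborel. w y * (u0 z * k (z - y))) = (\<lambda>z. u0 z * F z)"
      unfolding F_def mult.left_commute[of _ "u0 _"] by simp
    finally show "(LINT x|lborel. (bump r z x - bump r (- z) x) * F x) = 0"
      unfolding u0_def by simp
  qed
  \<comment> \<open>The distance to the complement of \<open>V\<close> is continuous and positive
    exactly on \<open>V\<close>, so negative values of \<open>w\<close> elsewhere do no
    harm.\<close>
  define \<psi> where "\<psi> y = infdist y (- V)" for y
  have \<psi>c: "continuous_on S \<psi>" for S unfolding \<psi>_def by (intro continuous_intros)
  have "V \<noteq> UNIV" using V(3) \<Omega>(2) not_bounded_UNIV bounded_subset by metis
  then have ne: "- V \<noteq> {}" by auto
  have w_pos: "0 < w y" if y: "y \<in> V" for y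
  proof -
    \<comment> \<open>If y were in the ball of radius \<delta>, so would be -y, which is not in
      \<Omega>. Hence \<open>V\<close> avoids the region cut out of \<open>m\<close>.\<close>
    have "\<delta> \<le> norm y" using VO[OF y] ball(2) by force
    then have "m y = k y" "k y > 0" using y V(3) ball(1) unfolding m_def k_def by (auto simp: indicator_def)
    moreover have "m (- y) = 0" using VO[OF y] unfolding m_def by simp
    ultimately show ?thesis unfolding w_def by simp
  qed
  have \<psi>0: "\<psi> y = 0" if "y \<notin> V" for y unfolding \<psi>_def using that by (intro infdist_zero) auto
  have "(LINT y|lborel. w y * \<psi> y) = 0"
  proof (rule vanish_continuous[of a, OF _ _ _ \<psi>c])
    show "(LINT y|lborel. w y * Q a (z - y)) = 0" if "z \<in> ball 0 \<delta>" for z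
      using F0[OF that] unfolding F_def Qk .
  qed (use s in \<open>auto simp: a_def\<close>)
  moreover have "0 \<le> w y * \<psi> y" for y
    using w_pos[of y] \<psi>0[of y] infdist_nonneg[of y "- V"] unfolding \<psi>_def[symmetric]
    by (cases "y \<in> V") auto
  ultimately have "AE y in lborel. w y * \<psi> y = 0"
    using integral_nonneg_eq_0_iff_AE[OF integrable_mult_continuous[OF \<psi>c]] by simp
  then have "AE y in lborel. y \<in> V \<longrightarrow> \<psi> y \<le> 0"
  proof eventually_elim
    case (elim y)
    then show ?case using w_pos[of y] by auto
  qed
  moreover obtain y where y: "y \<in> V" using V(2) by blast
  ultimately have "\<psi> y \<le> 0" by (rule nonpos_if_AE_nonpos[OF _ V(1) \<psi>c])
  then have "\<psi> y = 0" unfolding \<psi>_def using infdist_nonneg[of y "- V"] by simp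
  then show False
    using in_closed_iff_infdist_zero[of "- V" y] V(1) ne y unfolding \<psi>_def by auto
qed

theorem theorem3p6:
  fixes s \<delta> :: real
    and \<Omega> :: "(real ^ 'n) set"
    and u :: "(real ^ 'n \<Rightarrow> real) \<Rightarrow> real ^ 'n \<Rightarrow> real \<Rightarrow> real"
  assumes "0 < s" and "s < 1"
    and "is_domain \<Omega>" and "bounded \<Omega>" and "C11_boundary \<Omega>"
    and "star_shaped_origin \<Omega>"
    and "0 < \<delta>" and "ball 0 \<delta> \<subseteq> \<Omega>"
    and "\<And>u0. u0 \<in> odd_data \<Omega> \<delta> \<Longrightarrow> frac_heat_solution s \<Omega> u0 (u u0)"
  shows "(\<forall>t>0. \<forall>u0\<in>odd_data \<Omega> \<delta>. u u0 0 t = 0) \<longleftrightarrow> centrosymmetric \<Omega>"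
proof
  have \<Omega>: "open \<Omega>" using assms(3) by (simp add: is_domain_def)
  show "centrosymmetric \<Omega>" if "\<forall>t>0. \<forall>u0\<in>odd_data \<Omega> \<delta>. u u0 0 t = 0"
    by (rule not_vanishing_if_not_centrosymmetric[OF assms(1,2) \<Omega> assms(4,5,7,8,9)]) (use that in auto)
  show "\<forall>t>0. \<forall>u0\<in>odd_data \<Omega> \<delta>. u u0 0 t = 0" if sym: "centrosymmetric \<Omega>"
  proof (intro allI impI ballI)
    fix t :: real and u0 assume t: "t > 0" and A: "u0 \<in> odd_data \<Omega> \<delta>"
    obtain "smooth_on UNIV u0" "\<And>x. \<delta> \<le> norm x \<Longrightarrow> u0 x = 0" "\<And>x. u0 (- x) = - u0 x"
      using odd_dataE[OF A] by blast
    note u0 = this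
    have b: "bdd_C11 u0" by (rule smooth_bdd_C11[OF u0(1), of \<delta>]) (use u0(2) in auto)
    have "0 \<in> \<Omega>" using assms(7,8) by auto
    \<comment> \<open>The origin is its own reflection, so both signs together bound 2 u(0, t) by 0
      from above and below.\<close>
    then have le: "\<sigma> * (u u0 0 t + u u0 (- 0) t) \<le> 0" if "\<sigma>\<^sup>2 = 1" for \<sigma>
      using heat_solution_odd_nonpos[OF assms(1,2) \<Omega> assms(4) assms(9)[OF A] b _ u0(3) t _ that] sym
      unfolding centrosymmetric_def by blast
    show "u u0 0 t = 0" using le[of 1] le[of "- 1"] by simp
  qed
qed

end
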